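(* Let $\lambda\in\mathbb{D}\setminus\mathcal{E}$ be with $\arg\lambda\notin\pi\mathbb{Q}$, let $\Lambda$ be a finite nonempty set, and let $\mathbf{a}=(a_i)_{i\in\Lambda}\in\mathbb{C}^{\Lambda}$ be such that $\mathcal{F}_{\lambda,\mathbf{a}}$ satisfies the SSC. Set $K=K_{\lambda,\mathbf{a}}$ and $s=\dim_{H}K$, and assume $s>1$. For $z\in S$ and $x\in\mathbb{R}$ write $K_{z,x}=K\cap P_{z}^{-1}\{x\}$. Then: (1) for each $z\in S$, \[ \dim_{H}K_{z,P_{z}w}=s-1\ \text{ and }\ \mathcal{P}^{s-1}(K_{z,P_{z}w})>0\quad\text{for }\mathcal{H}^{s}\text{-a.e. }w\in K; \] (2) there exists $c>0$ such that for every $z\in S$, \[ \mathcal{L}\{x\in\mathbb{R}:\dim_{H}K_{z,x}=s-1\text{ and }\mathcal{P}^{s-1}(K_{z,x})>0\}>c. \]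
   Context: $\mathbb{D}=\{z\in\mathbb{C}:|z|<1\}$, $S=\{z\in\mathbb{C}:|z|=1\}$; the condition $\arg\lambda\notin\pi\mathbb{Q}$ includes $\lambda\neq0$. $\mathcal{L}$ is Lebesgue measure on $\mathbb{R}$; $\mathcal{H}^{t}$ and $\mathcal{P}^{t}$ are the $t$-dimensional Hausdorff and packing measures; $\dim_H$ is Hausdorff dimension. $\mathbb{P}_{\Lambda}=\{(p_i)_{i\in\Lambda}\in(0,1)^{\Lambda}:\sum_{i}p_i=1\}$. $P_z:\mathbb{C}\to\mathbb{R}$ is $P_zw=\mathrm{Re}(z\overline{w})$. Self-similar objects: $\mathcal{F}_{\lambda,\mathbf{a}}=\{f_i(w)=\lambda w+a_i\}_{i\in\Lambda}$ is an IFS on $\mathbb{C}$; $K_{\lambda,\mathbf{a}}$ is its attractor, the unique nonempty compact set with $K_{\lambda,\mathbf{a}}=\bigcup_{i\in\Lambda}f_i(K_{\lambda,\mathbf{a}})$; for $p\in\mathbb{P}_\Lambda$, $\nu_{\lambda,\mathbf{a}}^{p}$ is the unique compactly supported Borel probability measure on $\mathbb{C}$ with $\nu_{\lambda,\mathbf{a}}^{p}=\sum_{i}p_i\cdot f_i\nu_{\lambda,\mathbf{a}}^{p}$ (push-forwards). The strong separation condition (SSC) means that the sets $f_i(K_{\lambda,\mathbf{a}})$, $i\in\Lambda$, are pairwise disjoint. Exceptional set: for a compactly supported Borel probability measure $\mu$ on $\mathbb{C}$, $\widehat{\mu}(\xi)=\int e^{i\,\mathrm{Re}(\xi\overline{w})}d\mu(w)$.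 $\mathcal{E}'\subset\mathbb{D}$ is a fixed set with $\dim_H\mathcal{E}'=0$ (its existence is a known theorem of Shmerkin and Solomyak) such that: for every $\lambda\in\mathbb{D}\setminus(\mathcal{E}'\cup\mathbb{R})$, every finite nonempty set $\Lambda$, every $\mathbf{a}\in\mathbb{C}^\Lambda$ with not all $a_i$ equal and every $p\in\mathbb{P}_\Lambda$, there are $C,\gamma>0$ with $|\widehat{\nu_{\lambda,\mathbf{a}}^{p}}(\xi)|\le C|\xi|^{-\gamma}$ for all $0\neq\xi\in\mathbb{C}$. Then $\mathcal{E}=\bigcup_{k\ge1}\{\lambda\in\mathbb{D}:\lambda^k\in\mathcal{E}'\}$, which satisfies $\dim_H\mathcal{E}=0$. *)

theory Defs
  imports "HOL-Probability.Probability"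
begin

text \<open>
  Hausdorff and packing measures are outer measures, defined on all subsets of a metric space.
\<close>

text \<open>
  The case distinction is needed because \<^term>\<open>0 powr 0 = (0::real)\<close>, whereas the
  \<open>0\<close>-dimensional Hausdorff measure counts points: a nonempty set of diameter \<open>0\<close> has gauge
  \<open>1\<close> for \<open>t = 0\<close>.
\<close>

definition diam_gauge :: "real \<Rightarrow> 'a::metric_space set \<Rightarrow> ennreal" where
  "diam_gauge t U =
     (if U = {} then 0 else if t = 0 then 1 else ennreal (diameter U powr t))"

text \<open>Boundedness is required explicitly since \<^const>\<open>diameter\<close> is arbitrary on unbounded sets.\<close>

definition hausdorff_premeasure :: "real \<Rightarrow> real \<Rightarrow> 'a::metric_space set \<Rightarrow> ennreal" where
  "hausdorff_premeasure t \<delta> A =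
     (INF U \<in> {U :: nat \<Rightarrow> 'a set. A \<subseteq> (\<Union>i. U i) \<and> (\<forall>i. bounded (U i) \<and> diameter (U i) \<le> \<delta>)}.
        \<Sum>i. diam_gauge t (U i))"

definition hausdorff_measure :: "real \<Rightarrow> 'a::metric_space set \<Rightarrow> ennreal" where
  "hausdorff_measure t A = (SUP \<delta> \<in> {0<..}. hausdorff_premeasure t \<delta> A)"

text \<open>
  In a Euclidean space every \<open>t\<close> above the dimension of the space belongs to the set below, so
  the real infimum is the usual one.
\<close>

definition hausdorff_dim :: "'a::euclidean_space set \<Rightarrow> real" where
  "hausdorff_dim A = Inf {t. 0 \<le> t \<and> hausdorff_measure t A = 0}"

text \<open>
  A \<open>\<delta>\<close>-packing of \<open>A\<close> is a family of disjoint closed balls with centres in \<open>A\<close> and diameters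
  at most \<open>\<delta>\<close>; balls are encoded as pairs of centre and radius.
\<close>

definition packings :: "real \<Rightarrow> 'a::euclidean_space set \<Rightarrow> ('a \<times> real) set set" where
  "packings \<delta> A =
     {I. (\<forall>(x, r) \<in> I. x \<in> A \<and> 0 < r \<and> 2 * r \<le> \<delta>) \<and>
         disjoint_family_on (\<lambda>(x, r). cball x r) I}"

definition packing_premeasure :: "real \<Rightarrow> 'a::euclidean_space set \<Rightarrow> ennreal" where
  "packing_premeasure t A =
     (INF \<delta> \<in> {0<..}. SUP I \<in> packings \<delta> A. \<Sum>\<^sub>\<infinity>(x, r)\<in>I. ennreal ((2 * r) powr t))"

definition packing_measure :: "real \<Rightarrow> 'a::euclidean_space set \<Rightarrow> ennreal" where
  "packing_measure t A =
     (INF B \<in> {B :: nat \<Rightarrow> 'a set. A \<subseteq> (\<Union>i. B i)}. \<Sum>i. packing_premeasure t (B i))"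

definition ifs_map :: "complex \<Rightarrow> ('i \<Rightarrow> complex) \<Rightarrow> 'i \<Rightarrow> complex \<Rightarrow> complex" where
  "ifs_map lam a i w = lam * w + a i"

text \<open>
  For \<open>cmod lam < 1\<close> and finite nonempty \<open>L\<close>, there is exactly one such \<open>K\<close>
  (and below, for a probability vector \<open>p\<close>, exactly one such \<open>\<nu>\<close>).
\<close>

definition is_attractor :: "'i set \<Rightarrow> complex \<Rightarrow> ('i \<Rightarrow> complex) \<Rightarrow> complex set \<Rightarrow> bool" where
  "is_attractor L lam a K \<longleftrightarrow>
     compact K \<and> K \<noteq> {} \<and> K = (\<Union>i\<in>L. ifs_map lam a i ` K)"

definition strong_separation ::
    "'i set \<Rightarrow> complex \<Rightarrow> ('i \<Rightarrow> complex) \<Rightarrow> complex set \<Rightarrow> bool" where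
  "strong_separation L lam a K \<longleftrightarrow> disjoint_family_on (\<lambda>i. ifs_map lam a i ` K) L"

definition prob_vectors :: "'i set \<Rightarrow> ('i \<Rightarrow> real) set" where
  "prob_vectors L = {p. (\<forall>i\<in>L. 0 < p i \<and> p i < 1) \<and> (\<Sum>i\<in>L. p i) = 1}"

definition compactly_supported_prob :: "complex measure \<Rightarrow> bool" where
  "compactly_supported_prob \<nu> \<longleftrightarrow>
     prob_space \<nu> \<and> sets \<nu> = sets borel \<and> (\<exists>C. compact C \<and> emeasure \<nu> (- C) = 0)"

definition is_self_similar_measure ::
    "'i set \<Rightarrow> complex \<Rightarrow> ('i \<Rightarrow> complex) \<Rightarrow> ('i \<Rightarrow> real) \<Rightarrow> complex measure \<Rightarrow> bool" where
  "is_self_similar_measure L lam a p \<nu> \<longleftrightarrow>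
     compactly_supported_prob \<nu> \<and>
     (\<forall>B \<in> sets borel. emeasure \<nu> B =
        (\<Sum>i\<in>L. ennreal (p i) * emeasure (distr \<nu> borel (ifs_map lam a i)) B))"

definition fourier_transform :: "complex measure \<Rightarrow> complex \<Rightarrow> complex" where
  "fourier_transform \<mu> \<xi> = (\<integral>w. exp (\<i> * complex_of_real (Re (\<xi> * cnj w))) \<partial>\<mu>)"

text \<open>
  Index sets range over the finite nonempty sets of natural numbers; up to relabelling these are
  all finite nonempty index sets.
\<close>

definition fourier_decay_outside :: "complex set \<Rightarrow> bool" where
  "fourier_decay_outside E' \<longleftrightarrow>
     (\<forall>lam \<in> ball 0 1 - (E' \<union> \<real>).
      \<forall>(L :: nat set) (a :: nat \<Rightarrow> complex). \<forall>p \<in> prob_vectors L. \<forall>\<nu>.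
        finite L \<longrightarrow> L \<noteq> {} \<longrightarrow> (\<exists>i\<in>L. \<exists>j\<in>L. a i \<noteq> a j) \<longrightarrow>
        is_self_similar_measure L lam a p \<nu> \<longrightarrow>
        (\<exists>C > 0. \<exists>\<gamma> > 0. \<forall>\<xi>. \<xi> \<noteq> 0 \<longrightarrow>
           cmod (fourier_transform \<nu> \<xi>) \<le> C * cmod \<xi> powr (- \<gamma>)))"

definition exceptional_set :: "complex set \<Rightarrow> complex set" where
  "exceptional_set E' = (\<Union>k\<in>{1::nat..}. {lam \<in> ball 0 1. lam ^ k \<in> E'})"

definition proj :: "complex \<Rightarrow> complex \<Rightarrow> real" where
  "proj z w = Re (z * cnj w)"

definition slice :: "complex set \<Rightarrow> complex \<Rightarrow> real \<Rightarrow> complex set" where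
  "slice K z x = K \<inter> proj z -` {x}"

end

theory Submission
  imports Defs
begin

text \<open>
  Let \<open>n\<close> be the number of maps, \<open>s = log n / log (1 / |lam|)\<close>, and let \<open>\<eta>\<close> be the self-similar measure
  with equal weights. Splitting a word into its letters at the multiples of \<open>k\<close> and the blocks between
  them exhibits \<open>\<eta>\<close> as a convolution of a self-similar measure for \<open>lam^k\<close>, whose Fourier transform
  decays, with one for the blocks, whose projections have \<open>L^2\<close>-dimension almost \<open>1\<close> in every direction:
  by irrationality of the rotation, the pair counts of the projections are an average over all
  directions, controlled by the energy of the planar points. Hence the projections \<open>\<nu>\<close> of \<open>\<eta>\<close> satisfy
  \<open>\<nu>(A)^2 \<le> C Leb(A)\<close>, uniformly in the direction.

  The densities \<open>g_u\<close> of the projected cylinder measures make \<open>u \<mapsto> n^(-|u|) g_u(x)\<close> a mass distribution on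
  the slice over almost every \<open>x\<close>. The bound on \<open>\<nu>\<close>, rescaled to cylinders, shows that for each level
  \<open>k\<close> the words with mass above \<open>T |lam|^(k (s - 1))\<close> carry average mass \<open>O(1 / T)\<close>. A mass distribution
  argument gives the lower bound for the dimension, and Fatou's lemma gives infinitely many good levels
  and thus positive packing measure. The upper bound for the dimension comes from counting the cylinders
  that meet a slice on average.
\<close>

section \<open>Words and pair counts\<close>

text \<open>Neither factor of the convolution would do alone: the decay exponent may be tiny, and
  pair counts give \<open>L^2\<close>-dimension 1 only up to an arbitrarily small loss. Setting the
  loss equal to the decay exponent makes their product square integrable on every line through 0.
  The decay is used for a power of \<open>lam\<close>, which is why all powers have to avoid
  \<open>E'\<close>. The work is done with finite sums over words; the Fejer kernel passes between
  pair counts and integrals, and limits are taken only for the resulting bound on \<nu>(A)^2.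
  Applied to the set where a density exceeds t, that bound limits the mass of this set, which is all
  that the slices require.

  Almost every x is not yet the claim. For (1), the s-dimensional Hausdorff measure of the part of K
  over a set is at most a constant times its \<nu>-measure, so \<nu>-null sets of bad x pull back to
  null sets. For (2), \<open>emeasure\<close> is 0 on nonmeasurable sets, so the set of good x must
  be shown to be Lebesgue measurable: up to a null set it is the set where the density of \<nu> is
  positive, and for this the density may vanish on the projection of K only on a null set.\<close>

definition words :: "'v set \<Rightarrow> nat \<Rightarrow> 'v list set" where
  "words V m = {u. set u \<subseteq> V \<and> length u = m}"

text \<open>The image of 0 under the composition along the word of the maps taking w to
  \<open>b i + c * w\<close>. The digit type is arbitrary because whole blocks of letters will serve
  as digits.\<close>

primrec pt :: "complex \<Rightarrow> ('v \<Rightarrow> complex) \<Rightarrow> 'v list \<Rightarrow> complex" where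
  "pt c b [] = 0"
| "pt c b (i # u) = b i + c * pt c b u"

lemma pt_append: "pt c b (u @ v) = pt c b u + c ^ length u * pt c b v"
  by (induction u) (auto simp: algebra_simps)

lemma words_0 [simp]: "words V 0 = {[]}"
  by (auto simp: words_def)

lemma words_Suc: "words V (Suc m) = (\<lambda>(i, u). i # u) ` (V \<times> words V m)"
  by (auto simp: words_def length_Suc_conv image_iff)

lemma finite_words [simp]: "finite V \<Longrightarrow> finite (words V m)"
  unfolding words_def by (rule finite_lists_length_eq)

lemma card_words: "finite V \<Longrightarrow> card (words V m) = card V ^ m"
  unfolding words_def by (rule card_lists_length_eq)

lemma sum_words_Suc:
  assumes "finite V"
  shows "(\<Sum>u\<in>words V (Suc m). f u) = (\<Sum>i\<in>V. \<Sum>u\<in>words V m. f (i # u))"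
proof -
  have inj: "inj_on (\<lambda>(i, u). i # u) (V \<times> words V m)" by (auto simp: inj_on_def)
  show ?thesis unfolding words_Suc
    by (subst sum.reindex[OF inj]) (simp add: sum.cartesian_product case_prod_unfold)
qed

lemma sum_words_add:
  assumes "finite V"
  shows "(\<Sum>u\<in>words V (m + l). f u) = (\<Sum>u\<in>words V m. \<Sum>v\<in>words V l. f (u @ v))"
proof (induction m arbitrary: f)
  case (Suc m)
  have "(\<Sum>u\<in>words V (Suc m + l). f u) = (\<Sum>i\<in>V. \<Sum>u\<in>words V (m + l). f (i # u))"
    using sum_words_Suc[OF assms] by simp
  then show ?case by (simp add: Suc sum_words_Suc[OF assms])
qed simp

lemma card_words_pos: "finite V \<Longrightarrow> V \<noteq> {} \<Longrightarrow> 0 < card (words V m)"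
  by (simp add: card_words card_gt_0_iff)

lemma cmod_pt_le:
  assumes "cmod c < 1" "set u \<subseteq> V" "\<And>i. i \<in> V \<Longrightarrow> cmod (b i) \<le> B" "0 \<le> B"
  shows "cmod (pt c b u) \<le> B / (1 - cmod c)"
  using assms(2)
proof (induction u)
  case Nil then show ?case using assms by simp
next
  case (Cons i u)
  have "cmod (pt c b (i # u)) \<le> cmod (b i) + cmod c * cmod (pt c b u)"
    by (metis norm_mult norm_triangle_ineq pt.simps(2))
  also have "\<dots> \<le> B + cmod c * (B / (1 - cmod c))"
    using Cons assms by (intro add_mono mult_left_mono) auto
  also have "\<dots> = B / (1 - cmod c)" using assms(1) by (simp add: field_simps)
  finally show ?case .
qed

text \<open>After sorting the values into cells of length \<open>\<delta>\<close>, the number of pairs whose cells differ by \<open>h\<close>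
  is an autocorrelation, hence largest for \<open>h = 0\<close>.\<close>

lemma pair_count_shift:
  fixes y :: "'b \<Rightarrow> real"
  assumes "finite I" "\<delta> > 0"
  shows "(\<Sum>v\<in>I. \<Sum>v'\<in>I. of_bool (\<bar>y v - y v' - t\<bar> \<le> \<delta>) :: real)
       \<le> 4 * (\<Sum>v\<in>I. \<Sum>v'\<in>I. of_bool (\<bar>y v - y v'\<bar> \<le> \<delta>))"
proof -
  define k where "k v = \<lfloor>y v / \<delta>\<rfloor>" for v
  define S :: "int \<Rightarrow> real" where "S h = (\<Sum>v\<in>I. \<Sum>v'\<in>I. of_bool (k v = k v' + h))" for h
  define c :: "int \<Rightarrow> real" where "c j = (\<Sum>v\<in>I. of_bool (k v = j))" for j
  have S_c: "S h = (\<Sum>j\<in>k ` I. c j * c (j + h))" for h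
  proof -
    have "S h = (\<Sum>v'\<in>I. c (k v' + h))" unfolding S_def c_def by (rule sum.swap)
    also have "\<dots> = (\<Sum>j\<in>k ` I. \<Sum>v'\<in>{v\<in>I. k v = j}. c (k v' + h))"
      by (rule sum.image_gen[OF assms(1)])
    also have "\<dots> = (\<Sum>j\<in>k ` I. real (card {v\<in>I. k v = j}) * c (j + h))"
      by (intro sum.cong refl) simp
    also have "\<dots> = (\<Sum>j\<in>k ` I. c j * c (j + h))"
      by (intro sum.cong refl) (auto simp: c_def of_bool_def sum.If_cases assms Int_def)
    finally show ?thesis .
  qed
  have c0: "c j = 0" if "j \<notin> k ` I" for j using that by (auto simp: c_def intro!: sum.neutral)
  have S_le: "S h \<le> S 0" for h
  proof -
    have "S h \<le> (\<Sum>j\<in>k ` I. (c j * c j + c (j + h) * c (j + h)) / 2)"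
      unfolding S_c
    proof (intro sum_mono)
      fix j
      show "c j * c (j + h) \<le> (c j * c j + c (j + h) * c (j + h)) / 2"
        using sum_squares_bound[of "c j" "c (j + h)"] by (simp add: power2_eq_square)
    qed
    also have "\<dots> = (S 0 + (\<Sum>j\<in>k ` I. c (j + h) * c (j + h))) / 2"
      by (simp add: S_c sum.distrib sum_divide_distrib[symmetric] add_divide_distrib)
    also have "(\<Sum>j\<in>k ` I. c (j + h) * c (j + h)) = (\<Sum>j\<in>(\<lambda>j. j + h) ` k ` I. c j * c j)"
      by (subst sum.reindex) (auto simp: inj_on_def)
    also have "\<dots> \<le> (\<Sum>j\<in>(\<lambda>j. j + h) ` k ` I \<union> k ` I. c j * c j)"
      using assms by (intro sum_mono2) auto
    also have "\<dots> = (\<Sum>j\<in>k ` I. c j * c j)"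
      using assms c0 by (intro sum.mono_neutral_right) auto
    also have "\<dots> = S 0" by (simp add: S_c)
    finally show ?thesis by simp
  qed
  \<comment> \<open>If two real coordinates differ by \<open>t / \<delta>\<close> up to 1, the
    difference of their integer parts is one of these four values; hence the factor 4.\<close>
  define H where "H = {\<lfloor>t / \<delta>\<rfloor> - 1 .. \<lfloor>t / \<delta>\<rfloor> + 2}"
  have "(\<Sum>v\<in>I. \<Sum>v'\<in>I. of_bool (\<bar>y v - y v' - t\<bar> \<le> \<delta>) :: real)
      \<le> (\<Sum>v\<in>I. \<Sum>v'\<in>I. \<Sum>h\<in>H. of_bool (k v = k v' + h))"
  proof (intro sum_mono)
    fix v v'
    show "(of_bool (\<bar>y v - y v' - t\<bar> \<le> \<delta>) :: real) \<le> (\<Sum>h\<in>H. of_bool (k v = k v' + h))"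
    proof (cases "\<bar>y v - y v' - t\<bar> \<le> \<delta>")
      case True
      have "\<bar>y v / \<delta> - y v' / \<delta> - t / \<delta>\<bar> = \<bar>y v - y v' - t\<bar> / \<delta>"
        using assms by (simp add: diff_divide_distrib[symmetric])
      also have "\<dots> \<le> 1" using True assms by (simp add: field_simps)
      finally have "\<bar>y v / \<delta> - y v' / \<delta> - t / \<delta>\<bar> \<le> 1" .
      then have "k v - k v' \<in> H" unfolding k_def H_def atLeastAtMost_iff by linarith
      then have "(of_bool (k v = k v' + (k v - k v')) :: real) \<le> (\<Sum>h\<in>H. of_bool (k v = k v' + h))"
        by (intro member_le_sum) (auto simp: H_def)
      then show ?thesis by auto
    qed (simp add: sum_nonneg)
  qed
  also have "\<dots> = (\<Sum>v\<in>I. \<Sum>h\<in>H. \<Sum>v'\<in>I. of_bool (k v = k v' + h))"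
    by (intro sum.cong refl sum.swap)
  also have "\<dots> = (\<Sum>h\<in>H. S h)" unfolding S_def by (rule sum.swap)
  also have "\<dots> \<le> (\<Sum>h\<in>H. S 0)" by (intro sum_mono S_le)
  also have "\<dots> = 4 * S 0" by (simp add: H_def)
  also have "S 0 \<le> (\<Sum>v\<in>I. \<Sum>v'\<in>I. of_bool (\<bar>y v - y v'\<bar> \<le> \<delta>))"
    unfolding S_def
  proof (intro sum_mono)
    fix v v'
    have "\<bar>y v - y v'\<bar> \<le> \<delta>" if "k v = k v'"
    proof -
      have "\<bar>y v / \<delta> - y v' / \<delta>\<bar> \<le> 1" using that unfolding k_def by linarith
      then show ?thesis using assms by (simp add: diff_divide_distrib[symmetric])
    qed
    then show "(of_bool (k v = k v' + 0) :: real) \<le> of_bool (\<bar>y v - y v'\<bar> \<le> \<delta>)" by auto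
  qed
  finally show ?thesis by simp
qed

text \<open>The function \<open>|1 + y + \<dots> + y^(L - 1)|^2\<close> is at least \<open>L^2 / 4\<close> near \<open>y = 1\<close>, while its average
  along an orbit of the rotation tends to \<open>L\<close>, uniformly in the starting point.\<close>

lemma rotation_visits_aux:
  fixes Q :: complex
  assumes Q: "cmod Q = 1" "\<And>k. k > 0 \<Longrightarrow> Q ^ k \<noteq> 1" and "L > 0"
  shows "\<exists>M0. \<forall>w. cmod w = 1 \<longrightarrow> (\<forall>M\<ge>M0.
    (\<Sum>j<M. of_bool (cmod (w * Q ^ j - 1) \<le> 1 / real L) :: real) \<le> 8 * real M / real L)"
proof -
  define F where "F y = (cmod (\<Sum>i<L. y ^ i))\<^sup>2" for y :: complex
  define q where "q i i' = Q ^ i * cnj Q ^ i'" for i i'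
  \<comment> \<open>The diagonal terms are 2 / 0 = 0. The others bound the geometric sums of the
    nontrivial powers of \<open>Q\<close>, whatever the number of summands.\<close>
  define G where "G = (\<Sum>i<L. \<Sum>i'<L. 2 / cmod (q i i' - 1))"
  have QQ: "Q * cnj Q = 1" using Q by (simp add: complex_norm_square[symmetric])
  have F_low: "(real L)\<^sup>2 / 4 \<le> F y" if y: "cmod y = 1" "cmod (y - 1) \<le> 1 / L" for y
  proof -
    have "cmod (of_nat L - (\<Sum>i<L. y ^ i)) = cmod (\<Sum>i<L. 1 - y ^ i)"
      by (simp add: sum_subtractf)
    also have "\<dots> \<le> (\<Sum>i<L. cmod (1 - y ^ i))" by (rule norm_sum)
    also have "\<dots> \<le> (\<Sum>i<L. real i / L)"
    proof (intro sum_mono)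
      fix i
      have "cmod (1 - y ^ i) \<le> real i * cmod (1 - y)"
        using norm_power_diff[of 1 y i] y by simp
      also have "\<dots> \<le> real i * (1 / L)" using y by (intro mult_left_mono) (auto simp: norm_minus_commute)
      finally show "cmod (1 - y ^ i) \<le> real i / L" by simp
    qed
    also have "\<dots> = (\<Sum>i<L. real i) / L" by (simp add: sum_divide_distrib)
    also have "(\<Sum>i<L. real i) = real L * (real L - 1) / 2"
      by (induction L) (auto simp: field_simps)
    also have "\<dots> / L \<le> L / 2" using \<open>L > 0\<close> by (simp add: field_simps)
    finally have "cmod (of_nat L - (\<Sum>i<L. y ^ i)) \<le> L / 2" .
    moreover have "real L \<le> cmod (of_nat L - (\<Sum>i<L. y ^ i)) + cmod (\<Sum>i<L. y ^ i)"
      using norm_triangle_ineq[of "of_nat L - (\<Sum>i<L. y ^ i)" "\<Sum>i<L. y ^ i"] by simp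
    ultimately have "L / 2 \<le> cmod (\<Sum>i<L. y ^ i)" by simp
    then have "(L / 2)\<^sup>2 \<le> F y" unfolding F_def by (intro power_mono) auto
    then show ?thesis by (simp add: power_divide)
  qed
  have F_sum: "(\<Sum>j<M. F (w * Q ^ j)) \<le> L * real M + G" if w: "cmod w = 1" for w M
  proof -
    have F_eq: "complex_of_real (F y) = (\<Sum>i<L. \<Sum>i'<L. y ^ i * cnj y ^ i')" for y
      unfolding F_def complex_norm_square by (simp add: sum_product)
    have "complex_of_real (\<Sum>j<M. F (w * Q ^ j))
        = (\<Sum>j<M. \<Sum>i<L. \<Sum>i'<L. (w * Q ^ j) ^ i * cnj (w * Q ^ j) ^ i')"
      by (simp add: F_eq)
    also have "\<dots> = (\<Sum>i<L. \<Sum>j<M. \<Sum>i'<L. (w * Q ^ j) ^ i * cnj (w * Q ^ j) ^ i')"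
      by (rule sum.swap)
    also have "\<dots> = (\<Sum>i<L. \<Sum>i'<L. \<Sum>j<M. (w * Q ^ j) ^ i * cnj (w * Q ^ j) ^ i')"
      by (intro sum.cong refl sum.swap)
    also have "\<dots> = (\<Sum>i<L. \<Sum>i'<L. w ^ i * cnj w ^ i' * (\<Sum>j<M. q i i' ^ j))"
      by (simp add: sum_distrib_left q_def power_mult_distrib power_mult[symmetric] mult_ac)
    finally have eq: "complex_of_real (\<Sum>j<M. F (w * Q ^ j)) = \<dots>" .
    have "(\<Sum>j<M. F (w * Q ^ j)) = cmod (complex_of_real (\<Sum>j<M. F (w * Q ^ j)))"
      unfolding norm_of_real by (simp add: sum_nonneg F_def)
    also have "\<dots> \<le> (\<Sum>i<L. cmod (\<Sum>i'<L. w ^ i * cnj w ^ i' * (\<Sum>j<M. q i i' ^ j)))"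
      unfolding eq by (rule norm_sum)
    also have "\<dots> \<le> (\<Sum>i<L. \<Sum>i'<L. cmod (w ^ i * cnj w ^ i' * (\<Sum>j<M. q i i' ^ j)))"
      by (intro sum_mono norm_sum)
    also have "\<dots> = (\<Sum>i<L. \<Sum>i'<L. cmod (\<Sum>j<M. q i i' ^ j))"
      by (simp add: norm_mult norm_power w)
    also have "\<dots> \<le> (\<Sum>i<L. \<Sum>i'<L. of_bool (i = i') * real M + 2 / cmod (q i i' - 1))"
    proof (intro sum_mono)
      fix i i'
      have nq: "cmod (q i i') = 1" using Q by (simp add: q_def norm_mult norm_power)
      show "cmod (\<Sum>j<M. q i i' ^ j) \<le> of_bool (i = i') * real M + 2 / cmod (q i i' - 1)"
      proof (cases "i = i'")
        case True
        then have "q i i' = 1" using QQ by (simp add: q_def power_mult_distrib[symmetric])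
        then show ?thesis using True by simp
      next
        case False
        have "q i i' \<noteq> 1"
        proof
          assume "q i i' = 1"
          then have "Q ^ i' = Q ^ i * (Q * cnj Q) ^ i'"
            by (simp add: q_def power_mult_distrib mult_ac)
          then have e: "Q ^ i = Q ^ i'" using QQ by simp
          have nz: "Q \<noteq> 0" using Q by auto
          have "Q ^ (max i i' - min i i') = 1"
            using e nz by (cases "i \<le> i'") (auto simp: power_diff max_def min_def)
          then show False using Q(2)[of "max i i' - min i i'"] False by (auto simp: max_def min_def split: if_splits)
        qed
        then have "cmod (\<Sum>j<M. q i i' ^ j) = cmod (q i i' ^ M - 1) / cmod (q i i' - 1)"
          by (simp add: geometric_sum norm_divide)
        also have "\<dots> \<le> 2 / cmod (q i i' - 1)"
          using norm_triangle_ineq4[of "q i i' ^ M" 1] nq by (intro divide_right_mono) (auto simp: norm_power)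
        finally show ?thesis using False by simp
      qed
    qed
    also have "\<dots> = (\<Sum>i<L. real M) + G"
      unfolding G_def sum.distrib by (simp add: sum_distrib_right[symmetric])
    finally show ?thesis by simp
  qed
  obtain M0 :: nat where M0: "G / L \<le> real M0" using real_arch_simple by blast
  show ?thesis
  proof (intro exI allI impI)
    fix w :: complex and M assume w: "cmod w = 1" and M: "M0 \<le> M"
    have "(\<Sum>j<M. of_bool (cmod (w * Q ^ j - 1) \<le> 1 / real L) :: real) * ((real L)\<^sup>2 / 4)
        \<le> (\<Sum>j<M. F (w * Q ^ j))"
      unfolding sum_distrib_right
    proof (intro sum_mono)
      fix j
      have "cmod (w * Q ^ j) = 1" using w Q by (simp add: norm_mult norm_power)
      then show "of_bool (cmod (w * Q ^ j - 1) \<le> 1 / real L) * ((real L)\<^sup>2 / 4) \<le> F (w * Q ^ j)"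
        using F_low[of "w * Q ^ j"] by (auto simp: F_def)
    qed
    also have "\<dots> \<le> L * real M + G" by (rule F_sum[OF w])
    also have "\<dots> \<le> 2 * L * real M"
    proof -
      have "G / L \<le> real M" using M0 M by linarith
      then show ?thesis using \<open>L > 0\<close> by (simp add: field_simps)
    qed
    finally show "(\<Sum>j<M. of_bool (cmod (w * Q ^ j - 1) \<le> 1 / real L) :: real) \<le> 8 * real M / real L"
      using \<open>L > 0\<close> by (simp add: field_simps power2_eq_square)
  qed
qed

text \<open>For \<delta> between \<open>\<delta>0\<close> and 1 only the finitely many
  \<open>L\<close> up to \<open>1 / \<delta>0\<close> occur, so one \<open>M0\<close> serves them
  all; for \<delta> at least 1 the trivial count is enough. Rounding \<open>1 / \<delta>\<close>
  down to \<open>L\<close> costs the factor 2.\<close>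

lemma rotation_visits:
  fixes Q :: complex
  assumes Q: "cmod Q = 1" "\<And>k. k > 0 \<Longrightarrow> Q ^ k \<noteq> 1" and "\<delta>0 > 0"
  obtains M0 where "\<And>w M \<delta>. cmod w = 1 \<Longrightarrow> M \<ge> M0 \<Longrightarrow> \<delta> \<ge> \<delta>0 \<Longrightarrow>
    (\<Sum>j<M. of_bool (cmod (w * Q ^ j - 1) \<le> \<delta>) :: real) \<le> 16 * \<delta> * real M"
proof -
  have "\<forall>L. \<exists>M0. L > 0 \<longrightarrow> (\<forall>w. cmod w = 1 \<longrightarrow> (\<forall>M\<ge>M0.
    (\<Sum>j<M. of_bool (cmod (w * Q ^ j - 1) \<le> 1 / real L) :: real) \<le> 8 * real M / real L))"
    using rotation_visits_aux[OF Q] by blast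
  then obtain M1 where M1: "\<And>L w M. L > 0 \<Longrightarrow> cmod w = 1 \<Longrightarrow> M \<ge> M1 L \<Longrightarrow>
    (\<Sum>j<M. of_bool (cmod (w * Q ^ j - 1) \<le> 1 / real L) :: real) \<le> 8 * real M / real L"
    by metis
  define M0 where "M0 = Max (M1 ` {..nat \<lfloor>1 / \<delta>0\<rfloor>})"
  show thesis
  proof (rule that[of M0])
    fix w :: complex and M \<delta> assume a: "cmod w = 1" "M \<ge> M0" "\<delta> \<ge> \<delta>0"
    then have dpos: "\<delta> > 0" using assms by linarith
    show "(\<Sum>j<M. of_bool (cmod (w * Q ^ j - 1) \<le> \<delta>) :: real) \<le> 16 * \<delta> * real M"
    proof (cases "\<delta> \<ge> 1")
      case True
      have "(\<Sum>j<M. of_bool (cmod (w * Q ^ j - 1) \<le> \<delta>) :: real) \<le> (\<Sum>j<M. 1)"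
        by (intro sum_mono) auto
      also have "\<dots> \<le> 16 * \<delta> * real M" using True by (simp add: mult_le_cancel_right1)
      finally show ?thesis .
    next
      case False
      define L where "L = nat \<lfloor>1 / \<delta>\<rfloor>"
      have L: "real L \<le> 1 / \<delta>" "1 / \<delta> < real L + 1" "L > 0"
      proof -
        have "1 \<le> 1 / \<delta>" using False dpos by (simp add: field_simps)
        then have 1: "1 \<le> \<lfloor>1 / \<delta>\<rfloor>" by (simp add: le_floor_iff)
        then have "real L = real_of_int \<lfloor>1 / \<delta>\<rfloor>" unfolding L_def by (simp only: of_nat_nat)
        then show "real L \<le> 1 / \<delta>" "1 / \<delta> < real L + 1" by linarith+
        show "L > 0" using 1 unfolding L_def by simp
      qed
      have "1 / \<delta> \<le> 1 / \<delta>0" using a assms by (intro divide_left_mono) auto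
      then have "L \<le> nat \<lfloor>1 / \<delta>0\<rfloor>" unfolding L_def by (intro nat_mono floor_mono)
      then have "M1 L \<le> M0" unfolding M0_def by (intro Max_ge) auto
      then have *: "(\<Sum>j<M. of_bool (cmod (w * Q ^ j - 1) \<le> 1 / real L) :: real) \<le> 8 * real M / real L"
        using M1[OF L(3) a(1)] a(2) by auto
      have "\<delta> \<le> 1 / real L" using L dpos by (simp add: field_simps)
      then have "(\<Sum>j<M. of_bool (cmod (w * Q ^ j - 1) \<le> \<delta>) :: real)
          \<le> (\<Sum>j<M. of_bool (cmod (w * Q ^ j - 1) \<le> 1 / real L))"
        by (intro sum_mono) auto
      also note *
      also have "8 * real M / real L \<le> 16 * \<delta> * real M"
      proof -
        have "1 / \<delta> < 2 * real L" using L by linarith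
        then have "1 \<le> 2 * \<delta> * real L" using dpos by (simp add: field_simps)
        then have "1 * real M \<le> 2 * \<delta> * real L * real M" by (intro mult_right_mono) auto
        then show ?thesis using L(3) by (simp add: field_simps)
      qed
      finally show ?thesis .
    qed
  qed
qed

text \<open>A small projection means that the unit vector y in direction
  \<open>z * R ^ j * cnj D\<close> is close to i or to -i. Squaring merges the two cases:
  \<open>|y^2 + 1| = 2 * |Re y|\<close>, so these are visits of the rotation by \<open>R^2\<close>
  to a single arc.\<close>

lemma proj_visits:
  fixes R :: complex
  assumes R: "cmod R = 1" "\<And>k. k > 0 \<Longrightarrow> R ^ k \<noteq> 1" and "\<delta>0 > 0"
  obtains M0 where "\<And>z D M \<epsilon>. cmod z = 1 \<Longrightarrow> D \<noteq> 0 \<Longrightarrow> M \<ge> M0 \<Longrightarrow> \<epsilon> / cmod D \<ge> \<delta>0 \<Longrightarrow>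
    (\<Sum>j<M. of_bool (\<bar>proj (z * R ^ j) D\<bar> \<le> \<epsilon>) :: real) \<le> 32 * (\<epsilon> / cmod D) * real M"
proof -
  have "cmod (R\<^sup>2) = 1" "\<And>k. k > 0 \<Longrightarrow> (R\<^sup>2) ^ k \<noteq> 1"
    using R by (auto simp: norm_power power_mult[symmetric])
  from rotation_visits[OF this, of \<delta>0] assms(3)
  obtain M0 where M0: "\<And>w M \<delta>. cmod w = 1 \<Longrightarrow> M \<ge> M0 \<Longrightarrow> \<delta> \<ge> \<delta>0 \<Longrightarrow>
    (\<Sum>j<M. of_bool (cmod (w * (R\<^sup>2) ^ j - 1) \<le> \<delta>) :: real) \<le> 16 * \<delta> * real M" by blast
  show thesis
  proof (rule that[of M0])
    fix z D :: complex and M \<epsilon>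
    assume a: "cmod z = 1" "D \<noteq> 0" "M \<ge> M0" "\<epsilon> / cmod D \<ge> \<delta>0"
    define w where "w = - ((z * cnj D / cmod D)\<^sup>2)"
    have w: "cmod w = 1" using a by (simp add: w_def norm_power norm_mult norm_divide)
    have "\<epsilon> / cmod D > 0" using a assms by linarith
    have "(\<Sum>j<M. of_bool (\<bar>proj (z * R ^ j) D\<bar> \<le> \<epsilon>) :: real)
        \<le> (\<Sum>j<M. of_bool (cmod (w * (R\<^sup>2) ^ j - 1) \<le> 2 * (\<epsilon> / cmod D)))"
    proof (intro sum_mono)
      fix j
      define y where "y = z * R ^ j * cnj D / cmod D"
      have y1: "cmod y = 1" using a R by (simp add: y_def norm_mult norm_power norm_divide)
      have "w * (R\<^sup>2) ^ j - 1 = - (y\<^sup>2 + 1)"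
        by (simp add: w_def y_def power_mult_distrib power_divide power_mult[symmetric] mult_ac)
      also have "y\<^sup>2 + 1 = y * (y + cnj y)"
        using y1 by (simp add: power2_eq_square distrib_left complex_norm_square[symmetric])
      also have "y + cnj y = of_real (2 * Re y)" by (rule complex_add_cnj)
      finally have "cmod (w * (R\<^sup>2) ^ j - 1) = 2 * \<bar>Re y\<bar>" using y1 by (simp add: norm_mult)
      moreover have "Re y = proj (z * R ^ j) D / cmod D"
        unfolding y_def proj_def by (simp only: Re_divide_of_real)
      ultimately show "(of_bool (\<bar>proj (z * R ^ j) D\<bar> \<le> \<epsilon>) :: real)
          \<le> of_bool (cmod (w * (R\<^sup>2) ^ j - 1) \<le> 2 * (\<epsilon> / cmod D))"
        using a by (auto simp: field_simps)
    qed
    also have "\<dots> \<le> 16 * (2 * (\<epsilon> / cmod D)) * real M"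
      using a \<open>\<epsilon> / cmod D > 0\<close> by (intro M0 w) auto
    finally show "(\<Sum>j<M. of_bool (\<bar>proj (z * R ^ j) D\<bar> \<le> \<epsilon>) :: real) \<le> 32 * (\<epsilon> / cmod D) * real M"
      by simp
  qed
qed

text \<open>AM-GM without roots: multiply the inequalities \<open>t \<le> exp (t - 1)\<close> for
  \<open>t = x j / A\<close>.\<close>

lemma prod_le_mean_power:
  fixes x :: "nat \<Rightarrow> real" and A :: real
  assumes "\<And>j. j < M \<Longrightarrow> 0 \<le> x j" "(\<Sum>j<M. x j) \<le> A * M" "A > 0"
  shows "(\<Prod>j<M. x j) \<le> A ^ M"
proof -
  have "(\<Prod>j<M. x j / A) \<le> (\<Prod>j<M. exp (x j / A - 1))"
    using assms exp_ge_add_one_self[of "x _ / A - 1"] by (intro prod_mono) auto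
  also have "\<dots> = exp (\<Sum>j<M. x j / A - 1)" by (simp add: exp_sum)
  also have "\<dots> = exp ((\<Sum>j<M. x j) / A - M)"
    by (simp add: sum_subtractf sum_divide_distrib)
  also have "\<dots> \<le> exp 0" using assms by (simp add: field_simps)
  finally have "(\<Prod>j<M. x j) / A ^ M \<le> 1" by (simp add: prod_dividef)
  then show ?thesis using assms by (simp add: field_simps)
qed

section \<open>Pair counts for projections of a separated digit system\<close>

lemma proj_diff: "proj z (v - w) = proj z v - proj z w"
  by (simp add: proj_def algebra_simps)

lemma proj_add: "proj z (v + w) = proj z v + proj z w"
  by (simp add: proj_def algebra_simps)

lemma proj_scale: "proj (of_real x * z) w = x * proj z w"
  by (simp add: proj_def algebra_simps)

lemma abs_proj_le: "\<bar>proj z w\<bar> \<le> cmod z * cmod w"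
  unfolding proj_def by (metis abs_Re_le_cmod complex_mod_cnj norm_mult)

text \<open>Multiplication by \<open>c\<close> rotates the direction of projection; this is how
  counts in one fixed direction come to involve a whole orbit of directions.\<close>

lemma proj_mult_power:
  assumes "c \<noteq> 0"
  shows "proj z (c ^ m * w) = cmod c ^ m * proj (z * (cnj c / cmod c) ^ m) w"
proof -
  have "of_real (cmod c ^ m) * (z * (cnj c / cmod c) ^ m) * cnj w = z * cnj (c ^ m * w)"
    using assms by (simp add: power_divide)
  then have "proj (of_real (cmod c ^ m) * (z * (cnj c / cmod c) ^ m)) w = proj z (c ^ m * w)"
    unfolding proj_def by (simp only:)
  then show ?thesis by (simp only: proj_scale)
qed

text \<open>To be used with all words of a fixed length as digits. \<open>expand\<close> says that
  the similarity dimension exceeds 1, and \<open>rot\<close> that no positive power of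
  \<open>c\<close> is real.\<close>

locale separated_digits =
  fixes V :: "'v set" and b :: "'v \<Rightarrow> complex" and c :: complex and d :: real
  assumes fin: "finite V"
    and c: "c \<noteq> 0" "cmod c < 1"
    and expand: "1 < real (card V) * cmod c"
    and d: "0 < d"
    and sep: "\<And>i j u v. \<lbrakk>i \<in> V; j \<in> V; i \<noteq> j; set u \<subseteq> V; set v \<subseteq> V; length u = length v\<rbrakk>
        \<Longrightarrow> d \<le> cmod (pt c b (i # u) - pt c b (j # v))"
    and rot: "\<And>k. k > 0 \<Longrightarrow> (c / cnj c) ^ k \<noteq> 1"
begin

definition "r = cmod c"
definition "N = real (card V)"
definition "D0 = (\<Sum>i\<in>V. cmod (b i)) / (1 - r)"
text \<open>Chosen such that \<open>c0 * r + 2 * D0 \<le> c0\<close>: if the projections of two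
  words of length \<open>m + l\<close> are within \<open>c0 * r ^ (m + l)\<close>, those of their
  prefixes of length \<open>m\<close> are within \<open>c0 * r ^ m\<close>.\<close>

definition "c0 = 1 + 2 * D0 / (1 - r)"

definition cnt :: "nat \<Rightarrow> complex \<Rightarrow> real" where
  "cnt m z = (\<Sum>u\<in>words V m. \<Sum>v\<in>words V m.
     of_bool (\<bar>proj z (pt c b u - pt c b v)\<bar> \<le> c0 * r ^ m))"

lemma r: "0 < r" "r < 1" using c by (auto simp: r_def)
lemma N: "1 < N * r" "1 < N"
proof -
  show *: "1 < N * r" using expand by (simp add: N_def r_def)
  have "N * r \<le> N" using r by (simp add: N_def mult_left_le)
  then show "1 < N" using * by simp
qed

lemma cmod_pt: "u \<in> words V m \<Longrightarrow> cmod (pt c b u) \<le> D0"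
  unfolding D0_def r_def words_def
  by (rule cmod_pt_le[OF c(2), where V = V]) (auto intro: member_le_sum fin sum_nonneg)

lemma D0: "0 \<le> D0" using r by (auto simp: D0_def intro!: divide_nonneg_pos sum_nonneg)

lemma c0: "1 \<le> c0" "c0 * r + 2 * D0 \<le> c0"
proof -
  show "1 \<le> c0" using D0 r by (simp add: c0_def)
  have "c0 * (1 - r) = (1 - r) + 2 * D0" using r by (simp add: c0_def distrib_right)
  then show "c0 * r + 2 * D0 \<le> c0" using r by (simp add: right_diff_distrib)
qed

lemma cnt_nonneg: "0 \<le> cnt m z" unfolding cnt_def by (intro sum_nonneg) auto

text \<open>By the choice of \<open>c0\<close> only pairs of close prefixes contribute. For fixed
  prefixes the tails give a pair count in the rotated direction, shifted by the offset of the
  prefixes, and \<open>pair_count_shift\<close> removes the shift at the price of a factor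
  4.\<close>

lemma cnt_submult:
  assumes z: "cmod z = 1" and l: "l > 0"
  shows "cnt (m + l) z \<le> 4 * cnt m z * cnt l (z * (cnj c / r) ^ m)"
proof -
  define z' where "z' = z * (cnj c / r) ^ m"
  have z': "cmod z' = 1" using z r c by (simp add: z'_def norm_mult norm_power norm_divide r_def)
  let ?D = "\<lambda>u v. proj z (pt c b u - pt c b v)"
  have inner: "(\<Sum>u2\<in>words V l. \<Sum>v2\<in>words V l.
        of_bool (\<bar>?D (u1 @ u2) (v1 @ v2)\<bar> \<le> c0 * r ^ (m + l)))
      \<le> of_bool (\<bar>?D u1 v1\<bar> \<le> c0 * r ^ m) * (4 * cnt l z')"
    if w: "u1 \<in> words V m" "v1 \<in> words V m" for u1 v1
  proof -
    have len: "length u1 = m" "length v1 = m" using w by (auto simp: words_def)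
    have eq: "?D (u1 @ u2) (v1 @ v2) = ?D u1 v1 + r ^ m * proj z' (pt c b u2 - pt c b v2)" for u2 v2
    proof -
      have "pt c b (u1 @ u2) - pt c b (v1 @ v2) = (pt c b u1 - pt c b v1) + c ^ m * (pt c b u2 - pt c b v2)"
        by (simp add: pt_append len algebra_simps)
      then show ?thesis using proj_mult_power[OF c(1), of z m] by (simp add: proj_add z'_def r_def)
    qed
    show ?thesis
    proof (cases "\<bar>?D u1 v1\<bar> \<le> c0 * r ^ m")
      case True
      have "(\<Sum>u2\<in>words V l. \<Sum>v2\<in>words V l.
        of_bool (\<bar>?D (u1 @ u2) (v1 @ v2)\<bar> \<le> c0 * r ^ (m + l)) :: real)
        = (\<Sum>u2\<in>words V l. \<Sum>v2\<in>words V l.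
        of_bool (\<bar>proj z' (pt c b u2) - proj z' (pt c b v2) - (- ?D u1 v1 / r ^ m)\<bar> \<le> c0 * r ^ l))"
      proof (intro sum.cong refl arg_cong[where f = of_bool])
        fix u2 v2
        have "?D (u1 @ u2) (v1 @ v2) = r ^ m * (proj z' (pt c b u2) - proj z' (pt c b v2) - (- ?D u1 v1 / r ^ m))"
          unfolding eq using r by (simp add: proj_diff[of z'] field_simps)
        then have "\<bar>?D (u1 @ u2) (v1 @ v2)\<bar>
            = r ^ m * \<bar>proj z' (pt c b u2) - proj z' (pt c b v2) - (- ?D u1 v1 / r ^ m)\<bar>"
          using r by (simp add: abs_mult)
        moreover have "c0 * r ^ (m + l) = r ^ m * (c0 * r ^ l)" by (simp add: power_add)
        ultimately show "(\<bar>?D (u1 @ u2) (v1 @ v2)\<bar> \<le> c0 * r ^ (m + l)) =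
          (\<bar>proj z' (pt c b u2) - proj z' (pt c b v2) - (- ?D u1 v1 / r ^ m)\<bar> \<le> c0 * r ^ l)"
          using r by (simp only: mult_le_cancel_left_pos zero_less_power)
      qed
      also have "\<dots> \<le> 4 * (\<Sum>u2\<in>words V l. \<Sum>v2\<in>words V l.
        of_bool (\<bar>proj z' (pt c b u2) - proj z' (pt c b v2)\<bar> \<le> c0 * r ^ l))"
        using fin c0 r by (intro pair_count_shift) auto
      also have "\<dots> = 4 * cnt l z'" by (simp add: cnt_def proj_diff)
      finally show ?thesis using True by simp
    next
      case False
      have "\<not> \<bar>?D (u1 @ u2) (v1 @ v2)\<bar> \<le> c0 * r ^ (m + l)"
        if w2: "u2 \<in> words V l" "v2 \<in> words V l" for u2 v2
      proof
        assume a: "\<bar>?D (u1 @ u2) (v1 @ v2)\<bar> \<le> c0 * r ^ (m + l)"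
        have "\<bar>proj z' (pt c b u2 - pt c b v2)\<bar> \<le> cmod (pt c b u2 - pt c b v2)"
          using abs_proj_le[of z'] z' by simp
        also have "\<dots> \<le> 2 * D0"
          using norm_triangle_ineq4[of "pt c b u2" "pt c b v2"] cmod_pt[OF w2(1)] cmod_pt[OF w2(2)] by linarith
        finally have 1: "\<bar>r ^ m * proj z' (pt c b u2 - pt c b v2)\<bar> \<le> r ^ m * (2 * D0)"
          using r by (simp add: abs_mult)
        have "r ^ l \<le> r ^ 1" using r l by (intro power_decreasing) auto
        then have "c0 * r ^ l \<le> c0 * r" using c0 by (intro mult_left_mono) auto
        then have "c0 * r ^ l + 2 * D0 \<le> c0" using c0 by linarith
        then have "r ^ m * (c0 * r ^ l + 2 * D0) \<le> r ^ m * c0" using r by (intro mult_left_mono) auto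
        then have "c0 * r ^ (m + l) + r ^ m * (2 * D0) \<le> c0 * r ^ m"
          by (simp add: power_add algebra_simps)
        with a 1 have "\<bar>?D u1 v1\<bar> \<le> c0 * r ^ m" unfolding eq by linarith
        then show False using False by simp
      qed
      then show ?thesis using False by simp
    qed
  qed
  have "cnt (m + l) z = (\<Sum>u1\<in>words V m. \<Sum>u2\<in>words V l. \<Sum>v1\<in>words V m. \<Sum>v2\<in>words V l.
        of_bool (\<bar>?D (u1 @ u2) (v1 @ v2)\<bar> \<le> c0 * r ^ (m + l)))"
    unfolding cnt_def sum_words_add[OF fin] ..
  also have "\<dots> = (\<Sum>u1\<in>words V m. \<Sum>v1\<in>words V m. \<Sum>u2\<in>words V l. \<Sum>v2\<in>words V l.
        of_bool (\<bar>?D (u1 @ u2) (v1 @ v2)\<bar> \<le> c0 * r ^ (m + l)))"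
    by (intro sum.cong refl sum.swap)
  also have "\<dots> \<le> (\<Sum>u1\<in>words V m. \<Sum>v1\<in>words V m.
      of_bool (\<bar>?D u1 v1\<bar> \<le> c0 * r ^ m) * (4 * cnt l z'))"
    by (intro sum_mono inner)
  also have "\<dots> = cnt m z * (4 * cnt l z')" by (simp add: cnt_def sum_distrib_right)
  finally show ?thesis by (simp add: z'_def mult_ac)
qed

lemma inj_pt: "u \<in> words V m \<Longrightarrow> v \<in> words V m \<Longrightarrow> pt c b u = pt c b v \<Longrightarrow> u = v"
proof (induction m arbitrary: u v)
  case (Suc m)
  obtain i u' j v' where uv: "u = i # u'" "v = j # v'" "i \<in> V" "j \<in> V" "u' \<in> words V m" "v' \<in> words V m"
    using Suc.prems by (auto simp: words_Suc)
  have "i = j"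
  proof (rule ccontr)
    assume "i \<noteq> j"
    then have "d \<le> cmod (pt c b u - pt c b v)"
      unfolding uv(1,2) by (intro sep) (use uv in \<open>auto simp: words_def\<close>)
    then show False using d Suc.prems(3) by simp
  qed
  then show ?case using Suc uv c by auto
qed auto

text \<open>Since \<open>1 / 0 = 0\<close>, the diagonal does not contribute.\<close>

lemma energy_bound:
  "\<exists>C>0. \<forall>m. (\<Sum>u\<in>words V m. \<Sum>v\<in>words V m. 1 / cmod (pt c b u - pt c b v)) \<le> C * N ^ (2 * m)"
proof -
  \<comment> \<open>Pairs with equal first letters reproduce the energy with the factor
    \<open>N / r\<close>, which is \<open>q\<close> relative to \<open>N ^ 2\<close>; pairs with
    different ones contribute at most \<open>1 / d\<close> each. \<open>C\<close> solves
    \<open>q * C + 1 / d = C\<close>, and \<open>expand\<close> gives \<open>q < 1\<close>.\<close>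
  define q where "q = 1 / (N * r)"
  have q: "0 < q" "q < 1" using N r by (auto simp: q_def field_simps)
  define C where "C = 1 / (d * (1 - q))"
  have C: "C > 0" "q * C + 1 / d = C" using q d by (auto simp: C_def field_simps)
  let ?E = "\<lambda>m. (\<Sum>u\<in>words V m. \<Sum>v\<in>words V m. 1 / cmod (pt c b u - pt c b v))"
  have "?E m \<le> C * N ^ (2 * m)" for m
  proof (induction m)
    case 0 then show ?case using C by simp
  next
    case (Suc m)
    have "?E (Suc m) = (\<Sum>i\<in>V. \<Sum>u\<in>words V m. \<Sum>j\<in>V. \<Sum>v\<in>words V m. 1 / cmod (pt c b (i # u) - pt c b (j # v)))"
      by (simp only: sum_words_Suc[OF fin])
    also have "\<dots> \<le> (\<Sum>i\<in>V. \<Sum>u\<in>words V m. \<Sum>j\<in>V. \<Sum>v\<in>words V m.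
        of_bool (i = j) * ((1 / r) * (1 / cmod (pt c b u - pt c b v))) + 1 / d)"
    proof (intro sum_mono)
      fix i u j v assume a: "i \<in> V" "u \<in> words V m" "j \<in> V" "v \<in> words V m"
      show "1 / cmod (pt c b (i # u) - pt c b (j # v))
        \<le> of_bool (i = j) * ((1 / r) * (1 / cmod (pt c b u - pt c b v))) + 1 / d"
      proof (cases "i = j")
        case True
        have "pt c b (i # u) - pt c b (j # v) = c * (pt c b u - pt c b v)"
          using True by (simp add: algebra_simps)
        then show ?thesis using True d by (simp add: norm_mult r_def)
      next
        case False
        have "d \<le> cmod (pt c b (i # u) - pt c b (j # v))"
          using a False by (intro sep) (auto simp: words_def)
        then show ?thesis using False d by (auto intro!: divide_left_mono simp: frac_le)
      qed
    qed
    also have "\<dots> = (\<Sum>i\<in>V. \<Sum>j\<in>V. \<Sum>u\<in>words V m. \<Sum>v\<in>words V m.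
        of_bool (i = j) * ((1 / r) * (1 / cmod (pt c b u - pt c b v))) + 1 / d)"
      by (intro sum.cong refl sum.swap)
    also have "\<dots> = (\<Sum>i\<in>V. \<Sum>j\<in>V. of_bool (i = j) * ((1 / r) * ?E m) + N ^ (2 * m) / d)"
      by (simp add: sum.distrib sum_distrib_left card_words[OF fin] N_def power_add mult_2)
    also have "\<dots> = N * ((1 / r) * ?E m) + N * N * (N ^ (2 * m) / d)"
    proof -
      have 1: "(\<Sum>j\<in>V. of_bool (i = j) * X) = X" if "i \<in> V" for X :: real and i
        using that fin by (subst sum.remove[of V i]) (auto intro!: sum.neutral)
      have "(\<Sum>i\<in>V. \<Sum>j\<in>V. of_bool (i = j) * X + Y) = N * X + N * N * Y" for X Y :: real
        by (simp add: sum.distrib 1 N_def distrib_left mult.assoc)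
      then show ?thesis .
    qed
    also have "\<dots> \<le> N * ((1 / r) * (C * N ^ (2 * m))) + N * N * (N ^ (2 * m) / d)"
      using Suc N r by (intro add_right_mono mult_left_mono) auto
    also have "\<dots> = N ^ (2 * Suc m) * (q * C + 1 / d)"
      using N r by (simp add: q_def field_simps)
    also have "\<dots> = C * N ^ (2 * Suc m)" by (simp add: C)
    finally show ?case .
  qed
  then show ?thesis using C(1) by blast
qed

lemma cnt_prod:
  assumes "l > 0"
  shows "cmod z = 1 \<Longrightarrow> cnt (M * l) z \<le> (\<Prod>j<M. 4 * cnt l (z * ((cnj c / r) ^ l) ^ j))"
proof (induction M arbitrary: z)
  case 0
  have "cnt 0 z \<le> 1" by (simp add: cnt_def)
  then show ?case by simp
next
  case (Suc M)
  define z' where "z' = z * (cnj c / r) ^ l"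
  have z': "cmod z' = 1" using Suc.prems r by (simp add: z'_def norm_mult norm_power norm_divide r_def)
  show ?case
  proof (cases "M = 0")
    case True
    have "cnt l z \<le> 4 * cnt l z" using cnt_nonneg[of l z] by simp
    then show ?thesis using True by simp
  next
    case False
    have "cnt (Suc M * l) z \<le> 4 * cnt l z * cnt (M * l) z'"
      using cnt_submult[OF Suc.prems, of "M * l" l] False assms by (simp add: z'_def)
    also have "\<dots> \<le> 4 * cnt l z * (\<Prod>j<M. 4 * cnt l (z' * ((cnj c / r) ^ l) ^ j))"
      using Suc.IH[OF z'] cnt_nonneg by (intro mult_left_mono) auto
    also have "\<dots> = (\<Prod>j<Suc M. 4 * cnt l (z * ((cnj c / r) ^ l) ^ j))"
      by (subst prod.lessThan_Suc_shift) (simp add: z'_def mult.assoc)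
    finally show ?thesis .
  qed
qed

text \<open>The square of the unit vector \<open>cnj c / r\<close> is \<open>cnj c / c\<close>, the
  inverse of the number that occurs in \<open>rot\<close>.\<close>

lemma rotation_not_root:
  assumes "l > 0" "k > 0"
  shows "((cnj c / r) ^ l) ^ k \<noteq> 1"
proof
  assume a: "((cnj c / r) ^ l) ^ k = 1"
  have "(cnj c / r)\<^sup>2 = cnj c / c"
  proof -
    have "complex_of_real r * complex_of_real r = c * cnj c"
      using complex_norm_square[of c] by (simp add: power2_eq_square r_def)
    then have "(cnj c / r)\<^sup>2 = (cnj c * cnj c) / (c * cnj c)"
      unfolding power2_eq_square times_divide_times_eq by (rule arg_cong)
    then show ?thesis using c by simp
  qed
  then have "(cnj c / c) ^ (l * k) = ((cnj c / r)\<^sup>2) ^ (l * k)" by (simp only:)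
  also have "\<dots> = (((cnj c / r) ^ l) ^ k)\<^sup>2"
    by (simp only: power_mult[symmetric]) (simp only: mult_ac)
  also have "\<dots> = 1" using a by simp
  finally have 1: "(cnj c / c) ^ (l * k) = 1" .
  have "(c / cnj c) ^ (l * k) = inverse ((cnj c / c) ^ (l * k))"
    by (simp only: power_inverse[symmetric] inverse_divide)
  then have "(c / cnj c) ^ (l * k) = 1" using 1 by simp
  then show False using rot[of "l * k"] assms by simp
qed

text \<open>By AM-GM the product in \<open>cnt_prod\<close> is at most a power of the mean of \<open>cnt l\<close> over the rotated
  directions; the number of directions nearly orthogonal to a given difference makes this mean an energy.\<close>

lemma cnt_block_bound:
  "\<exists>A>0. \<forall>l>0. \<exists>M0. \<forall>M\<ge>M0. \<forall>z. cmod z = 1 \<longrightarrow> cnt (M * l) z \<le> (A * (r ^ l * N ^ (2 * l))) ^ M"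
proof -
  obtain C where C: "C > 0"
    "\<And>m. (\<Sum>u\<in>words V m. \<Sum>v\<in>words V m. 1 / cmod (pt c b u - pt c b v)) \<le> C * N ^ (2 * m)"
    using energy_bound by meson
  define A where "A = 4 * (1 + 32 * c0 * C)"
  have A: "A > 0" using C c0 by (auto simp: A_def intro!: add_pos_nonneg)
  have "\<exists>M0. \<forall>M\<ge>M0. \<forall>z. cmod z = 1 \<longrightarrow> cnt (M * l) z \<le> (A * (r ^ l * N ^ (2 * l))) ^ M"
    if l: "l > 0" for l
  proof -
    define R where "R = (cnj c / r) ^ l"
    have R: "cmod R = 1" using r by (simp add: R_def norm_power norm_divide r_def)
    have R': "R ^ k \<noteq> 1" if "k > 0" for k using rotation_not_root[OF l that] by (simp add: R_def)
    define \<epsilon> where "\<epsilon> = c0 * r ^ l"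
    have e: "\<epsilon> > 0" using c0 r by (simp add: \<epsilon>_def)
    \<comment> \<open>All differences of points have modulus at most \<open>2 * D0\<close>, so this
      is a lower bound for every ratio \<open>\<epsilon> / cmod D\<close> and one \<open>M0\<close>
      works for all pairs of words.\<close>
    have "\<epsilon> / (2 * D0 + 1) > 0" using e D0 by (intro divide_pos_pos) auto
    from proj_visits[OF R R' this] obtain M0 where M0:
      "\<And>z D M \<epsilon>'. cmod z = 1 \<Longrightarrow> D \<noteq> 0 \<Longrightarrow> M \<ge> M0 \<Longrightarrow> \<epsilon>' / cmod D \<ge> \<epsilon> / (2 * D0 + 1) \<Longrightarrow>
    (\<Sum>j<M. of_bool (\<bar>proj (z * R ^ j) D\<bar> \<le> \<epsilon>') :: real) \<le> 32 * (\<epsilon>' / cmod D) * real M" by blast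
    show ?thesis
    proof (intro exI allI impI)
      fix M z assume M: "M0 \<le> M" and z: "cmod z = 1"
      have "(\<Sum>j<M. 4 * cnt l (z * R ^ j)) = 4 * (\<Sum>j<M. \<Sum>u\<in>words V l. \<Sum>v\<in>words V l.
          of_bool (\<bar>proj (z * R ^ j) (pt c b u - pt c b v)\<bar> \<le> \<epsilon>))"
        by (simp add: cnt_def \<epsilon>_def sum_distrib_left)
      also have "\<dots> = 4 * (\<Sum>u\<in>words V l. \<Sum>j<M. \<Sum>v\<in>words V l.
          of_bool (\<bar>proj (z * R ^ j) (pt c b u - pt c b v)\<bar> \<le> \<epsilon>))"
        by (subst sum.swap) simp
      also have "\<dots> = 4 * (\<Sum>u\<in>words V l. \<Sum>v\<in>words V l. \<Sum>j<M.
          of_bool (\<bar>proj (z * R ^ j) (pt c b u - pt c b v)\<bar> \<le> \<epsilon>))"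
        by (intro arg_cong2[where f = "(*)"] sum.cong refl sum.swap)
      also have "\<dots> \<le> 4 * (\<Sum>u\<in>words V l. \<Sum>v\<in>words V l.
          of_bool (u = v) * real M + 32 * \<epsilon> * real M * (1 / cmod (pt c b u - pt c b v)))"
      proof (intro mult_left_mono sum_mono)
        fix u v assume w: "u \<in> words V l" "v \<in> words V l"
        show "(\<Sum>j<M. of_bool (\<bar>proj (z * R ^ j) (pt c b u - pt c b v)\<bar> \<le> \<epsilon>) :: real)
          \<le> of_bool (u = v) * real M + 32 * \<epsilon> * real M * (1 / cmod (pt c b u - pt c b v))"
        proof (cases "u = v")
          case True
          have "(\<Sum>j<M. of_bool (\<bar>proj (z * R ^ j) (pt c b u - pt c b v)\<bar> \<le> \<epsilon>) :: real) \<le> (\<Sum>j<M. 1)"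
            by (intro sum_mono) auto
          then show ?thesis using True by simp
        next
          case False
          then have D: "pt c b u - pt c b v \<noteq> 0" using inj_pt w by auto
          have "cmod (pt c b u - pt c b v) \<le> 2 * D0 + 1"
            using norm_triangle_ineq4[of "pt c b u" "pt c b v"] cmod_pt[OF w(1)] cmod_pt[OF w(2)] by linarith
          then have "\<epsilon> / (2 * D0 + 1) \<le> \<epsilon> / cmod (pt c b u - pt c b v)"
            using e D D0 by (intro divide_left_mono) auto
          from M0[OF z D M this] show ?thesis using False by (simp add: mult_ac)
        qed
      qed auto
      also have "(\<Sum>u\<in>words V l. \<Sum>v\<in>words V l.
          of_bool (u = v) * real M + 32 * \<epsilon> * real M * (1 / cmod (pt c b u - pt c b v)))
          = N ^ l * real M + 32 * \<epsilon> * real M * (\<Sum>u\<in>words V l. \<Sum>v\<in>words V l. 1 / cmod (pt c b u - pt c b v))"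
        unfolding sum.distrib sum_distrib_left[symmetric]
        by (simp add: sum_distrib_right[symmetric] of_bool_def fin card_words N_def)
      also have "\<dots> \<le> N ^ l * real M + 32 * \<epsilon> * real M * (C * N ^ (2 * l))"
        using e C by (intro add_left_mono mult_left_mono) auto
      \<comment> \<open>The diagonal pairs are dominated by the energy term because
        \<open>N * r > 1\<close>.\<close>
      also have "N ^ l \<le> r ^ l * N ^ (2 * l)"
      proof -
        have "1 \<le> (N * r) ^ l" using N by (intro one_le_power) auto
        then have "N ^ l * 1 \<le> N ^ l * (N * r) ^ l" using N by (intro mult_left_mono) auto
        then show ?thesis
          unfolding mult_2 power_add power_mult_distrib by (simp only: mult_ac mult_1)
      qed
      finally have "(\<Sum>j<M. 4 * cnt l (z * R ^ j)) \<le>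
          4 * (r ^ l * N ^ (2 * l) * real M + 32 * \<epsilon> * real M * (C * N ^ (2 * l)))"
        by (simp add: mult_right_mono)
      also have "\<dots> = A * (r ^ l * N ^ (2 * l)) * real M"
        by (simp add: A_def \<epsilon>_def algebra_simps)
      finally have "(\<Prod>j<M. 4 * cnt l (z * R ^ j)) \<le> (A * (r ^ l * N ^ (2 * l))) ^ M"
        using A r N cnt_nonneg by (intro prod_le_mean_power) (auto intro!: mult_pos_pos)
      moreover have "cnt (M * l) z \<le> (\<Prod>j<M. 4 * cnt l (z * R ^ j))"
        unfolding R_def by (rule cnt_prod[OF l z])
      ultimately show "cnt (M * l) z \<le> (A * (r ^ l * N ^ (2 * l))) ^ M" by simp
    qed
  qed
  then show ?thesis using A by blast
qed

text \<open>A block length \<open>l\<close> with \<open>A \<le> (r powr - \<epsilon>) ^ l\<close>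
  hides the constant \<open>A ^ M\<close> in the loss. The numbers of blocks below \<open>M0\<close>
  are covered by the trivial count and the constant \<open>C\<close>.\<close>

lemma cnt_bound:
  assumes eps: "\<epsilon> > 0"
  obtains l C where "l > 0" "C > 0"
    "\<And>M z. cmod z = 1 \<Longrightarrow> cnt (M * l) z \<le> C * (N ^ (2 * (M * l)) * r ^ (M * l) * (r powr - \<epsilon>) ^ (M * l))"
proof -
  from cnt_block_bound obtain A where "A > 0 \<and> (\<forall>l>0.
      \<exists>M0. \<forall>M\<ge>M0. \<forall>z. cmod z = 1 \<longrightarrow> cnt (M * l) z \<le> (A * (r ^ l * N ^ (2 * l))) ^ M)" ..
  note A = conjunct1[OF this] conjunct2[OF this]
  define t where "t = r powr - \<epsilon>"
  have t: "t > 1" using r eps by (simp add: t_def powr_minus one_less_inverse_iff powr01_less_one)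
  obtain l' where "A < t ^ l'" using real_arch_pow[OF t] by blast
  moreover define l where "l = Suc l'"
  moreover have "t ^ l' \<le> t ^ Suc l'" using t by (intro power_increasing) auto
  ultimately have l: "l > 0" "A \<le> t ^ l" by auto
  obtain M0 where M0: "\<And>M z. M \<ge> M0 \<Longrightarrow> cmod z = 1 \<Longrightarrow> cnt (M * l) z \<le> (A * (r ^ l * N ^ (2 * l))) ^ M"
    using A(2) l(1) by metis
  define C where "C = max 1 (1 / r ^ (M0 * l))"
  show thesis
  proof (rule that[OF l(1), of C])
    show "C > 0" by (simp add: C_def)
    fix M z assume z: "cmod z = 1"
    show "cnt (M * l) z \<le> C * (N ^ (2 * (M * l)) * r ^ (M * l) * (r powr - \<epsilon>) ^ (M * l))"
    proof (cases "M \<ge> M0")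
      case True
      have "cnt (M * l) z \<le> (A * (r ^ l * N ^ (2 * l))) ^ M" by (rule M0[OF True z])
      also have "\<dots> \<le> (t ^ l * (r ^ l * N ^ (2 * l))) ^ M"
        using A l r N by (intro power_mono mult_right_mono) auto
      also have "\<dots> = N ^ (2 * (M * l)) * r ^ (M * l) * t ^ (M * l)"
        by (simp add: power_mult_distrib power_mult[symmetric] mult_ac)
      also have "\<dots> \<le> C * (N ^ (2 * (M * l)) * r ^ (M * l) * t ^ (M * l))"
      proof -
        have "1 * (N ^ (2 * (M * l)) * r ^ (M * l) * t ^ (M * l))
            \<le> C * (N ^ (2 * (M * l)) * r ^ (M * l) * t ^ (M * l))"
          using r N t by (intro mult_right_mono) (auto simp: C_def)
        then show ?thesis by simp
      qed
      finally show ?thesis by (simp add: t_def)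
    next
      case False
      have "cnt (M * l) z \<le> (\<Sum>u\<in>words V (M * l). \<Sum>v\<in>words V (M * l). 1)"
        unfolding cnt_def by (intro sum_mono) auto
      also have "\<dots> = N ^ (2 * (M * l)) * (1 * 1)" by (simp add: card_words fin N_def mult_2 power_add)
      also have "\<dots> \<le> N ^ (2 * (M * l)) * ((C * r ^ (M * l)) * t ^ (M * l))"
      proof (intro mult_left_mono mult_mono)
        have "r ^ (M0 * l) \<le> r ^ (M * l)" using False r by (intro power_decreasing) auto
        then have "1 \<le> 1 / r ^ (M0 * l) * r ^ (M * l)" using r by (simp add: field_simps)
        also have "\<dots> \<le> C * r ^ (M * l)" using r by (intro mult_right_mono) (auto simp: C_def)
        finally show "1 \<le> C * r ^ (M * l)" .
        then show "0 \<le> C * r ^ (M * l)" by simp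
      qed (use t N in \<open>auto intro: one_le_power\<close>)
      finally show ?thesis by (simp add: t_def mult_ac)
    qed
  qed
qed

end

section \<open>Exponential sums\<close>

definition fejer :: "real \<Rightarrow> real \<Rightarrow> real" where
  "fejer R y = integral {0..R} (\<lambda>x. (1 - x / R) * cos (x * y))"

lemma fejer_closed:
  assumes "R > 0" "y \<noteq> 0"
  shows "fejer R y = (1 - cos (R * y)) / (R * y\<^sup>2)"
proof -
  define F where "F x = (1 - x / R) * sin (x * y) / y - cos (x * y) / (R * y\<^sup>2)" for x
  have "((\<lambda>x. (1 - x / R) * cos (x * y)) has_integral (F R - F 0)) {0..R}"
  proof (rule fundamental_theorem_of_calculus)
    fix x assume "x \<in> {0..R}"
    have "(F has_real_derivative (- (1 / R)) * sin (x * y) / y + (1 - x / R) * (cos (x * y) * y) / y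
        + sin (x * y) * y / (R * y\<^sup>2)) (at x within {0..R})"
      unfolding F_def using assms by (auto intro!: derivative_eq_intros simp: field_simps)
    also have "(- (1 / R)) * sin (x * y) / y + (1 - x / R) * (cos (x * y) * y) / y
        + sin (x * y) * y / (R * y\<^sup>2) = (1 - x / R) * cos (x * y)"
      using assms by (simp add: field_simps power2_eq_square)
    finally show "(F has_vector_derivative (1 - x / R) * cos (x * y)) (at x within {0..R})"
      by (simp add: has_real_derivative_iff_has_vector_derivative)
  qed (use assms in auto)
  moreover have "F R - F 0 = (1 - cos (R * y)) / (R * y\<^sup>2)"
    using assms by (simp add: F_def diff_divide_distrib)
  ultimately show ?thesis unfolding fejer_def by (metis integral_unique)
qed

lemma fejer_integrable:
  fixes R y :: real
  shows "R > 0 \<Longrightarrow> (\<lambda>x. (1 - x / R) * cos (x * y)) integrable_on {0..R}"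
  by (intro integrable_continuous_interval continuous_intros) auto

lemma integral_tent:
  fixes R :: real
  assumes "R > 0"
  shows "integral {0..R} (\<lambda>x. 1 - x / R) = R / 2"
proof -
  have "((\<lambda>x. 1 - x / R) has_integral ((R - R\<^sup>2 / (2 * R)) - (0 - 0\<^sup>2 / (2 * R)))) {0..R}"
    using assms by (intro fundamental_theorem_of_calculus)
      (auto intro!: derivative_eq_intros simp: has_real_derivative_iff_has_vector_derivative[symmetric] field_simps)
  then show ?thesis using assms by (simp add: integral_unique power2_eq_square)
qed

lemma fejer_nonneg: "R > 0 \<Longrightarrow> 0 \<le> fejer R y"
  using integral_tent[of R] by (cases "y = 0") (auto simp: fejer_closed, simp add: fejer_def)

text \<open>On the range of integration \<open>|x * y| \<le> 1 < pi / 3\<close>, so the cosine is at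
  least 1/2.\<close>

lemma fejer_lower:
  assumes "R > 0" "\<bar>y\<bar> \<le> 1 / R"
  shows "R / 4 \<le> fejer R y"
proof -
  have "R / 4 = integral {0..R} (\<lambda>x. (1 - x / R) * (1 / 2))"
    using integral_tent[OF assms(1)] by (simp del: times_divide_eq_right)
  also have "\<dots> \<le> fejer R y"
    unfolding fejer_def
  proof (intro integral_le fejer_integrable mult_left_mono assms)
    show "(\<lambda>x. (1 - x / R) * (1 / 2)) integrable_on {0..R}"
      using assms by (intro integrable_continuous_interval continuous_intros) auto
    fix x assume x: "x \<in> {0..R}"
    show "0 \<le> 1 - x / R" using x assms by simp
    have "\<bar>x * y\<bar> \<le> R * (1 / R)" unfolding abs_mult using x assms by (intro mult_mono) auto
    then have xy: "\<bar>x * y\<bar> \<le> 1" using assms by simp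
    have "cos (pi / 3) \<le> cos \<bar>x * y\<bar>"
      using xy pi_gt3 by (intro cos_monotone_0_pi_le) auto
    then show "1 / 2 \<le> cos (x * y)" by (simp add: cos_60)
  qed
  finally show ?thesis .
qed

lemma fejer_upper:
  assumes "R > 0"
  shows "fejer R y \<le> 4 * R / (1 + (R * y)\<^sup>2)"
proof (cases "\<bar>R * y\<bar> \<le> 1")
  case True
  have "fejer R y \<le> integral {0..R} (\<lambda>x. 1 - x / R)"
    unfolding fejer_def
    using assms by (intro integral_le fejer_integrable integrable_continuous_interval continuous_intros)
      (auto intro!: mult_left_le simp: divide_le_eq_1)
  then have 1: "fejer R y \<le> R / 2" using integral_tent[OF assms] by simp
  have "(R * y)\<^sup>2 \<le> 1" using True by (simp add: abs_square_le_1)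
  then have "R / 2 * (1 + (R * y)\<^sup>2) \<le> R / 2 * 2" using assms by (intro mult_left_mono) auto
  then have "R / 2 \<le> 4 * R / (1 + (R * y)\<^sup>2)"
    using assms by (subst pos_le_divide_eq) (auto intro: add_pos_nonneg)
  with 1 show ?thesis by linarith
next
  case False
  then have y: "y \<noteq> 0" by auto
  have "1 \<le> (R * y)\<^sup>2" using False abs_square_le_1[of "R * y"] by linarith
  have "fejer R y = (1 - cos (R * y)) / (R * y\<^sup>2)" by (rule fejer_closed[OF assms y])
  also have "\<dots> \<le> 2 / (R * y\<^sup>2)" using assms cos_ge_minus_one[of "R * y"] by (intro divide_right_mono) auto
  also have "\<dots> = 2 * R / (R * y)\<^sup>2" using assms by (simp add: power2_eq_square)
  also have "\<dots> \<le> 2 * R / ((1 + (R * y)\<^sup>2) / 2)"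
    using assms y \<open>1 \<le> (R * y)\<^sup>2\<close> by (intro divide_left_mono mult_pos_pos) (auto intro: add_pos_nonneg)
  finally show ?thesis by simp
qed

lemma norm_sum_cis_sq:
  "(cmod (\<Sum>u\<in>I. cis (y u)))\<^sup>2 = (\<Sum>u\<in>I. \<Sum>v\<in>I. cos (y u - y v))"
proof -
  have "complex_of_real ((cmod (\<Sum>u\<in>I. cis (y u)))\<^sup>2) = (\<Sum>u\<in>I. \<Sum>v\<in>I. cis (y u - y v))"
    unfolding complex_norm_square by (simp add: sum_product cis_cnj cis_mult)
  then have "Re (complex_of_real ((cmod (\<Sum>u\<in>I. cis (y u)))\<^sup>2)) = Re (\<Sum>u\<in>I. \<Sum>v\<in>I. cis (y u - y v))"
    by (rule arg_cong)
  then show ?thesis by simp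
qed

lemma integral_tent_norm_sum_cis_sq:
  assumes "finite I" "R > 0"
  shows "((\<lambda>x. (1 - x / R) * (cmod (\<Sum>u\<in>I. cis (x * y u)))\<^sup>2) has_integral
     (\<Sum>u\<in>I. \<Sum>v\<in>I. fejer R (y u - y v))) {0..R}"
proof -
  have "((\<lambda>x. \<Sum>u\<in>I. \<Sum>v\<in>I. (1 - x / R) * cos (x * (y u - y v))) has_integral
     (\<Sum>u\<in>I. \<Sum>v\<in>I. fejer R (y u - y v))) {0..R}"
    unfolding fejer_def
    by (intro has_integral_sum assms integrable_integral fejer_integrable assms)
  then show ?thesis
    by (simp add: norm_sum_cis_sq sum_distrib_left right_diff_distrib)
qed

lemma norm_sum_cis_integrable: "(\<lambda>x. (cmod (\<Sum>u\<in>I. cis (x * y u)))\<^sup>2) integrable_on {a..b}"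
  by (intro integrable_continuous_interval continuous_intros)

lemma sum_inverse_square_int:
  "\<exists>Z>0. \<forall>H::int set. finite H \<longrightarrow> (\<Sum>h\<in>H. 1 / (1 + (real_of_int h)\<^sup>2)) \<le> Z"
proof -
  define f where "f k = 1 / (1 + (real k)\<^sup>2)" for k
  have sf: "summable f"
  proof (rule summable_comparison_test)
    show "summable (\<lambda>k. 1 / (real k)\<^sup>2)" using inverse_power_summable[of 2, where 'a = real] by (simp add: field_simps)
    show "\<exists>N. \<forall>n\<ge>N. norm (f n) \<le> 1 / (real n)\<^sup>2"
      by (intro exI[of _ 1]) (auto simp: f_def intro!: divide_left_mono mult_pos_pos add_pos_nonneg)
  qed
  have fpos: "0 \<le> f k" for k by (simp add: f_def)
  define Z where "Z = 2 * suminf f + 1"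
  have "(\<Sum>h\<in>H. 1 / (1 + (real_of_int h)\<^sup>2)) \<le> Z" if H: "finite H" for H :: "int set"
  proof -
    have bd: "(\<Sum>h\<in>G. 1 / (1 + (real_of_int h)\<^sup>2)) \<le> suminf f"
      if "finite G" "inj_on (\<lambda>h. nat \<bar>h\<bar>) G" for G :: "int set"
    proof -
      have "(\<Sum>h\<in>G. 1 / (1 + (real_of_int h)\<^sup>2)) = (\<Sum>k\<in>(\<lambda>h. nat \<bar>h\<bar>) ` G. f k)"
        by (subst sum.reindex[OF that(2)]) (simp add: f_def)
      also have "\<dots> \<le> suminf f" using that fpos by (intro sum_le_suminf sf) auto
      finally show ?thesis .
    qed
    have "(\<Sum>h\<in>H. 1 / (1 + (real_of_int h)\<^sup>2))
        = (\<Sum>h\<in>H \<inter> {0..}. 1 / (1 + (real_of_int h)\<^sup>2)) + (\<Sum>h\<in>H - {0..}. 1 / (1 + (real_of_int h)\<^sup>2))"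
      by (rule sum.Int_Diff[OF H])
    also have "\<dots> \<le> suminf f + suminf f"
      using H by (intro add_mono bd) (auto simp: inj_on_def)
    finally show ?thesis by (simp add: Z_def)
  qed
  moreover have "Z > 0" using suminf_nonneg[OF sf fpos] by (simp add: Z_def)
  ultimately show ?thesis by blast
qed

text \<open>The tent over \<open>{0..2 * R}\<close> is at least 1/2 on \<open>{0..R}\<close>, which
  turns the integral into a sum of kernels over pairs. Pairs are grouped by the integer part
  \<open>h\<close> of \<open>R * (y u - y v)\<close>: every group is at most 4 times the pair count
  at distance \<open>1 / R\<close>, and the kernel contributes the summable weights
  \<open>1 / (1 + h^2)\<close>.\<close>

lemma norm_sum_cis_integral_upper:
  "\<exists>C>0. \<forall>(I::'a set) y R. finite I \<longrightarrow> R > 0 \<longrightarrow> integral {0..R} (\<lambda>x. (cmod (\<Sum>u\<in>I. cis (x * y u)))\<^sup>2)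
    \<le> C * R * (\<Sum>u\<in>I. \<Sum>v\<in>I. of_bool (\<bar>y u - y v\<bar> \<le> 1 / R))"
proof -
  obtain Z where Z: "Z > 0" "\<And>H::int set. finite H \<Longrightarrow> (\<Sum>h\<in>H. 1 / (1 + (real_of_int h)\<^sup>2)) \<le> Z"
    using sum_inverse_square_int by metis
  have "integral {0..R} (\<lambda>x. (cmod (\<Sum>u\<in>I. cis (x * y u)))\<^sup>2)
    \<le> (192 * Z) * R * (\<Sum>u\<in>I. \<Sum>v\<in>I. of_bool (\<bar>y u - y v\<bar> \<le> 1 / R))"
    if I: "finite I" and R: "R > 0" for I :: "'a set" and y and R :: real
  proof -
    define P where "P = (\<Sum>u\<in>I. \<Sum>v\<in>I. of_bool (\<bar>y u - y v\<bar> \<le> 1 / R) :: real)"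
    define f where "f x = (cmod (\<Sum>u\<in>I. cis (x * y u)))\<^sup>2" for x
    have f0: "0 \<le> f x" for x by (simp add: f_def)
    define k where "k u v = \<lfloor>R * (y u - y v)\<rfloor>" for u v
    define H where "H = (\<lambda>(u, v). k u v) ` (I \<times> I)"
    have H: "finite H" using I by (simp add: H_def)
    have int2: "(\<lambda>x. (1 - x / (2 * R)) * f x) integrable_on {0..2 * R}"
      unfolding f_def
      by (rule has_integral_integrable[OF integral_tent_norm_sum_cis_sq[OF I]]) (use R in simp)
    have "integral {0..R} f \<le> integral {0..R} (\<lambda>x. 2 * ((1 - x / (2 * R)) * f x))"
    proof (intro integral_le)
      show "f integrable_on {0..R}" unfolding f_def by (rule norm_sum_cis_integrable)
      have "(\<lambda>x. (1 - x / (2 * R)) * f x) integrable_on {0..R}"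
        by (rule integrable_subinterval_real[OF int2]) (use R in auto)
      then show "(\<lambda>x. 2 * ((1 - x / (2 * R)) * f x)) integrable_on {0..R}"
        by (rule integrable_on_mult_right)
      fix x assume "x \<in> {0..R}"
      then have "1 / 2 \<le> 1 - x / (2 * R)" using R by (simp add: field_simps)
      then have "1 / 2 * f x \<le> (1 - x / (2 * R)) * f x" using f0 by (intro mult_right_mono) auto
      then show "f x \<le> 2 * ((1 - x / (2 * R)) * f x)" by simp
    qed
    also have "\<dots> = 2 * integral {0..R} (\<lambda>x. (1 - x / (2 * R)) * f x)" by simp
    also have "\<dots> \<le> 2 * integral {0..2 * R} (\<lambda>x. (1 - x / (2 * R)) * f x)"
      using R f0 by (intro mult_left_mono integral_subset_le int2 integrable_subinterval_real[OF int2])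
        (auto intro!: mult_nonneg_nonneg simp: divide_le_eq_1)
    also have "\<dots> = 2 * (\<Sum>u\<in>I. \<Sum>v\<in>I. fejer (2 * R) (y u - y v))"
      unfolding f_def using R by (simp add: integral_unique[OF integral_tent_norm_sum_cis_sq[OF I]])
    also have "\<dots> \<le> 2 * (\<Sum>u\<in>I. \<Sum>v\<in>I. \<Sum>h\<in>H. 24 * R * (1 / (1 + (real_of_int h)\<^sup>2)) *
          of_bool (k u v = h))"
    proof (intro mult_left_mono sum_mono)
      fix u v assume uv: "u \<in> I" "v \<in> I"
      define t where "t = R * (y u - y v)"
      have "fejer (2 * R) (y u - y v) \<le> 8 * R / (1 + (2 * t)\<^sup>2)"
        using fejer_upper[of "2 * R" "y u - y v"] R by (simp add: t_def mult.assoc)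
      also have "\<dots> \<le> 8 * R / (1 + t\<^sup>2)"
        using R by (intro divide_left_mono mult_pos_pos) (auto intro: add_pos_nonneg)
      also have "\<dots> \<le> 24 * R * (1 / (1 + (real_of_int (k u v))\<^sup>2))"
      proof -
        define h where "h = real_of_int (k u v)"
        have h: "h \<le> t" "t < h + 1" unfolding h_def k_def t_def by linarith+
        have "\<bar>h\<bar> \<le> \<bar>t\<bar> + 1" using h by linarith
        then have "h\<^sup>2 \<le> (\<bar>t\<bar> + 1)\<^sup>2" by (metis abs_ge_zero abs_le_square_iff abs_of_nonneg add_nonneg_nonneg zero_le_one)
        also have "\<dots> \<le> 2 * t\<^sup>2 + 2" using sum_squares_bound[of "\<bar>t\<bar>" 1] by (simp add: power2_sum)
        also have "\<dots> \<le> 3 * (1 + t\<^sup>2) - 1" by (simp add: distrib_left)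
        finally have "1 + h\<^sup>2 \<le> 3 * (1 + t\<^sup>2)" by simp
        then have "8 * R * (1 + h\<^sup>2) \<le> 8 * R * (3 * (1 + t\<^sup>2))" using R by (intro mult_left_mono) auto
        moreover have "1 + t\<^sup>2 > 0" "1 + h\<^sup>2 > 0" by (auto intro: add_pos_nonneg)
        ultimately show ?thesis unfolding h_def[symmetric] by (simp add: field_simps)
      qed
      also have "\<dots> = 24 * R * (1 / (1 + (real_of_int (k u v))\<^sup>2)) * of_bool (k u v = k u v)" by simp
      also have "\<dots> \<le> (\<Sum>h\<in>H. 24 * R * (1 / (1 + (real_of_int h)\<^sup>2)) * of_bool (k u v = h))"
        using uv H R by (intro member_le_sum[of "k u v" H "\<lambda>h. 24 * R * (1 / (1 + (real_of_int h)\<^sup>2)) * of_bool (k u v = h)"])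
          (auto simp: H_def)
      finally show "fejer (2 * R) (y u - y v) \<le> (\<Sum>h\<in>H. 24 * R * (1 / (1 + (real_of_int h)\<^sup>2)) * of_bool (k u v = h))" .
    qed auto
    also have "\<dots> = 2 * (\<Sum>u\<in>I. \<Sum>h\<in>H. \<Sum>v\<in>I. 24 * R * (1 / (1 + (real_of_int h)\<^sup>2)) * of_bool (k u v = h))"
      by (intro arg_cong2[where f = "(*)"] sum.cong refl sum.swap)
    also have "\<dots> = 2 * (\<Sum>h\<in>H. \<Sum>u\<in>I. \<Sum>v\<in>I. 24 * R * (1 / (1 + (real_of_int h)\<^sup>2)) * of_bool (k u v = h))"
      by (subst sum.swap) simp
    also have "\<dots> = 2 * (\<Sum>h\<in>H. 24 * R * (1 / (1 + (real_of_int h)\<^sup>2)) * (\<Sum>u\<in>I. \<Sum>v\<in>I. of_bool (k u v = h)))"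
      by (simp only: sum_distrib_left)
    also have "\<dots> \<le> 2 * (\<Sum>h\<in>H. 24 * R * (1 / (1 + (real_of_int h)\<^sup>2)) * (4 * P))"
    proof (intro mult_left_mono sum_mono)
      fix h
      have "(\<Sum>u\<in>I. \<Sum>v\<in>I. of_bool (k u v = h)) \<le> (\<Sum>u\<in>I. \<Sum>v\<in>I. of_bool (\<bar>y u - y v - h / R\<bar> \<le> 1 / R) :: real)"
      proof (intro sum_mono)
        fix u v
        have "\<bar>y u - y v - h / R\<bar> \<le> 1 / R" if "k u v = h"
        proof -
          have "\<bar>R * (y u - y v) - h\<bar> \<le> 1" using that unfolding k_def by linarith
          then have "\<bar>R * (y u - y v) - h\<bar> / R \<le> 1 / R" using R by (intro divide_right_mono) auto
          moreover have "\<bar>R * (y u - y v) - h\<bar> / R = \<bar>(R * (y u - y v) - h) / R\<bar>" using R by simp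
          moreover have "(R * (y u - y v) - h) / R = y u - y v - h / R" using R by (simp add: field_simps)
          ultimately show ?thesis by simp
        qed
        then show "(of_bool (k u v = h) :: real) \<le> of_bool (\<bar>y u - y v - h / R\<bar> \<le> 1 / R)" by auto
      qed
      also have "\<dots> \<le> 4 * P" unfolding P_def using I R by (intro pair_count_shift) auto
      finally show "(\<Sum>u\<in>I. \<Sum>v\<in>I. of_bool (k u v = h)) \<le> 4 * P" .
    qed (use R in auto)
    also have "\<dots> = 192 * R * P * (\<Sum>h\<in>H. 1 / (1 + (real_of_int h)\<^sup>2))"
      unfolding sum_distrib_left by (intro sum.cong refl) simp
    also have "\<dots> \<le> 192 * R * P * Z"
      using R by (intro mult_left_mono Z H) (auto simp: P_def intro!: sum_nonneg mult_nonneg_nonneg)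
    finally show ?thesis by (simp add: f_def[abs_def] P_def mult_ac)
  qed
  then show ?thesis using Z(1) by (intro exI[of _ "192 * Z"]) auto
qed

text \<open>The kernel is at least \<open>R / 4\<close> on close pairs and nonnegative on all
  others, a property that the tent weight secures; afterwards the weight is bounded by 1.\<close>

lemma norm_sum_cis_integral_lower:
  assumes I: "finite I" and R: "R > 0"
  shows "(\<Sum>u\<in>I. \<Sum>v\<in>I. of_bool (\<bar>y u - y v\<bar> \<le> 1 / R))
    \<le> 4 / R * integral {0..R} (\<lambda>x. (cmod (\<Sum>u\<in>I. cis (x * y u)))\<^sup>2)"
proof -
  have "(\<Sum>u\<in>I. \<Sum>v\<in>I. of_bool (\<bar>y u - y v\<bar> \<le> 1 / R)) \<le> (\<Sum>u\<in>I. \<Sum>v\<in>I. 4 / R * fejer R (y u - y v))"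
  proof (intro sum_mono)
    fix u v
    show "of_bool (\<bar>y u - y v\<bar> \<le> 1 / R) \<le> 4 / R * fejer R (y u - y v)"
      using fejer_lower[OF R, of "y u - y v"] fejer_nonneg[OF R, of "y u - y v"] R
      by (auto simp: of_bool_def field_simps)
  qed
  also have "\<dots> = 4 / R * integral {0..R} (\<lambda>x. (1 - x / R) * (cmod (\<Sum>u\<in>I. cis (x * y u)))\<^sup>2)"
    unfolding integral_unique[OF integral_tent_norm_sum_cis_sq[OF I R]] sum_distrib_left ..
  also have "\<dots> \<le> 4 / R * integral {0..R} (\<lambda>x. (cmod (\<Sum>u\<in>I. cis (x * y u)))\<^sup>2)"
    using R has_integral_integrable[OF integral_tent_norm_sum_cis_sq[OF I R]]
    by (intro mult_left_mono integral_le norm_sum_cis_integrable) (auto intro!: mult_left_le_one_le)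
  finally show ?thesis .
qed

context separated_digits
begin

text \<open>Frequencies up to \<open>1 / r ^ m\<close> correspond to pairs at distance
  \<open>r ^ m\<close>, the scale of \<open>cnt m\<close>. The constants depend neither on the level
  nor on the direction.\<close>

lemma norm_sum_cis_words_integral:
  assumes eps: "\<epsilon> > 0"
  shows "\<exists>l>0. \<exists>C>0. \<forall>M z. cmod z = 1 \<longrightarrow>
    integral {0..1 / r ^ (M * l)} (\<lambda>x. (cmod (\<Sum>u\<in>words V (M * l). cis (x * proj z (pt c b u))))\<^sup>2)
    \<le> C * (N ^ (2 * (M * l)) * (r powr - \<epsilon>) ^ (M * l))"
proof -
  obtain C0 where C0: "C0 > 0" "\<And>I y R. finite (I :: 'v list set) \<Longrightarrow> R > 0 \<Longrightarrow>
      integral {0..R} (\<lambda>x. (cmod (\<Sum>u\<in>I. cis (x * y u)))\<^sup>2)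
    \<le> C0 * R * (\<Sum>u\<in>I. \<Sum>v\<in>I. of_bool (\<bar>y u - y v\<bar> \<le> 1 / R))"
    using norm_sum_cis_integral_upper by metis
  obtain l C where lC: "l > 0" "C > 0"
    "\<And>M z. cmod z = 1 \<Longrightarrow> cnt (M * l) z \<le> C * (N ^ (2 * (M * l)) * r ^ (M * l) * (r powr - \<epsilon>) ^ (M * l))"
    by (rule cnt_bound[OF eps]) (rule that)
  have "integral {0..1 / r ^ (M * l)} (\<lambda>x. (cmod (\<Sum>u\<in>words V (M * l). cis (x * proj z (pt c b u))))\<^sup>2)
    \<le> (C0 * C) * (N ^ (2 * (M * l)) * (r powr - \<epsilon>) ^ (M * l))" if z: "cmod z = 1" for M z
  proof -
    define m where "m = M * l"
    have "integral {0..1 / r ^ m} (\<lambda>x. (cmod (\<Sum>u\<in>words V m. cis (x * proj z (pt c b u))))\<^sup>2)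
      \<le> C0 * (1 / r ^ m) * (\<Sum>u\<in>words V m. \<Sum>v\<in>words V m.
          of_bool (\<bar>proj z (pt c b u) - proj z (pt c b v)\<bar> \<le> 1 / (1 / r ^ m)))"
      using r fin by (intro C0) auto
    also have "\<dots> \<le> C0 * (1 / r ^ m) * cnt m z"
    proof (intro mult_left_mono)
      have "1 * r ^ m \<le> c0 * r ^ m" using c0 r by (intro mult_right_mono) auto
      then show "(\<Sum>u\<in>words V m. \<Sum>v\<in>words V m.
          of_bool (\<bar>proj z (pt c b u) - proj z (pt c b v)\<bar> \<le> 1 / (1 / r ^ m))) \<le> cnt m z"
        unfolding cnt_def by (intro sum_mono) (auto simp: proj_diff)
    qed (use C0 r in auto)
    also have "\<dots> \<le> C0 * (1 / r ^ m) * (C * (N ^ (2 * m) * r ^ m * (r powr - \<epsilon>) ^ m))"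
      unfolding m_def using C0 r by (intro mult_left_mono lC z) auto
    also have "\<dots> = (C0 * C) * (N ^ (2 * m) * (r powr - \<epsilon>) ^ m)" using r by simp
    finally show ?thesis by (simp add: m_def)
  qed
  then show ?thesis using lC(1,2) C0(1) by (intro exI[of _ l] exI[of _ "C0 * C"] conjI) auto
qed

end

section \<open>Exponential sums over words, the unnormalised Fourier transforms of the level
  sets\<close>

definition trig :: "'v set \<Rightarrow> complex \<Rightarrow> ('v \<Rightarrow> complex) \<Rightarrow> nat \<Rightarrow> complex \<Rightarrow> complex" where
  "trig V c b m \<xi> = (\<Sum>u\<in>words V m. cis (proj \<xi> (pt c b u)))"

lemma proj_mult_left: "proj z (c * w) = proj (z * cnj c) w"
  by (simp add: proj_def algebra_simps)

lemma trig_add: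
  assumes "finite V"
  shows "trig V c b (m + l) \<xi> = trig V c b m \<xi> * trig V c b l (\<xi> * cnj (c ^ m))"
proof -
  have "trig V c b (m + l) \<xi> = (\<Sum>u\<in>words V m. \<Sum>v\<in>words V l. cis (proj \<xi> (pt c b (u @ v))))"
    unfolding trig_def by (rule sum_words_add[OF assms])
  also have "\<dots> = (\<Sum>u\<in>words V m. \<Sum>v\<in>words V l. cis (proj \<xi> (pt c b u)) * cis (proj (\<xi> * cnj (c ^ m)) (pt c b v)))"
  proof (intro sum.cong refl)
    fix u v assume "u \<in> words V m"
    then have "length u = m" by (simp add: words_def)
    then have "proj \<xi> (pt c b (u @ v)) = proj \<xi> (pt c b u) + proj (\<xi> * cnj (c ^ m)) (pt c b v)"
      by (simp only: pt_append proj_add proj_mult_left)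
    then show "cis (proj \<xi> (pt c b (u @ v))) = cis (proj \<xi> (pt c b u)) * cis (proj (\<xi> * cnj (c ^ m)) (pt c b v))"
      by (simp add: cis_mult)
  qed
  finally show ?thesis by (simp only: trig_def sum_product)
qed

lemma trig_1: "finite V \<Longrightarrow> trig V c b (Suc 0) \<xi> = (\<Sum>i\<in>V. cis (proj \<xi> (b i)))"
  by (simp add: trig_def sum_words_Suc)

lemma cmod_trig_le: "finite V \<Longrightarrow> cmod (trig V c b m \<xi>) \<le> real (card V) ^ m"
  unfolding trig_def using norm_sum[of "\<lambda>u. cis (proj \<xi> (pt c b u))" "words V m"]
  by (simp add: card_words)

lemma cmod_trig_add_le:
  assumes "finite V"
  shows "cmod (trig V c b (m + l) \<xi>) \<le> real (card V) ^ l * cmod (trig V c b m \<xi>)"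
  unfolding trig_add[OF assms] norm_mult
  by (subst mult.commute) (intro mult_right_mono cmod_trig_le assms norm_ge_zero)

text \<open>A word of length \<open>Suc k * M\<close> splits into the letters at the multiples of \<open>Suc k\<close> and the blocks
  of length \<open>k\<close> between them, so the exponential sum factors.\<close>

lemma trig_split:
  assumes "finite V"
  shows "trig V c b (Suc k * M) \<xi> =
    trig V (c ^ Suc k) b M \<xi> * trig (words V k) (c ^ Suc k) (\<lambda>w. c * pt c b w) M \<xi>"
proof (induction M arbitrary: \<xi>)
  case 0 then show ?case by (simp add: trig_def proj_def)
next
  case (Suc M)
  \<comment> \<open>In one block, the first letter is a digit of the first factor and the other
    \<open>k\<close> letters together form one digit \<open>c * pt c b w\<close> of the
    second.\<close>
  have blk: "trig V c b (Suc k) \<xi> = trig V (c ^ Suc k) b (Suc 0) \<xi> *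
      trig (words V k) (c ^ Suc k) (\<lambda>w. c * pt c b w) (Suc 0) \<xi>"
  proof -
    have "trig V c b (Suc k) \<xi> = trig V c b (Suc 0) \<xi> * trig V c b k (\<xi> * cnj c)"
      using trig_add[OF assms, of c b "Suc 0" k \<xi>] by simp
    also have "trig V c b k (\<xi> * cnj c) = (\<Sum>w\<in>words V k. cis (proj \<xi> (c * pt c b w)))"
      unfolding trig_def proj_mult_left ..
    finally show ?thesis by (simp add: trig_1 assms)
  qed
  have "trig V c b (Suc k * Suc M) \<xi> = trig V c b (Suc k) \<xi> * trig V c b (Suc k * M) (\<xi> * cnj (c ^ Suc k))"
    using trig_add[OF assms, of c b "Suc k" "Suc k * M" \<xi>] by simp
  also have "\<dots> = (trig V (c ^ Suc k) b (Suc 0) \<xi> * trig V (c ^ Suc k) b M (\<xi> * cnj (c ^ Suc k))) *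
    (trig (words V k) (c ^ Suc k) (\<lambda>w. c * pt c b w) (Suc 0) \<xi> *
     trig (words V k) (c ^ Suc k) (\<lambda>w. c * pt c b w) M (\<xi> * cnj (c ^ Suc k)))"
    unfolding Suc blk by (simp only: mult_ac)
  also have "\<dots> = trig V (c ^ Suc k) b (Suc 0 + M) \<xi> * trig (words V k) (c ^ Suc k) (\<lambda>w. c * pt c b w) (Suc 0 + M) \<xi>"
    using assms by (simp only: trig_add finite_words power_one_right One_nat_def[symmetric])
  finally show ?case by simp
qed

lemma cmod_cis_diff_le: "cmod (cis s - cis t) \<le> \<bar>s - t\<bar>"
proof -
  have "cis s - cis t = cis t * (cis (s - t) - 1)" by (simp add: cis_mult right_diff_distrib)
  then have "cmod (cis s - cis t) = cmod (exp (\<i> * of_real (s - t)) - 1)"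
    by (simp add: norm_mult cis_conv_exp)
  also have "\<dots> = 2 * \<bar>sin ((s - t) / 2)\<bar>" by (rule dist_exp_i_1)
  also have "\<dots> \<le> \<bar>s - t\<bar>" using abs_sin_x_le_abs_x[of "(s - t) / 2"] by simp
  finally show ?thesis .
qed

section \<open>The self-similar measure with equal weights\<close>

text \<open>Streams range over all natural numbers, although letters from \<open>n\<close> on have
  probability 0. Setting \<open>a i = 0\<close> for these letters makes the series converge, with
  one bound, for every stream.\<close>

locale digit_series =
  fixes n :: nat and a :: "nat \<Rightarrow> complex" and c :: complex
  assumes n_pos: "n > 0" and c_lt_1: "cmod c < 1" and a_outside: "\<And>i. n \<le> i \<Longrightarrow> a i = 0"
begin

definition "\<Omega> = stream_space (measure_pmf (pmf_of_set {..<n}))"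
definition "X \<omega> = (\<Sum>j. c ^ j * a (\<omega> !! j))"
definition "A0 = (\<Sum>i<n. cmod (a i))"
definition "B0 = A0 / (1 - cmod c)"

abbreviation "W \<equiv> words {..<n}"

lemma cmod_a_le: "cmod (a i) \<le> A0"
proof (cases "i < n")
  case True then show ?thesis unfolding A0_def by (intro member_le_sum) auto
next
  case False then show ?thesis using a_outside by (simp add: A0_def sum_nonneg)
qed

lemma A0: "0 \<le> A0" by (simp add: A0_def sum_nonneg)
lemma B0: "0 \<le> B0" using A0 c_lt_1 by (simp add: B0_def)

lemma summable_X: "summable (\<lambda>j. c ^ j * a (\<omega> !! j))"
proof (rule summable_comparison_test)
  show "summable (\<lambda>j. cmod c ^ j * A0)" using c_lt_1 by (intro summable_mult2 summable_geometric) auto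
  show "\<exists>N. \<forall>j\<ge>N. norm (c ^ j * a (\<omega> !! j)) \<le> cmod c ^ j * A0"
    by (auto simp: norm_mult norm_power intro!: mult_left_mono cmod_a_le)
qed

lemma X_Stream: "X (i ## \<omega>) = a i + c * X \<omega>"
proof -
  have "X (i ## \<omega>) = a i + (\<Sum>j. c ^ Suc j * a (\<omega> !! j))"
    unfolding X_def using suminf_split_head[OF summable_X[of "i ## \<omega>"]] by simp
  also have "(\<Sum>j. c ^ Suc j * a (\<omega> !! j)) = c * X \<omega>"
    unfolding X_def using suminf_mult[OF summable_X, of c \<omega>] by (simp add: mult.assoc)
  finally show ?thesis .
qed

lemma X_split: "X \<omega> = pt c a (stake m \<omega>) + c ^ m * X (sdrop m \<omega>)"
proof (induction m arbitrary: \<omega>)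
  case (Suc m)
  have "X \<omega> = a (shd \<omega>) + c * X (stl \<omega>)" by (metis X_Stream stream.collapse)
  also have "X (stl \<omega>) = pt c a (stake m (stl \<omega>)) + c ^ m * X (sdrop m (stl \<omega>))" by (rule Suc)
  finally show ?case by (simp add: algebra_simps)
qed simp

lemma cmod_X_le: "cmod (X \<omega>) \<le> B0"
proof -
  have "cmod (X \<omega>) \<le> (\<Sum>j. cmod c ^ j * A0)"
    unfolding X_def using c_lt_1
    by (intro norm_suminf_le summable_mult2 summable_geometric)
       (auto simp: norm_mult norm_power intro!: mult_left_mono cmod_a_le)
  also have "\<dots> = B0" using c_lt_1 suminf_mult2[OF summable_geometric[of "cmod c"], of A0]
    by (simp add: B0_def suminf_geometric)
  finally show ?thesis .
qed

lemma cmod_X_stake_le: "cmod (X \<omega> - pt c a (stake m \<omega>)) \<le> cmod c ^ m * B0"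
  using X_split[of \<omega> m] by (simp add: norm_mult norm_power mult_left_mono cmod_X_le)

sublocale \<Omega>: prob_space \<Omega>
  unfolding \<Omega>_def by (rule prob_space.prob_space_stream_space[OF prob_space_measure_pmf])

lemma X_measurable [measurable]: "X \<in> borel_measurable \<Omega>"
proof -
  have "(\<lambda>\<omega>. c ^ j * a (\<omega> !! j)) \<in> borel_measurable \<Omega>" for j
    unfolding \<Omega>_def
    by (rule measurable_compose[OF measurable_snth, where g = "\<lambda>i. c ^ j * a i"]) simp
  then show ?thesis unfolding X_def by (rule borel_measurable_suminf)
qed

lemma nn_integral_Stream:
  assumes "f \<in> borel_measurable \<Omega>"
  shows "(\<integral>\<^sup>+\<omega>. f \<omega> \<partial>\<Omega>) = (\<Sum>i<n. ennreal (1 / real n) * (\<integral>\<^sup>+\<omega>. f (i ## \<omega>) \<partial>\<Omega>))"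
proof -
  have "(\<integral>\<^sup>+\<omega>. f \<omega> \<partial>\<Omega>) = (\<integral>\<^sup>+i. (\<integral>\<^sup>+\<omega>. f (i ## \<omega>) \<partial>\<Omega>) \<partial>measure_pmf (pmf_of_set {..<n}))"
    using assms unfolding \<Omega>_def by (rule prob_space.nn_integral_stream_space[OF prob_space_measure_pmf])
  also have "\<dots> = (\<Sum>i<n. \<integral>\<^sup>+\<omega>. f (i ## \<omega>) \<partial>\<Omega>) / of_nat n"
    using n_pos by (subst nn_integral_pmf_of_set) auto
  also have "\<dots> = (\<Sum>i<n. ennreal (1 / real n) * (\<integral>\<^sup>+\<omega>. f (i ## \<omega>) \<partial>\<Omega>))"
  proof -
    have "inverse (of_nat n :: ennreal) = ennreal (1 / real n)"
      using n_pos by (simp add: ennreal_of_nat_eq_real_of_nat inverse_ennreal inverse_eq_divide)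
    then show ?thesis by (simp add: divide_ennreal_def sum_distrib_left[symmetric] mult.commute)
  qed
  finally show ?thesis .
qed

lemma sets_\<Omega>: "sets \<Omega> = sets (stream_space (count_space UNIV))"
  unfolding \<Omega>_def by (rule sets_stream_space_cong) simp

lemma stake_measurable [measurable]: "stake m \<in> \<Omega> \<rightarrow>\<^sub>M count_space UNIV"
  using measurable_stake[of m, where 'a = nat] measurable_cong_sets[OF sets_\<Omega> refl] by blast

lemma nn_integral_stake:
  "(\<integral>\<^sup>+\<omega>. f (stake m \<omega>) \<partial>\<Omega>) = (\<Sum>u\<in>W m. ennreal ((1 / real n) ^ m) * f u)"
proof (induction m arbitrary: f)
  case 0 then show ?case by (simp add: \<Omega>.emeasure_space_1)
next
  case (Suc m)
  have "(\<integral>\<^sup>+\<omega>. f (stake (Suc m) \<omega>) \<partial>\<Omega>)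
      = (\<Sum>i<n. ennreal (1 / real n) * (\<integral>\<^sup>+\<omega>. f (stake (Suc m) (i ## \<omega>)) \<partial>\<Omega>))"
    by (rule nn_integral_Stream) (rule measurable_compose[OF stake_measurable], simp)
  also have "\<dots> = (\<Sum>i<n. ennreal (1 / real n) * (\<integral>\<^sup>+\<omega>. f (i # stake m \<omega>) \<partial>\<Omega>))" by simp
  also have "\<dots> = (\<Sum>i<n. ennreal (1 / real n) * (\<Sum>u\<in>W m. ennreal ((1 / real n) ^ m) * f (i # u)))"
    by (intro sum.cong refl arg_cong2[where f = "(*)"] Suc)
  also have "\<dots> = (\<Sum>i<n. \<Sum>u\<in>W m. ennreal ((1 / real n) ^ Suc m) * f (i # u))"
    by (simp add: sum_distrib_left mult.assoc[symmetric] ennreal_mult[symmetric])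
  finally show ?case by (simp add: sum_words_Suc)
qed

lemma distr_stake: "distr \<Omega> (count_space UNIV) (stake m) = measure_pmf (pmf_of_set (W m))"
proof (rule measure_eqI)
  fix A assume "A \<in> sets (distr \<Omega> (count_space UNIV) (stake m))"
  have W: "finite (W m)" "W m \<noteq> {}"
    using card_words_pos[of "{..<n}" m] n_pos by (auto simp: lessThan_empty_iff)
  have "emeasure (distr \<Omega> (count_space UNIV) (stake m)) A = (\<integral>\<^sup>+u. indicator A u \<partial>distr \<Omega> (count_space UNIV) (stake m))"
    by simp
  also have "\<dots> = (\<integral>\<^sup>+\<omega>. indicator A (stake m \<omega>) \<partial>\<Omega>)" by (subst nn_integral_distr) auto
  also have "\<dots> = (\<Sum>u\<in>W m. indicator A u) / of_nat (card (W m))"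
  proof -
    have "inverse (of_nat (card (W m)) :: ennreal) = ennreal ((1 / real n) ^ m)"
      using n_pos unfolding ennreal_of_nat_eq_real_of_nat
      by (subst inverse_ennreal) (auto simp: card_words inverse_eq_divide power_one_over)
    then show ?thesis
      unfolding nn_integral_stake divide_ennreal_def sum_distrib_left[symmetric] by (simp only: mult.commute)
  qed
  also have "\<dots> = (\<integral>\<^sup>+u. indicator A u \<partial>measure_pmf (pmf_of_set (W m)))"
    using W by (subst nn_integral_pmf_of_set) (auto simp: ennreal_of_nat_eq_real_of_nat)
  also have "\<dots> = emeasure (measure_pmf (pmf_of_set (W m))) A" by simp
  finally show "emeasure (distr \<Omega> (count_space UNIV) (stake m)) A = emeasure (measure_pmf (pmf_of_set (W m))) A" .
qed simp

lemma integral_stake: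
  fixes f :: "nat list \<Rightarrow> complex"
  shows "(\<integral>\<omega>. f (stake m \<omega>) \<partial>\<Omega>) = (\<Sum>u\<in>W m. f u) / of_nat n ^ m"
proof -
  have W: "finite (W m)" "W m \<noteq> {}"
    using card_words_pos[of "{..<n}" m] n_pos by (auto simp: lessThan_empty_iff)
  have "(\<integral>\<omega>. f (stake m \<omega>) \<partial>\<Omega>) = (\<integral>u. f u \<partial>distr \<Omega> (count_space UNIV) (stake m))"
    by (subst integral_distr) auto
  also have "\<dots> = (\<integral>u. f u \<partial>measure_pmf (pmf_of_set (W m)))" by (simp only: distr_stake)
  also have "\<dots> = (\<Sum>u\<in>W m. pmf (pmf_of_set (W m)) u *\<^sub>R f u)"
    using W by (intro integral_measure_pmf) (auto simp: set_pmf_of_set)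
  also have "\<dots> = (\<Sum>u\<in>W m. f u / of_nat n ^ m)"
    using W by (intro sum.cong refl) (simp add: pmf_of_set card_words scaleR_conv_of_real)
  finally show ?thesis by (simp add: sum_divide_distrib)
qed

definition "\<eta> = distr \<Omega> borel X"

text \<open>The first letter is independent of the rest of the stream, and
  \<open>X (i ## \<omega>) = a i + c * X \<omega>\<close>. This identifies \<eta> as a measure to
  which the decay hypothesis applies.\<close>

lemma self_similar_\<eta>: "is_self_similar_measure {..<n} c a (\<lambda>_. 1 / real n) \<eta>"
  unfolding is_self_similar_measure_def compactly_supported_prob_def
proof (intro conjI ballI)
  show "prob_space \<eta>" unfolding \<eta>_def by (rule \<Omega>.prob_space_distr) simp
  show "sets \<eta> = sets borel" by (simp add: \<eta>_def)
  have "emeasure \<eta> (- cball 0 B0) = emeasure \<Omega> (X -` (- cball 0 B0) \<inter> space \<Omega>)"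
    unfolding \<eta>_def by (rule emeasure_distr) auto
  also have "X -` (- cball 0 B0) \<inter> space \<Omega> = {}" using cmod_X_le by auto
  finally have "emeasure \<eta> (- cball 0 B0) = 0" by simp
  then show "\<exists>C. compact C \<and> emeasure \<eta> (- C) = 0" using compact_cball by blast
  fix B :: "complex set" assume B[measurable]: "B \<in> sets borel"
  have e: "emeasure (distr \<eta> borel (ifs_map c a i)) B = (\<integral>\<^sup>+\<omega>. indicator B (X (i ## \<omega>)) \<partial>\<Omega>)" for i
  proof -
    have [measurable]: "ifs_map c a i \<in> borel_measurable borel" unfolding ifs_map_def[abs_def] by measurable
    have "distr \<eta> borel (ifs_map c a i) = distr \<Omega> borel (\<lambda>\<omega>. ifs_map c a i (X \<omega>))"
      unfolding \<eta>_def by (subst distr_distr) (auto simp: comp_def)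
    then have "emeasure (distr \<eta> borel (ifs_map c a i)) B = (\<integral>\<^sup>+x. indicator B x \<partial>distr \<Omega> borel (\<lambda>\<omega>. ifs_map c a i (X \<omega>)))"
      by simp
    also have "\<dots> = (\<integral>\<^sup>+\<omega>. indicator B (ifs_map c a i (X \<omega>)) \<partial>\<Omega>)"
      by (subst nn_integral_distr) auto
    finally show ?thesis by (simp add: X_Stream ifs_map_def add.commute)
  qed
  have "emeasure \<eta> B = (\<integral>\<^sup>+\<omega>. indicator B (X \<omega>) \<partial>\<Omega>)"
  proof -
    have "emeasure \<eta> B = (\<integral>\<^sup>+x. indicator B x \<partial>\<eta>)" using B by (simp add: \<eta>_def)
    then show ?thesis unfolding \<eta>_def by (subst (asm) nn_integral_distr) auto
  qed
  also have "\<dots> = (\<Sum>i<n. ennreal (1 / real n) * (\<integral>\<^sup>+\<omega>. indicator B (X (i ## \<omega>)) \<partial>\<Omega>))"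
    by (rule nn_integral_Stream) auto
  finally show "emeasure \<eta> B = (\<Sum>i\<in>{..<n}. ennreal (1 / real n) * emeasure (distr \<eta> borel (ifs_map c a i)) B)"
    by (simp add: e)
qed

text \<open>\<open>cis\<close> is 1-Lipschitz, and \<open>X\<close> differs from its truncation by
  at most \<open>cmod c ^ m * B0\<close>.\<close>

lemma fourier_transform_\<eta>_approx:
  "cmod (fourier_transform \<eta> \<xi> - trig {..<n} c a m \<xi> / of_nat n ^ m) \<le> cmod \<xi> * cmod c ^ m * B0"
proof -
  have [measurable]: "(\<lambda>w. cis (proj \<xi> w)) \<in> borel_measurable borel"
    unfolding proj_def by (intro borel_measurable_continuous_onI continuous_intros)
  have i1: "integrable \<Omega> (\<lambda>\<omega>. cis (proj \<xi> (X \<omega>)))"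
    by (rule \<Omega>.integrable_const_bound[where B = 1]) auto
  have i2: "integrable \<Omega> (\<lambda>\<omega>. cis (proj \<xi> (pt c a (stake m \<omega>))))"
    by (rule \<Omega>.integrable_const_bound[where B = 1])
      (auto intro: measurable_compose[OF stake_measurable])
  have "fourier_transform \<eta> \<xi> = (\<integral>\<omega>. cis (proj \<xi> (X \<omega>)) \<partial>\<Omega>)"
    unfolding fourier_transform_def \<eta>_def proj_def[symmetric] cis_conv_exp[symmetric]
    by (rule integral_distr) auto
  moreover have "trig {..<n} c a m \<xi> / of_nat n ^ m = (\<integral>\<omega>. cis (proj \<xi> (pt c a (stake m \<omega>))) \<partial>\<Omega>)"
    unfolding trig_def by (rule integral_stake[symmetric])
  ultimately have "fourier_transform \<eta> \<xi> - trig {..<n} c a m \<xi> / of_nat n ^ m =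
      (\<integral>\<omega>. cis (proj \<xi> (X \<omega>)) - cis (proj \<xi> (pt c a (stake m \<omega>))) \<partial>\<Omega>)"
    using i1 i2 by simp
  also have "cmod \<dots> \<le> cmod \<xi> * cmod c ^ m * B0"
  proof (rule order_trans[OF integral_norm_bound \<Omega>.integral_le_const])
    show "integrable \<Omega> (\<lambda>\<omega>. cmod (cis (proj \<xi> (X \<omega>)) - cis (proj \<xi> (pt c a (stake m \<omega>)))))"
      using i1 i2 by simp
    show "AE \<omega> in \<Omega>. cmod (cis (proj \<xi> (X \<omega>)) - cis (proj \<xi> (pt c a (stake m \<omega>)))) \<le> cmod \<xi> * cmod c ^ m * B0"
    proof (rule AE_I2)
      fix \<omega>
      have "cmod (cis (proj \<xi> (X \<omega>)) - cis (proj \<xi> (pt c a (stake m \<omega>)))) \<le> \<bar>proj \<xi> (X \<omega> - pt c a (stake m \<omega>))\<bar>"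
        unfolding proj_diff by (rule cmod_cis_diff_le)
      also have "\<dots> \<le> cmod \<xi> * cmod (X \<omega> - pt c a (stake m \<omega>))" by (rule abs_proj_le)
      also have "\<dots> \<le> cmod \<xi> * (cmod c ^ m * B0)" by (intro mult_left_mono cmod_X_stake_le) auto
      finally show "cmod (cis (proj \<xi> (X \<omega>)) - cis (proj \<xi> (pt c a (stake m \<omega>)))) \<le> cmod \<xi> * cmod c ^ m * B0"
        by simp
    qed
  qed
  finally show ?thesis .
qed

text \<open>Transfers the decay from the measure to its level sets. The condition on
  \<open>M\<close> makes the truncation error at most \<open>B0 / cmod \<xi>\<close>, so the
  exponent \<open>min \<gamma> 1\<close> survives.\<close>

lemma trig_decay:
  assumes "C > 0" "\<gamma> > 0" and dec: "\<And>\<xi>. \<xi> \<noteq> 0 \<Longrightarrow> cmod (fourier_transform \<eta> \<xi>) \<le> C * cmod \<xi> powr (- \<gamma>)"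
  shows "\<exists>C>0. \<exists>\<gamma>>0. \<forall>\<xi> M. 1 \<le> cmod \<xi> \<longrightarrow> cmod c ^ M * (cmod \<xi>)\<^sup>2 \<le> 1 \<longrightarrow>
    cmod (trig {..<n} c a M \<xi>) \<le> C * real n ^ M * cmod \<xi> powr (- \<gamma>)"
proof (intro exI conjI allI impI)
  let ?g = "min \<gamma> 1"
  fix \<xi> M assume x: "1 \<le> cmod \<xi>" "cmod c ^ M * (cmod \<xi>)\<^sup>2 \<le> 1"
  define y where "y = cmod \<xi>"
  have y: "1 \<le> y" "cmod c ^ M * y\<^sup>2 \<le> 1" using x by (auto simp: y_def)
  have "y * cmod c ^ M \<le> 1 / y" using y by (simp add: field_simps power2_eq_square)
  also have "1 / y = y powr (-1)" using y by (simp add: powr_minus_divide)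
  also have "\<dots> \<le> y powr - ?g" using y by (intro powr_mono) auto
  finally have "y * cmod c ^ M * B0 \<le> y powr - ?g * B0" using B0 by (rule mult_right_mono)
  then have 1: "y * cmod c ^ M * B0 \<le> B0 * y powr - ?g" by (simp only: mult.commute)
  have "cmod (trig {..<n} c a M \<xi> / of_nat n ^ M) \<le>
      cmod (fourier_transform \<eta> \<xi>) + cmod (fourier_transform \<eta> \<xi> - trig {..<n} c a M \<xi> / of_nat n ^ M)"
    using norm_triangle_ineq4[of "fourier_transform \<eta> \<xi>" "fourier_transform \<eta> \<xi> - trig {..<n} c a M \<xi> / of_nat n ^ M"]
    by simp
  also have "\<dots> \<le> C * y powr (- \<gamma>) + y * cmod c ^ M * B0"
    unfolding y_def using x by (intro add_mono dec fourier_transform_\<eta>_approx) auto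
  also have "\<dots> \<le> C * y powr - ?g + B0 * y powr - ?g"
    using y assms by (intro add_mono 1 mult_left_mono powr_mono) auto
  finally have "cmod (trig {..<n} c a M \<xi>) / real n ^ M \<le> (C + B0) * y powr - ?g"
    by (simp add: norm_divide norm_power distrib_right)
  then show "cmod (trig {..<n} c a M \<xi>) \<le> (C + B0) * real n ^ M * cmod \<xi> powr - ?g"
    using n_pos by (simp add: field_simps y_def)
qed (use assms B0 in auto)

end

section \<open>Cylinders under strong separation\<close>

locale separated_ifs =
  fixes n :: nat and a :: "nat \<Rightarrow> complex" and lam :: complex and K :: "complex set"
  assumes a_outside': "\<And>i. n \<le> i \<Longrightarrow> a i = 0"
    and lam: "lam \<noteq> 0" "cmod lam < 1"
    and compact_K: "compact K" and K_nonempty: "K \<noteq> {}"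
    and K_eq: "K = (\<Union>i<n. (\<lambda>w. lam * w + a i) ` K)"
    and K_disj: "disjoint_family_on (\<lambda>i. (\<lambda>w. lam * w + a i) ` K) {..<n}"
    and n_lam: "1 < real n * cmod lam"
begin

lemma n_gt_1: "1 < n"
proof -
  have "real n * cmod lam \<le> real n * 1" using lam by (intro mult_left_mono) auto
  then have "1 < real n" using n_lam by linarith
  then show ?thesis by simp
qed

sublocale digit_series n a lam
  using n_gt_1 lam a_outside' by unfold_locales auto

definition f :: "nat list \<Rightarrow> complex \<Rightarrow> complex" where
  "f u w = pt lam a u + lam ^ length u * w"

definition "rho = cmod lam"

lemma rho: "0 < rho" "rho < 1" using lam by (auto simp: rho_def)

lemma f_Nil [simp]: "f [] w = w" by (simp add: f_def)
lemma f_Cons: "f (i # u) w = lam * f u w + a i" by (simp add: f_def algebra_simps)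
lemma f_append: "f (u @ v) w = f u (f v w)" by (simp add: f_def pt_append power_add algebra_simps)
lemma f_diff: "f u x - f u y = lam ^ length u * (x - y)" by (simp add: f_def algebra_simps)

lemma f_K: "set u \<subseteq> {..<n} \<Longrightarrow> x \<in> K \<Longrightarrow> f u x \<in> K"
proof (induction u)
  case (Cons i u)
  then have "f (i # u) x \<in> (\<Union>i<n. (\<lambda>w. lam * w + a i) ` K)" by (auto simp: f_Cons)
  then show ?case using K_eq by simp
qed simp

lemma K_words: "x \<in> K \<Longrightarrow> \<exists>u\<in>W m. \<exists>y\<in>K. x = f u y"
proof (induction m arbitrary: x)
  case (Suc m)
  obtain i y where iy: "i < n" "y \<in> K" "x = lam * y + a i" using Suc.prems K_eq by blast
  obtain u y' where "u \<in> W m" "y' \<in> K" "y = f u y'" using Suc.IH[OF iy(2)] by blast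
  then show ?case using iy by (intro bexI[of _ "i # u"] bexI[of _ y']) (auto simp: f_Cons words_Suc)
qed simp

lemma compact_cyl: "compact (f u ` K)"
  unfolding f_def by (intro compact_continuous_image compact_K continuous_intros)

lemma gap_exists:
  "\<exists>d>0. \<forall>i<n. \<forall>j<n. i \<noteq> j \<longrightarrow> (\<forall>x\<in>K. \<forall>y\<in>K. d \<le> cmod ((lam * x + a i) - (lam * y + a j)))"
proof -
  define g where "g = (\<lambda>(i, j). setdist ((\<lambda>w. lam * w + a i) ` K) ((\<lambda>w. lam * w + a j) ` K))"
  define P where "P = {(i, j). i < n \<and> j < n \<and> i \<noteq> j}"
  have "finite P" by (rule finite_subset[of _ "{..<n} \<times> {..<n}"]) (auto simp: P_def)
  define d where "d = Min (insert 1 (g ` P))"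
  have "0 < g p" if p: "p \<in> P" for p
  proof -
    obtain i j where ij: "p = (i, j)" "i < n" "j < n" "i \<noteq> j" using p by (auto simp: P_def)
    have c: "compact ((\<lambda>w. lam * w + a i) ` K)" for i
      by (intro compact_continuous_image compact_K continuous_intros)
    have "(\<lambda>w. lam * w + a i) ` K \<inter> (\<lambda>w. lam * w + a j) ` K = {}"
      using K_disj ij by (auto simp: disjoint_family_on_def)
    then show ?thesis
      using c[of i] c[of j] K_nonempty unfolding g_def ij(1) case_prod_conv
      by (subst setdist_gt_0_compact_closed) (auto intro: compact_imp_closed)
  qed
  then have "d > 0" unfolding d_def using \<open>finite P\<close> by (subst Min_gr_iff) auto
  moreover have "d \<le> cmod ((lam * x + a i) - (lam * y + a j))"
    if "i < n" "j < n" "i \<noteq> j" "x \<in> K" "y \<in> K" for i j x y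
  proof -
    have "d \<le> g (i, j)" unfolding d_def using \<open>finite P\<close> that by (intro Min_le) (auto simp: P_def)
    also have "\<dots> \<le> dist (lam * x + a i) (lam * y + a j)"
      unfolding g_def using that by (auto intro!: setdist_le_dist)
    finally show ?thesis by (simp add: dist_norm)
  qed
  ultimately show ?thesis by blast
qed

definition "gap = (SOME d. d > 0 \<and> (\<forall>i<n. \<forall>j<n. i \<noteq> j \<longrightarrow> (\<forall>x\<in>K. \<forall>y\<in>K. d \<le> cmod ((lam * x + a i) - (lam * y + a j)))))"

lemma gap: "gap > 0"
  "\<lbrakk>i < n; j < n; i \<noteq> j; x \<in> K; y \<in> K\<rbrakk> \<Longrightarrow> gap \<le> cmod ((lam * x + a i) - (lam * y + a j))"
  using someI_ex[OF gap_exists] unfolding gap_def by auto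

text \<open>Behind the common prefix the first letters differ, so the points are at least
  \<open>gap\<close> apart there; applying the prefix multiplies distances by a power of
  \<open>rho\<close> with exponent below \<open>length w\<close>.\<close>

lemma cyl_separated:
  "\<lbrakk>set w \<subseteq> {..<n}; set w' \<subseteq> {..<n}; length w = length w'; w \<noteq> w'; x \<in> K; y \<in> K\<rbrakk>
    \<Longrightarrow> gap * rho ^ length w \<le> cmod (f w x - f w' y)"
proof (induction w arbitrary: w')
  case (Cons i w)
  obtain j v where w': "w' = j # v" using Cons.prems by (cases w') auto
  show ?case
  proof (cases "i = j")
    case True
    then have "w \<noteq> v" using Cons.prems w' by auto
    then have "gap * rho ^ length w \<le> cmod (f w x - f v y)"
      using Cons.prems w' by (intro Cons.IH) auto
    then have "rho * (gap * rho ^ length w) \<le> rho * cmod (f w x - f v y)"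
      using rho by (intro mult_left_mono) auto
    also have "\<dots> = cmod (f (i # w) x - f w' y)"
      using True by (simp add: w' f_Cons rho_def norm_mult[symmetric] algebra_simps)
    finally show ?thesis by (simp add: mult_ac)
  next
    case False
    have "rho ^ length (i # w) \<le> 1" using rho by (intro power_le_one) auto
    then have "gap * rho ^ length (i # w) \<le> gap" using gap(1) by (simp add: mult_left_le)
    also have "\<dots> \<le> cmod (f (i # w) x - f w' y)"
      unfolding f_Cons w' using Cons.prems False w' by (intro gap f_K) auto
    finally show ?thesis .
  qed
qed auto

text \<open>The points \<open>pt lam a u\<close> are images of 0, which need not lie in
  \<open>K\<close>. For words of equal length the difference of the images does not depend on the
  base point, so a point of \<open>K\<close> can replace 0.\<close>

lemma pt_separated:
  assumes "set w \<subseteq> {..<n}" "set w' \<subseteq> {..<n}" "length w = length w'" "w \<noteq> w'"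
    "set u \<subseteq> {..<n}" "set v \<subseteq> {..<n}" "length u = length v"
  shows "gap * rho ^ length w \<le> cmod (pt lam a (w @ u) - pt lam a (w' @ v))"
proof -
  obtain x where x: "x \<in> K" using K_nonempty by blast
  have "pt lam a (w @ u) - pt lam a (w' @ v) = f (w @ u) x - f (w' @ v) x"
    using assms by (simp add: f_def)
  also have "\<dots> = f w (f u x) - f w' (f v x)" by (simp only: f_append)
  finally show ?thesis using cyl_separated[of w w' "f u x" "f v x"] assms x by (auto intro: f_K)
qed

lemma a_inj: assumes "i < n" "j < n" "i \<noteq> j" shows "a i \<noteq> a j"
proof
  assume "a i = a j"
  then show False using pt_separated[of "[i]" "[j]" "[]" "[]"] assms mult_pos_pos[OF gap(1) rho(1)] by auto
qed

text \<open>Inserting the letter \<open>0\<close> before every block shifts all points by the same constant, so the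
  separation of cylinders is inherited by the blocks.\<close>

definition blk :: "nat \<Rightarrow> nat list list \<Rightarrow> nat list" where
  "blk k us = concat (map (\<lambda>w. 0 # w) us)"

lemma blk_props:
  assumes "set us \<subseteq> W k"
  shows "set (blk k us) \<subseteq> {..<n}" "length (blk k us) = Suc k * length us"
    "pt lam a (blk k us) = pt (lam ^ Suc k) (\<lambda>w. lam * pt lam a w) us
       + a 0 * (\<Sum>j<length us. (lam ^ Suc k) ^ j)"
  using assms
proof (induction us)
  case Nil
  { case 1 then show ?case by (simp add: blk_def) }
  { case 2 then show ?case by (simp add: blk_def) }
  { case 3 then show ?case by (simp add: blk_def) }
next
  case (Cons w us)
  have w: "length w = k" "set w \<subseteq> {..<n}" if "set (w # us) \<subseteq> W k" using that by (auto simp: words_def)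
  have b: "blk k (w # us) = (0 # w) @ blk k us" by (simp add: blk_def)
  { case 1 then show ?case using Cons.IH w n_gt_1 unfolding b by auto }
  { case 2 then show ?case using Cons.IH w unfolding b by auto }
  { case 3
    then have "pt lam a (blk k (w # us)) = a 0 + lam * pt lam a w + lam ^ Suc k * pt lam a (blk k us)"
      unfolding b pt_append using w by simp
    also have "pt lam a (blk k us) = pt (lam ^ Suc k) (\<lambda>w. lam * pt lam a w) us
       + a 0 * (\<Sum>j<length us. (lam ^ Suc k) ^ j)" using 3 Cons.IH by simp
    also have "a 0 + lam * pt lam a w + lam ^ Suc k * (\<dots>)
      = (lam * pt lam a w + lam ^ Suc k * pt (lam ^ Suc k) (\<lambda>w. lam * pt lam a w) us)
        + a 0 * (1 + lam ^ Suc k * (\<Sum>j<length us. (lam ^ Suc k) ^ j))"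
      by (simp only: algebra_simps mult_1_left mult_1_right)
    also have "1 + lam ^ Suc k * (\<Sum>j<length us. (lam ^ Suc k) ^ j) = (\<Sum>j<Suc (length us). (lam ^ Suc k) ^ j)"
      unfolding sum.lessThan_Suc_shift sum_distrib_left by (simp only: power_0 power_Suc)
    finally show ?case by (simp only: pt.simps list.size add_Suc_right add_0_right) }
qed

lemma separated_blocks:
  assumes "w \<in> W k" "w' \<in> W k" "w \<noteq> w'" "set us \<subseteq> W k" "set vs \<subseteq> W k" "length us = length vs"
  shows "gap * rho ^ Suc k \<le> cmod (pt (lam ^ Suc k) (\<lambda>w. lam * pt lam a w) (w # us)
      - pt (lam ^ Suc k) (\<lambda>w. lam * pt lam a w) (w' # vs))"
proof -
  have "gap * rho ^ length (0 # w) \<le> cmod (pt lam a ((0 # w) @ blk k us) - pt lam a ((0 # w') @ blk k vs))"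
    using assms blk_props[of us k] blk_props[of vs k] n_gt_1
    by (intro pt_separated) (auto simp: words_def)
  also have "(0 # w) @ blk k us = blk k (w # us)" by (simp add: blk_def)
  also have "(0 # w') @ blk k vs = blk k (w' # vs)" by (simp add: blk_def)
  also have "pt lam a (blk k (w # us)) - pt lam a (blk k (w' # vs)) =
    pt (lam ^ Suc k) (\<lambda>w. lam * pt lam a w) (w # us) - pt (lam ^ Suc k) (\<lambda>w. lam * pt lam a w) (w' # vs)"
    using assms blk_props(3)[of "w # us" k] blk_props(3)[of "w' # vs" k] by simp
  finally show ?thesis using assms by (simp add: words_def)
qed

end

section \<open>Uniform mean square bounds on lines\<close>

lemma cmod_sq_integral_mono:
  fixes F G :: "real \<Rightarrow> complex"
  assumes "a \<le> b" "0 \<le> C" "\<And>x. a \<le> x \<Longrightarrow> x \<le> b \<Longrightarrow> cmod (F x) \<le> C * cmod (G x)"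
    "(\<lambda>x. (cmod (F x))\<^sup>2) integrable_on {a..b}" "(\<lambda>x. (cmod (G x))\<^sup>2) integrable_on {a..b}"
  shows "integral {a..b} (\<lambda>x. (cmod (F x))\<^sup>2) \<le> C\<^sup>2 * integral {a..b} (\<lambda>x. (cmod (G x))\<^sup>2)"
proof -
  have "integral {a..b} (\<lambda>x. (cmod (F x))\<^sup>2) \<le> integral {a..b} (\<lambda>x. C\<^sup>2 * (cmod (G x))\<^sup>2)"
  proof (intro integral_le assms integrable_on_mult_right)
    fix x assume "x \<in> {a..b}"
    then have "(cmod (F x))\<^sup>2 \<le> (C * cmod (G x))\<^sup>2" using assms by (intro power_mono) auto
    then show "(cmod (F x))\<^sup>2 \<le> C\<^sup>2 * (cmod (G x))\<^sup>2" by (simp add: power_mult_distrib)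
  qed
  then show ?thesis by simp
qed

lemma trig_line: "trig V c b m (of_real x * z) = (\<Sum>u\<in>words V m. cis (x * proj z (pt c b u)))"
  unfolding trig_def proj_scale ..

lemma trig_line_integrable: "(\<lambda>x. (cmod (trig V c b m (of_real x * z)))\<^sup>2) integrable_on {\<alpha>..\<beta>}"
  unfolding trig_line by (rule norm_sum_cis_integrable)

text \<open>\<open>rot\<close> is the irrationality of the argument, in the form that passes to
  powers of \<open>lam\<close>; the last assumption is what being outside the exceptional set
  provides.\<close>

locale irrational_ifs = separated_ifs +
  fixes E' :: "complex set"
  assumes rot: "\<And>k. k > 0 \<Longrightarrow> (lam / cnj lam) ^ k \<noteq> 1"
    and decay: "fourier_decay_outside E'" and E': "\<And>k. k > 0 \<Longrightarrow> lam ^ k \<notin> E'"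
begin

text \<open>The decay hypothesis asks for a nonreal ratio, which \<open>rot\<close> gives, and for
  two different translations, which separation gives.\<close>

lemma lam_power_decay:
  assumes "k > 0"
  shows "\<exists>C>0. \<exists>\<gamma>>0. \<forall>\<xi> M. 1 \<le> cmod \<xi> \<longrightarrow> cmod (lam ^ k) ^ M * (cmod \<xi>)\<^sup>2 \<le> 1 \<longrightarrow>
    cmod (trig {..<n} (lam ^ k) a M \<xi>) \<le> C * real n ^ M * cmod \<xi> powr (- \<gamma>)"
proof -
  have c1: "cmod (lam ^ k) < 1" using lam assms by (simp add: norm_power power_less_one_iff)
  interpret P: digit_series n a "lam ^ k"
    using n_gt_1 c1 a_outside' by unfold_locales auto
  have "lam ^ k \<notin> \<real>"
  proof
    assume "lam ^ k \<in> \<real>"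
    then have "cnj (lam ^ k) = lam ^ k" by (simp add: Reals_cnj_iff)
    then have "(lam / cnj lam) ^ k = 1" using lam by (simp add: power_divide)
    then show False using rot assms by blast
  qed
  then have l: "lam ^ k \<in> ball 0 1 - (E' \<union> \<real>)" using c1 E'[OF assms] by simp
  have p: "(\<lambda>_. 1 / real n) \<in> prob_vectors {..<n}" using n_gt_1 by (auto simp: prob_vectors_def)
  have "\<exists>i\<in>{..<n}. \<exists>j\<in>{..<n}. a i \<noteq> a j" using a_inj[of 0 1] n_gt_1 by force
  moreover have "finite {..<n}" "{..<n} \<noteq> {}" using n_gt_1 by auto
  ultimately obtain C \<gamma> where "C > 0" "\<gamma> > 0"
      "\<And>\<xi>. \<xi> \<noteq> 0 \<Longrightarrow> cmod (fourier_transform P.\<eta> \<xi>) \<le> C * cmod \<xi> powr (- \<gamma>)"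
    using decay[unfolded fourier_decay_outside_def, rule_format, OF l p, of a P.\<eta>] P.self_similar_\<eta> by blast
  then show ?thesis by (rule P.trig_decay)
qed

text \<open>On \<open>[Q^i, Q^(i + 1)]\<close> the factor of \<open>trig_split\<close> with ratio \<open>lam^(k + 1)\<close> gains \<open>Q^(-\<gamma> i)\<close> by Fourier
  decay, and the square of this gain beats the loss \<open>Q^(\<gamma> (i + 1))\<close> in the \<open>L^2\<close> bound of the block factor.\<close>

lemma trig_L2_bound:
  "\<exists>C>0. \<forall>R. \<exists>m0. \<forall>m\<ge>m0. \<forall>z. cmod z = 1 \<longrightarrow>
     integral {0..R} (\<lambda>x. (cmod (trig {..<n} lam a m (of_real x * z)))\<^sup>2) \<le> C * real n ^ (2 * m)"
proof -
  \<comment> \<open>Taking one letter out of each block of \<open>k + 1\<close> leaves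
    \<open>n ^ k\<close> digits with ratio \<open>rho ^ (k + 1)\<close>. For this \<open>k\<close>
    the product of the two still exceeds 1, so the block system keeps dimension greater than
    1.\<close>
  obtain k where k: "real n < (real n * rho) ^ k"
    using real_arch_pow[of "real n * rho"] n_lam by (auto simp: rho_def)
  define c where "c = lam ^ Suc k"
  define b where "b = (\<lambda>w. lam * pt lam a w)"
  have cn: "cmod c = rho ^ Suc k" by (simp add: c_def norm_power norm_mult rho_def)
  interpret S: separated_digits "W k" b c "gap * rho ^ Suc k"
  proof
    show "finite (W k)" by simp
    show "c \<noteq> 0" using lam by (simp add: c_def)
    show "cmod c < 1" unfolding cn using rho by (simp add: power_less_one_iff del: power_Suc)
    show "1 < real (card (W k)) * cmod c"
    proof -
      have "real n ^ k * rho ^ Suc k * real n = (real n * rho) ^ Suc k"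
        by (simp add: power_mult_distrib mult_ac)
      also have "\<dots> = (real n * rho) ^ k * (real n * rho)" by simp
      also have "\<dots> > real n"
      proof -
        have "(real n * rho) ^ k * 1 \<le> (real n * rho) ^ k * (real n * rho)"
          using n_lam rho by (intro mult_left_mono) (auto simp: rho_def)
        then show ?thesis using k by linarith
      qed
      finally have "1 * real n < real n ^ k * rho ^ Suc k * real n" by simp
      then show ?thesis using n_gt_1 unfolding cn card_words[OF finite_lessThan]
        by (subst (asm) mult_less_cancel_right_pos) auto
    qed
    show "0 < gap * rho ^ Suc k" using gap rho by simp
    show "gap * rho ^ Suc k \<le> cmod (pt c b (i # u) - pt c b (j # v))"
      if "i \<in> W k" "j \<in> W k" "i \<noteq> j" "set u \<subseteq> W k" "set v \<subseteq> W k" "length u = length v" for i j u v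
      unfolding c_def b_def by (rule separated_blocks[OF that])
    show "(c / cnj c) ^ m \<noteq> 1" if "m > 0" for m
    proof -
      have "(c / cnj c) ^ m = (lam / cnj lam) ^ (Suc k * m)"
        unfolding c_def by (simp only: complex_cnj_power power_divide power_mult)
      then show ?thesis using rot[of "Suc k * m"] that by simp
    qed
  qed
  obtain C1 \<gamma> where C1: "C1 > 0" "\<gamma> > 0" "\<And>\<xi> M. 1 \<le> cmod \<xi> \<Longrightarrow> cmod c ^ M * (cmod \<xi>)\<^sup>2 \<le> 1 \<Longrightarrow>
    cmod (trig {..<n} c a M \<xi>) \<le> C1 * real n ^ M * cmod \<xi> powr (- \<gamma>)"
    using lam_power_decay[of "Suc k"] unfolding c_def by (metis zero_less_Suc)
  \<comment> \<open>The loss exponent of the block factor is set to the decay exponent \<gamma> of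
    the other factor.\<close>
  obtain l C2 where l: "l > 0" "C2 > 0" "\<And>M z. cmod z = 1 \<Longrightarrow>
    integral {0..1 / S.r ^ (M * l)} (\<lambda>x. (cmod (trig (W k) c b (M * l) (of_real x * z)))\<^sup>2)
    \<le> C2 * (S.N ^ (2 * (M * l)) * (S.r powr - \<gamma>) ^ (M * l))"
    using S.norm_sum_cis_words_integral[OF C1(2)] unfolding trig_line by metis
  define Q where "Q = 1 / S.r ^ l"
  have Q: "Q > 1" using S.r l(1) by (simp add: Q_def power_less_one_iff)
  have Qp: "1 / S.r ^ (M * l) = Q ^ M" for M
    by (simp add: Q_def power_divide power_mult[symmetric] mult.commute)
  have Qg: "(S.r powr - \<gamma>) ^ (M * l) = (Q powr \<gamma>) ^ M" for M
  proof -
    have "Q powr \<gamma> = (S.r powr - \<gamma>) ^ l"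
      using S.r by (simp add: Q_def powr_divide powr_minus_divide powr_powr[symmetric] powr_realpow[symmetric] power_divide)
       (simp add: powr_powr mult.commute)
    then show ?thesis by (simp add: power_mult[symmetric] mult.commute)
  qed
  define q where "q = Q powr - \<gamma>"
  have q: "0 < q" "q < 1" using Q C1(2) by (auto simp: q_def powr_less_one)
  have qQ: "q * Q powr \<gamma> = 1" using Q by (simp add: q_def powr_minus)
  define C3 where "C3 = C1\<^sup>2 * C2 * Q powr \<gamma>"
  have C3: "C3 > 0" using C1 l Q by (simp add: C3_def)
  have NN: "S.N = real n ^ k" by (simp add: S.N_def card_words)
  have annulus: "integral {Q ^ i..Q ^ Suc i} (\<lambda>x. (cmod (trig {..<n} lam a (Suc k * M) (of_real x * z)))\<^sup>2)
      \<le> C3 * q ^ i * real n ^ (2 * (Suc k * M))"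
    if z: "cmod z = 1" and M: "2 * (Suc i * l) \<le> M" for i M z
  proof -
    define G where "G = C1 * real n ^ M * q ^ i * S.N ^ (M - Suc i * l)"
    have G: "0 \<le> G" using C1 q S.N by (auto simp: G_def)
    have "cmod (trig {..<n} lam a (Suc k * M) (of_real x * z)) \<le> G * cmod (trig (W k) c b (Suc i * l) (of_real x * z))"
      if x: "Q ^ i \<le> x" "x \<le> Q ^ Suc i" for x
    proof -
      have Qi: "1 \<le> Q ^ i" using Q by (intro one_le_power) auto
      have nx: "cmod (of_real x * z) = x" using x Qi z by (simp add: norm_mult)
      \<comment> \<open>The lower bound on \<open>M\<close> serves here: the truncation at level
        \<open>M\<close> must be fine enough for all frequencies up to
        \<open>Q ^ Suc i\<close>.\<close>
      have "cmod c ^ M * x\<^sup>2 \<le> cmod c ^ (2 * (Suc i * l)) * (Q ^ Suc i)\<^sup>2"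
        using S.r x Qi M unfolding S.r_def[symmetric] by (intro mult_mono power_decreasing power_mono) auto
      also have "\<dots> = (S.r ^ (Suc i * l) * Q ^ Suc i)\<^sup>2"
        unfolding S.r_def[symmetric] by (simp only: power_mult_distrib power_mult[symmetric] mult.commute)
      also have "S.r ^ (Suc i * l) * Q ^ Suc i = 1" using S.r by (simp only: Qp[symmetric]) simp
      finally have "cmod (trig {..<n} c a M (of_real x * z)) \<le> C1 * real n ^ M * x powr (- \<gamma>)"
        using C1(3)[of "of_real x * z" M] x Qi unfolding nx by auto
      also have "\<dots> \<le> C1 * real n ^ M * q ^ i"
      proof (intro mult_left_mono)
        have "x powr - \<gamma> \<le> (Q ^ i) powr - \<gamma>" using x Qi C1(2) by (intro powr_mono2') auto
        also have "\<dots> = q ^ i" using Q by (simp add: q_def powr_realpow[symmetric] powr_powr mult.commute)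
        finally show "x powr - \<gamma> \<le> q ^ i" .
      qed (use C1 in auto)
      finally have 1: "cmod (trig {..<n} c a M (of_real x * z)) \<le> C1 * real n ^ M * q ^ i" .
      \<comment> \<open>The mean square bound for \<open>Suc i * l\<close> blocks reaches exactly up
        to the frequency \<open>Q ^ Suc i\<close>; the further blocks are estimated
        trivially.\<close>
      have 2: "cmod (trig (W k) c b M (of_real x * z))
          \<le> S.N ^ (M - Suc i * l) * cmod (trig (W k) c b (Suc i * l) (of_real x * z))"
        using cmod_trig_add_le[of "W k" c b "Suc i * l" "M - Suc i * l" "of_real x * z"] M
        by (simp add: S.N_def)
      have "cmod (trig {..<n} lam a (Suc k * M) (of_real x * z)) =
          cmod (trig {..<n} c a M (of_real x * z)) * cmod (trig (W k) c b M (of_real x * z))"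
        unfolding c_def b_def trig_split[OF finite_lessThan] norm_mult ..
      also have "\<dots> \<le> (C1 * real n ^ M * q ^ i) * (S.N ^ (M - Suc i * l) * cmod (trig (W k) c b (Suc i * l) (of_real x * z)))"
        using C1 q by (intro mult_mono 1 2) auto
      finally show ?thesis by (simp add: G_def mult_ac)
    qed
    then have "integral {Q ^ i..Q ^ Suc i} (\<lambda>x. (cmod (trig {..<n} lam a (Suc k * M) (of_real x * z)))\<^sup>2)
      \<le> G\<^sup>2 * integral {Q ^ i..Q ^ Suc i} (\<lambda>x. (cmod (trig (W k) c b (Suc i * l) (of_real x * z)))\<^sup>2)"
      using Q G by (intro cmod_sq_integral_mono trig_line_integrable) auto
    also have "\<dots> \<le> G\<^sup>2 * integral {0..Q ^ Suc i} (\<lambda>x. (cmod (trig (W k) c b (Suc i * l) (of_real x * z)))\<^sup>2)"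
      using Q by (intro mult_left_mono integral_subset_le trig_line_integrable) auto
    also have "\<dots> \<le> G\<^sup>2 * (C2 * (S.N ^ (2 * (Suc i * l)) * (Q powr \<gamma>) ^ Suc i))"
      using l(3)[OF z, of "Suc i"] unfolding Qp Qg by (intro mult_left_mono) auto
    also have "\<dots> = C1\<^sup>2 * C2 * Q powr \<gamma> * (q ^ i * (q * Q powr \<gamma>) ^ i) *
        (real n ^ M)\<^sup>2 * (S.N ^ (M - Suc i * l) * S.N ^ (Suc i * l))\<^sup>2"
      unfolding G_def by (simp add: power_mult_distrib power2_eq_square power_add mult_2 del: mult_Suc mult_Suc_right)
    also have "S.N ^ (M - Suc i * l) * S.N ^ (Suc i * l) = S.N ^ M"
      using M by (simp only: power_add[symmetric]) simp
    also have "C1\<^sup>2 * C2 * Q powr \<gamma> * (q ^ i * (q * Q powr \<gamma>) ^ i) * (real n ^ M)\<^sup>2 * (S.N ^ M)\<^sup>2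
      = C1\<^sup>2 * C2 * Q powr \<gamma> * (q ^ i * (q * Q powr \<gamma>) ^ i) * real n ^ (2 * (Suc k * M))"
      unfolding NN by (simp add: power_mult[symmetric] power_add[symmetric] algebra_simps)
    finally show ?thesis by (simp add: C3_def qQ mult.assoc)
  qed
  define C4 where "C4 = 1 + C3 / (1 - q)"
  have C4: "C4 > 0" using C3 q by (auto simp: C4_def intro!: add_pos_nonneg)
  have total: "integral {0..Q ^ J} (\<lambda>x. (cmod (trig {..<n} lam a (Suc k * M) (of_real x * z)))\<^sup>2)
      \<le> (1 + C3 * (\<Sum>i<J. q ^ i)) * real n ^ (2 * (Suc k * M))"
    if z: "cmod z = 1" and M: "2 * (J * l) \<le> M" for J M z
    using M
  proof (induction J)
    case 0
    have "integral {0..1} (\<lambda>x. (cmod (trig {..<n} lam a (Suc k * M) (of_real x * z)))\<^sup>2)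
        \<le> integral {0..1} (\<lambda>x::real. (real n ^ (Suc k * M))\<^sup>2)"
      using cmod_trig_le[of "{..<n}" lam a "Suc k * M"]
      by (intro integral_le trig_line_integrable power_mono) auto
    then show ?case by (simp add: power_mult[symmetric] mult.commute)
  next
    case (Suc J)
    let ?F = "\<lambda>x. (cmod (trig {..<n} lam a (Suc k * M) (of_real x * z)))\<^sup>2"
    have "integral {0..Q ^ Suc J} ?F = integral {0..Q ^ J} ?F + integral {Q ^ J..Q ^ Suc J} ?F"
      using Q by (intro Henstock_Kurzweil_Integration.integral_combine[symmetric] trig_line_integrable) auto
    also have "\<dots> \<le> (1 + C3 * (\<Sum>i<J. q ^ i)) * real n ^ (2 * (Suc k * M)) + C3 * q ^ J * real n ^ (2 * (Suc k * M))"
      using Suc by (intro add_mono annulus z Suc.IH) auto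
    finally show ?case by (simp add: algebra_simps)
  qed
  have "\<exists>m0. \<forall>m\<ge>m0. \<forall>z. cmod z = 1 \<longrightarrow>
     integral {0..R} (\<lambda>x. (cmod (trig {..<n} lam a m (of_real x * z)))\<^sup>2) \<le> C4 * real n ^ (2 * m)" for R
  proof -
    obtain J where J: "R < Q ^ J" using real_arch_pow[OF Q] by blast
    define M where "M = 2 * (J * l)"
    show ?thesis
    proof (intro exI[of _ "Suc k * M"] allI impI)
      fix m z assume m: "Suc k * M \<le> m" and z: "cmod z = 1"
      \<comment> \<open>The letters beyond a full number of blocks cost no more than their trivial
        factor \<open>n ^ e\<close>.\<close>
      define e where "e = m - Suc k * M"
      have m': "m = Suc k * M + e" using m by (simp add: e_def)
      have "integral {0..R} (\<lambda>x. (cmod (trig {..<n} lam a m (of_real x * z)))\<^sup>2)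
          \<le> integral {0..Q ^ J} (\<lambda>x. (cmod (trig {..<n} lam a m (of_real x * z)))\<^sup>2)"
        using J by (intro integral_subset_le trig_line_integrable) auto
      also have "\<dots> \<le> (real n ^ e)\<^sup>2 * integral {0..Q ^ J} (\<lambda>x. (cmod (trig {..<n} lam a (Suc k * M) (of_real x * z)))\<^sup>2)"
        unfolding m' using Q cmod_trig_add_le[of "{..<n}" lam a "Suc k * M" e]
        by (intro cmod_sq_integral_mono trig_line_integrable) auto
      also have "\<dots> \<le> (real n ^ e)\<^sup>2 * ((1 + C3 * (\<Sum>i<J. q ^ i)) * real n ^ (2 * (Suc k * M)))"
        by (intro mult_left_mono total z) (auto simp: M_def)
      also have "\<dots> \<le> (real n ^ e)\<^sup>2 * (C4 * real n ^ (2 * (Suc k * M)))"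
      proof (intro mult_left_mono mult_right_mono)
        have "(\<Sum>i<J. q ^ i) = (1 - q ^ J) / (1 - q)" using q by (subst sum_gp_strict) auto
        also have "\<dots> \<le> 1 / (1 - q)" using q by (intro divide_right_mono) auto
        finally have "C3 * (\<Sum>i<J. q ^ i) \<le> C3 * (1 / (1 - q))" using C3 by (intro mult_left_mono) auto
        then show "1 + C3 * (\<Sum>i<J. q ^ i) \<le> C4" by (simp add: C4_def)
      qed auto
      also have "\<dots> = C4 * real n ^ (2 * m)"
        unfolding m' by (simp add: power_mult[symmetric] power_add[symmetric] algebra_simps)
      finally show "integral {0..R} (\<lambda>x. (cmod (trig {..<n} lam a m (of_real x * z)))\<^sup>2) \<le> C4 * real n ^ (2 * m)" .
    qed
  qed
  then show ?thesis using C4 by blast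
qed

text \<open>The constant is the same for all distances \<delta> and all directions; only the level
  from which the bound holds depends on \<delta>. So the level can go to infinity first and \<delta>
  to 0 afterwards.\<close>

lemma pair_count_bound:
  "\<exists>C>0. \<forall>\<delta>>0. \<exists>m0. \<forall>m\<ge>m0. \<forall>z. cmod z = 1 \<longrightarrow>
     (\<Sum>u\<in>W m. \<Sum>v\<in>W m. of_bool (\<bar>proj z (pt lam a u) - proj z (pt lam a v)\<bar> \<le> \<delta>)) \<le> C * \<delta> * real n ^ (2 * m)"
proof -
  obtain C where C: "C > 0" "\<And>R. \<exists>m0. \<forall>m\<ge>m0. \<forall>z. cmod z = 1 \<longrightarrow>
     integral {0..R} (\<lambda>x. (cmod (trig {..<n} lam a m (of_real x * z)))\<^sup>2) \<le> C * real n ^ (2 * m)"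
    using trig_L2_bound by metis
  show ?thesis
  proof (intro exI[of _ "4 * C"] conjI allI impI)
    fix \<delta> :: real assume d: "\<delta> > 0"
    obtain m0 where m0: "\<And>m z. m \<ge> m0 \<Longrightarrow> cmod z = 1 \<Longrightarrow>
     integral {0..1 / \<delta>} (\<lambda>x. (cmod (trig {..<n} lam a m (of_real x * z)))\<^sup>2) \<le> C * real n ^ (2 * m)"
      using C(2)[of "1 / \<delta>"] by blast
    show "\<exists>m0. \<forall>m\<ge>m0. \<forall>z. cmod z = 1 \<longrightarrow>
     (\<Sum>u\<in>W m. \<Sum>v\<in>W m. of_bool (\<bar>proj z (pt lam a u) - proj z (pt lam a v)\<bar> \<le> \<delta>)) \<le> 4 * C * \<delta> * real n ^ (2 * m)"
    proof (intro exI[of _ m0] allI impI)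
      fix m z assume m: "m0 \<le> m" and z: "cmod z = 1"
      have "(\<Sum>u\<in>W m. \<Sum>v\<in>W m. of_bool (\<bar>proj z (pt lam a u) - proj z (pt lam a v)\<bar> \<le> 1 / (1 / \<delta>)))
        \<le> 4 / (1 / \<delta>) * integral {0..1 / \<delta>} (\<lambda>x. (cmod (\<Sum>u\<in>W m. cis (x * proj z (pt lam a u))))\<^sup>2)"
        using d by (intro norm_sum_cis_integral_lower) auto
      also have "\<dots> \<le> 4 / (1 / \<delta>) * (C * real n ^ (2 * m))"
        using m0[OF m z] d unfolding trig_line by (intro mult_left_mono) auto
      finally show "(\<Sum>u\<in>W m. \<Sum>v\<in>W m. of_bool (\<bar>proj z (pt lam a u) - proj z (pt lam a v)\<bar> \<le> \<delta>))
          \<le> 4 * C * \<delta> * real n ^ (2 * m)" by (simp add: mult_ac)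
    qed
  qed (use C in auto)
qed

section \<open>Absolute continuity of the projections\<close>

text \<open>The projection of the normalised restriction of \<eta> to the cylinder of
  \<open>u\<close>; for \<open>u = []\<close> it is the projection of \<eta> itself.\<close>

definition nu :: "complex \<Rightarrow> nat list \<Rightarrow> real measure" where
  "nu z u = distr \<Omega> borel (\<lambda>\<omega>. proj z (f u (X \<omega>)))"

lemma proj_measurable [measurable]: "proj z \<in> borel_measurable borel"
  unfolding proj_def[abs_def] by (intro borel_measurable_continuous_onI continuous_intros)

lemma f_measurable [measurable]: "f u \<in> borel_measurable borel"
  unfolding f_def[abs_def] by measurable

lemma sets_nu [measurable_cong, simp]: "sets (nu z u) = sets borel" by (simp add: nu_def)
lemma space_nu [simp]: "space (nu z u) = UNIV" by (simp add: nu_def)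

lemma prob_nu: "prob_space (nu z u)"
  unfolding nu_def by (rule \<Omega>.prob_space_distr) measurable

lemma measure_nu:
  "A \<in> sets borel \<Longrightarrow> measure (nu z u) A = measure \<Omega> {\<omega> \<in> space \<Omega>. proj z (f u (X \<omega>)) \<in> A}"
  unfolding nu_def by (subst measure_distr) (auto simp: vimage_def Int_def conj_commute)

lemma measure_stake: "measure \<Omega> {\<omega> \<in> space \<Omega>. stake m \<omega> \<in> A} = real (card (W m \<inter> A)) / real n ^ m"
proof -
  have W: "finite (W m)" "W m \<noteq> {}"
    using card_words_pos[of "{..<n}" m] n_pos by (auto simp: lessThan_empty_iff)
  have "measure \<Omega> {\<omega> \<in> space \<Omega>. stake m \<omega> \<in> A} = measure (distr \<Omega> (count_space UNIV) (stake m)) A"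
    by (subst measure_distr) (auto simp: vimage_def Int_def conj_commute)
  also have "\<dots> = real (card (W m \<inter> A)) / real (card (W m))"
    unfolding distr_stake using W by (simp add: measure_pmf_of_set)
  finally show ?thesis by (simp add: card_words)
qed

text \<open>Let \<open>J'\<close> be the occupied cells of length \<delta> inside \<open>U\<close>.
  By Cauchy-Schwarz the squared mass of these cells is at most their number times the sum of their
  squared masses. The number times \<delta> is at most the length of \<open>U\<close>, and the sum
  is a normalised pair count. Points of \<open>S\<close> are so far inside \<open>U\<close> that
  replacing the series by a word of length \<open>m\<close> keeps the whole cell in
  \<open>U\<close>.\<close>

lemma nu_Nil_interior:
  assumes C: "C > 0" "\<delta> > 0" and z: "cmod z = 1" and U: "open U" "emeasure lborel U < \<infinity>"
    and pc: "\<And>m. m \<ge> m0 \<Longrightarrow>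
     (\<Sum>u\<in>W m. \<Sum>v\<in>W m. of_bool (\<bar>proj z (pt lam a u) - proj z (pt lam a v)\<bar> \<le> \<delta>)) \<le> C * \<delta> * real n ^ (2 * m)"
    and S: "S \<in> sets borel" "\<And>x y. x \<in> S \<Longrightarrow> dist x y < 2 * \<delta> \<Longrightarrow> y \<in> U"
  shows "(measure (nu z []) S)\<^sup>2 \<le> C * measure lborel U"
proof -
  define k where "k y = \<lfloor>y / \<delta>\<rfloor>" for y :: real
  define p where "p u = proj z (pt lam a u)" for u
  obtain m1 where m1: "(B0 + 1) * rho ^ m1 < \<delta>"
  proof -
    obtain m1 where "rho ^ m1 < \<delta> / (B0 + 1)"
      using real_arch_pow_inv[of "\<delta> / (B0 + 1)" rho] rho C B0 by auto
    then have "(B0 + 1) * rho ^ m1 < \<delta>" using B0 by (simp add: field_simps)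
    then show thesis by (rule that)
  qed
  define m where "m = max m0 m1"
  have m: "m \<ge> m0" "rho ^ m * B0 \<le> \<delta>"
  proof -
    have "rho ^ m * B0 \<le> rho ^ m1 * (B0 + 1)"
      using rho B0 by (intro mult_mono power_decreasing) (auto simp: m_def)
    then show "rho ^ m * B0 \<le> \<delta>" using m1 by (simp add: mult.commute)
  qed (simp add: m_def)
  define J where "J = {j. \<forall>x. k x = j \<longrightarrow> x \<in> U}"
  define J' where "J' = (\<lambda>u. k (p u)) ` W m \<inter> J"
  define N where "N j = (\<Sum>u\<in>W m. of_bool (k (p u) = j) :: real)" for j
  have fin: "finite (W m)" "finite J'" by (auto simp: J'_def)
  have near: "\<bar>x - y\<bar> < \<delta>" if "k x = k y" for x y
  proof -
    have "\<bar>x / \<delta> - y / \<delta>\<bar> < 1" using that unfolding k_def by linarith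
    then show ?thesis using C by (simp add: diff_divide_distrib[symmetric] field_simps)
  qed
  have "measure (nu z []) S = measure \<Omega> {\<omega> \<in> space \<Omega>. proj z (X \<omega>) \<in> S}"
    using measure_nu[OF S(1)] by simp
  also have "\<dots> \<le> measure \<Omega> {\<omega> \<in> space \<Omega>. stake m \<omega> \<in> {u. k (p u) \<in> J}}"
  proof (intro \<Omega>.finite_measure_mono subsetI)
    fix \<omega> assume "\<omega> \<in> {\<omega> \<in> space \<Omega>. proj z (X \<omega>) \<in> S}"
    then have w: "\<omega> \<in> space \<Omega>" "proj z (X \<omega>) \<in> S" by auto
    have "\<bar>proj z (X \<omega>) - p (stake m \<omega>)\<bar> \<le> cmod z * cmod (X \<omega> - pt lam a (stake m \<omega>))"
      unfolding p_def proj_diff[symmetric] by (rule abs_proj_le)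
    also have "\<dots> \<le> \<delta>" using z m cmod_X_stake_le[of \<omega> m] by (simp add: rho_def)
    finally have 1: "\<bar>proj z (X \<omega>) - p (stake m \<omega>)\<bar> \<le> \<delta>" .
    have "x \<in> U" if "k x = k (p (stake m \<omega>))" for x
    proof (rule S(2)[OF w(2)])
      show "dist (proj z (X \<omega>)) x < 2 * \<delta>" using 1 near[OF that] by (simp add: dist_real_def)
    qed
    then show "\<omega> \<in> {\<omega> \<in> space \<Omega>. stake m \<omega> \<in> {u. k (p u) \<in> J}}" using w by (auto simp: J_def)
  next
    show "{\<omega> \<in> space \<Omega>. stake m \<omega> \<in> {u. k (p u) \<in> J}} \<in> sets \<Omega>"
      by (rule measurable_sets_Collect[OF stake_measurable]) simp
  qed
  also have "\<dots> = real (card (W m \<inter> {u. k (p u) \<in> J})) / real n ^ m" by (rule measure_stake)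
  also have "real (card (W m \<inter> {u. k (p u) \<in> J})) = (\<Sum>j\<in>J'. N j)"
  proof -
    have "(\<Sum>j\<in>J'. N j) = (\<Sum>u\<in>W m. \<Sum>j\<in>J'. of_bool (k (p u) = j))" unfolding N_def by (rule sum.swap)
    also have "\<dots> = (\<Sum>u\<in>W m. of_bool (k (p u) \<in> J))"
    proof (intro sum.cong refl)
      fix u assume "u \<in> W m"
      have "(\<Sum>j\<in>J'. of_bool (k (p u) = j)) = (\<Sum>j\<in>J'. if k (p u) = j then 1 else 0 :: real)"
        by (intro sum.cong) auto
      also have "\<dots> = of_bool (k (p u) \<in> J)" using fin \<open>u \<in> W m\<close> by (simp add: J'_def)
      finally show "(\<Sum>j\<in>J'. of_bool (k (p u) = j)) = (of_bool (k (p u) \<in> J) :: real)" .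
    qed
    also have "\<dots> = real (card (W m \<inter> {u. k (p u) \<in> J}))"
      using fin by (simp add: of_bool_def sum.If_cases)
    finally show ?thesis by simp
  qed
  finally have "(measure (nu z []) S)\<^sup>2 \<le> ((\<Sum>j\<in>J'. N j) / real n ^ m)\<^sup>2"
    by (intro power_mono) auto
  also have "\<dots> = (\<Sum>j\<in>J'. 1 * N j)\<^sup>2 / real n ^ (2 * m)"
    by (simp add: power_divide power_mult[symmetric] mult.commute)
  also have "\<dots> \<le> (\<Sum>j\<in>J'. 1\<^sup>2) * (\<Sum>j\<in>J'. (N j)\<^sup>2) / real n ^ (2 * m)"
    by (intro divide_right_mono Cauchy_Schwarz_ineq_sum) auto
  also have "\<dots> \<le> (\<Sum>j\<in>J'. 1\<^sup>2) * (C * \<delta> * real n ^ (2 * m)) / real n ^ (2 * m)"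
  proof (intro divide_right_mono mult_left_mono)
    have "(\<Sum>j\<in>J'. (N j)\<^sup>2) = (\<Sum>j\<in>J'. \<Sum>u\<in>W m. \<Sum>v\<in>W m. of_bool (k (p u) = j) * of_bool (k (p v) = j))"
      unfolding N_def power2_eq_square sum_product ..
    also have "\<dots> = (\<Sum>u\<in>W m. \<Sum>j\<in>J'. \<Sum>v\<in>W m. of_bool (k (p u) = j) * of_bool (k (p v) = j))"
      by (rule sum.swap)
    also have "\<dots> = (\<Sum>u\<in>W m. \<Sum>v\<in>W m. \<Sum>j\<in>J'. of_bool (k (p u) = j) * of_bool (k (p v) = j))"
      by (intro sum.cong refl sum.swap)
    also have "\<dots> \<le> (\<Sum>u\<in>W m. \<Sum>v\<in>W m. of_bool (\<bar>p u - p v\<bar> \<le> \<delta>))"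
    proof (intro sum_mono)
      fix u v
      have "(\<Sum>j\<in>J'. of_bool (k (p u) = j) * of_bool (k (p v) = j))
          = (\<Sum>j\<in>J'. if k (p u) = j then of_bool (k (p v) = j) else 0 :: real)"
        by (intro sum.cong) auto
      also have "\<dots> \<le> of_bool (k (p u) = k (p v))" using fin by auto
      also have "\<dots> \<le> of_bool (\<bar>p u - p v\<bar> \<le> \<delta>)" using near[of "p u" "p v"] by auto
      finally show "(\<Sum>j\<in>J'. of_bool (k (p u) = j) * of_bool (k (p v) = j)) \<le> (of_bool (\<bar>p u - p v\<bar> \<le> \<delta>) :: real)" .
    qed
    also have "\<dots> \<le> C * \<delta> * real n ^ (2 * m)" using pc[OF m(1)] by (simp add: p_def)
    finally show "(\<Sum>j\<in>J'. (N j)\<^sup>2) \<le> C * \<delta> * real n ^ (2 * m)" .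
  qed auto
  also have "\<dots> = C * (real (card J') * \<delta>)" using n_pos by simp
  also have "\<dots> \<le> C * measure lborel U"
  proof (intro mult_left_mono)
    define I where "I j = {real_of_int j * \<delta>..<(real_of_int j + 1) * \<delta>}" for j
    have I: "x \<in> I j \<longleftrightarrow> k x = j" for x j
      using C unfolding I_def k_def floor_eq_iff by (simp add: field_simps)
    have "disjoint_family_on I J'" by (auto simp: disjoint_family_on_def I set_eq_iff)
    then have "measure lborel (\<Union>j\<in>J'. I j) = (\<Sum>j\<in>J'. measure lborel (I j))"
    proof (intro measure_finite_Union)
      fix j
      have "real_of_int j * \<delta> \<le> (real_of_int j + 1) * \<delta>" using C by (intro mult_right_mono) auto
      then show "emeasure lborel (I j) \<noteq> \<infinity>" by (simp add: I_def)
    next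
      show "I ` J' \<subseteq> sets lborel" by (simp add: I_def image_subset_iff)
      show "finite J'" by (rule fin)
    qed
    also have "\<dots> = (\<Sum>j\<in>J'. \<delta>)" using C by (intro sum.cong refl) (simp add: I_def algebra_simps)
    finally have "real (card J') * \<delta> = measure lborel (\<Union>j\<in>J'. I j)" by simp
    also have "\<dots> \<le> measure lborel U"
    proof (rule measure_mono_fmeasurable)
      show "(\<Union>j\<in>J'. I j) \<subseteq> U" by (auto simp: I J'_def J_def)
      show "(\<Union>j\<in>J'. I j) \<in> sets lborel" using fin by (auto simp: I_def)
      show "U \<in> fmeasurable lborel" using U by (intro fmeasurableI) auto
    qed
    finally show "real (card J') * \<delta> \<le> measure lborel U" .
  qed (use C in auto)
  finally show ?thesis .
qed

text \<open>The sets \<open>S j\<close> of points at distance at least \<open>2 / (j + 1)\<close>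
  from the complement exhaust \<open>U\<close>, and each is treated with
  \<open>\<delta> = 1 / (j + 1)\<close> and the same \<open>C\<close>.\<close>

lemma nu_Nil_open:
  assumes C: "C > 0" and pc: "\<And>\<delta>. \<delta> > 0 \<Longrightarrow> \<exists>m0. \<forall>m\<ge>m0. \<forall>z. cmod z = 1 \<longrightarrow>
     (\<Sum>u\<in>W m. \<Sum>v\<in>W m. of_bool (\<bar>proj z (pt lam a u) - proj z (pt lam a v)\<bar> \<le> \<delta>)) \<le> C * \<delta> * real n ^ (2 * m)"
    and z: "cmod z = 1" and U: "open U"
  shows "ennreal ((measure (nu z []) U)\<^sup>2) \<le> ennreal C * emeasure lborel U"
proof (cases "emeasure lborel U < \<infinity>")
  case True
  interpret P: prob_space "nu z []" by (rule prob_nu)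
  define S where "S j = (\<Inter>y\<in>-U. {x. 2 * (1 / real (Suc j)) \<le> dist x y})" for j
  have S_closed: "closed (S j)" for j
    unfolding S_def by (intro closed_INT ballI closed_Collect_le continuous_intros)
  have inc: "incseq S"
  proof (rule incseq_SucI)
    fix j
    have "2 * (1 / real (Suc (Suc j))) \<le> 2 * (1 / real (Suc j))" by (simp add: field_simps)
    then show "S j \<subseteq> S (Suc j)" unfolding S_def by (blast intro: order_trans)
  qed
  have UN: "(\<Union>j. S j) = U"
  proof
    show "(\<Union>j. S j) \<subseteq> U"
    proof
      fix x assume "x \<in> (\<Union>j. S j)"
      then obtain j where j: "x \<in> S j" by blast
      show "x \<in> U"
      proof (rule ccontr)
        assume "x \<notin> U"
        then have "2 * (1 / real (Suc j)) \<le> dist x x" using j unfolding S_def by blast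
        then show False by (simp add: field_simps)
      qed
    qed
    show "U \<subseteq> (\<Union>j. S j)"
    proof
      fix x assume "x \<in> U"
      then obtain e where e: "e > 0" "ball x e \<subseteq> U" using U open_contains_ball by blast
      obtain j where j: "1 / real (Suc j) < e / 2" using e(1) reals_Archimedean[of "e / 2"] by (auto simp: inverse_eq_divide)
      have "2 * (1 / real (Suc j)) \<le> dist x y" if "y \<in> -U" for y
      proof -
        have "y \<notin> ball x e" using that e(2) by blast
        then have "e \<le> dist x y" by simp
        then show ?thesis using j by linarith
      qed
      then show "x \<in> (\<Union>j. S j)" unfolding S_def by blast
    qed
  qed
  have "(measure (nu z []) (S j))\<^sup>2 \<le> C * measure lborel U" for j
  proof -
    have d: "1 / real (Suc j) > 0" by simp
    obtain m0 where m0: "\<And>m. m \<ge> m0 \<Longrightarrow>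
     (\<Sum>u\<in>W m. \<Sum>v\<in>W m. of_bool (\<bar>proj z (pt lam a u) - proj z (pt lam a v)\<bar> \<le> 1 / real (Suc j)))
       \<le> C * (1 / real (Suc j)) * real n ^ (2 * m)"
      using pc[OF d] z by metis
    show ?thesis
    proof (rule nu_Nil_interior[OF C d z U True m0])
      show "S j \<in> sets borel" using S_closed by (rule borel_closed)
      show "y \<in> U" if xy: "x \<in> S j" "dist x y < 2 * (1 / real (Suc j))" for x y
      proof (rule ccontr)
        assume "y \<notin> U"
        then have "2 * (1 / real (Suc j)) \<le> dist x y" using xy(1) unfolding S_def by blast
        then show False using xy(2) by linarith
      qed
    qed
  qed
  moreover have "(\<lambda>j. (measure (nu z []) (S j))\<^sup>2) \<longlonglongrightarrow> (measure (nu z []) U)\<^sup>2"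
  proof (intro tendsto_power)
    have "range S \<subseteq> sets (nu z [])" using borel_closed[OF S_closed] by (simp add: image_subset_iff)
    from P.finite_Lim_measure_incseq[OF this inc]
    show "(\<lambda>j. measure (nu z []) (S j)) \<longlonglongrightarrow> measure (nu z []) U" unfolding UN .
  qed
  ultimately have "(measure (nu z []) U)\<^sup>2 \<le> C * measure lborel U"
    by (intro LIMSEQ_le_const2) auto
  then have "ennreal ((measure (nu z []) U)\<^sup>2) \<le> ennreal (C * measure lborel U)" by (rule ennreal_leI)
  also have "\<dots> = ennreal C * emeasure lborel U"
    using C True by (simp add: ennreal_mult emeasure_eq_ennreal_measure)
  finally show ?thesis .
next
  case False
  then have "emeasure lborel U = \<infinity>" by (metis infinity_ennreal_def top.not_eq_extremum)
  then show ?thesis using C by (simp add: ennreal_mult_top)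
qed

text \<open>Outer regularity of Lebesgue measure passes from open to Borel sets.\<close>

lemma nu_Nil_bound:
  "\<exists>C>0. \<forall>z A. cmod z = 1 \<longrightarrow> A \<in> sets borel \<longrightarrow>
    ennreal ((measure (nu z []) A)\<^sup>2) \<le> ennreal C * emeasure lborel A"
proof -
  obtain C where C: "C > 0" "\<And>\<delta>. \<delta> > 0 \<Longrightarrow> \<exists>m0. \<forall>m\<ge>m0. \<forall>z. cmod z = 1 \<longrightarrow>
     (\<Sum>u\<in>W m. \<Sum>v\<in>W m. of_bool (\<bar>proj z (pt lam a u) - proj z (pt lam a v)\<bar> \<le> \<delta>)) \<le> C * \<delta> * real n ^ (2 * m)"
    using pair_count_bound by metis
  show ?thesis
  proof (intro exI[of _ C] conjI allI impI)
    fix z and A :: "real set" assume z: "cmod z = 1" and A: "A \<in> sets borel"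
    interpret P: prob_space "nu z []" by (rule prob_nu)
    show "ennreal ((measure (nu z []) A)\<^sup>2) \<le> ennreal C * emeasure lborel A"
    proof (rule ennreal_le_epsilon)
      fix e :: real assume e: "e > 0"
      obtain U where U: "open U" "A \<subseteq> U" "emeasure lborel (U - A) < ennreal (e / C)"
        using outer_regular_lborel[OF A, of "e / C"] e C by auto
      have "emeasure lborel U \<le> emeasure lborel A + emeasure lborel (U - A)"
      proof -
        have "emeasure lborel U = emeasure lborel (A \<union> (U - A))" using U by (intro arg_cong2[where f = emeasure]) auto
        also have "\<dots> \<le> emeasure lborel A + emeasure lborel (U - A)"
          using A U by (intro emeasure_subadditive) auto
        finally show ?thesis .
      qed
      also have "\<dots> \<le> emeasure lborel A + ennreal (e / C)" using U by (intro add_left_mono) auto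
      finally have 1: "emeasure lborel U \<le> emeasure lborel A + ennreal (e / C)" .
      have "ennreal ((measure (nu z []) A)\<^sup>2) \<le> ennreal ((measure (nu z []) U)\<^sup>2)"
        using U by (intro ennreal_leI power_mono P.finite_measure_mono) auto
      also have "\<dots> \<le> ennreal C * emeasure lborel U" by (rule nu_Nil_open[OF C z U(1)])
      also have "\<dots> \<le> ennreal C * (emeasure lborel A + ennreal (e / C))" by (intro mult_left_mono 1) auto
      also have "\<dots> = ennreal C * emeasure lborel A + ennreal e"
        using C e by (simp add: distrib_left ennreal_mult[symmetric])
      finally show "ennreal ((measure (nu z []) A)\<^sup>2) \<le> ennreal C * emeasure lborel A + ennreal e" .
    qed
  qed (use C in auto)
qed

definition "Cnu = (SOME C. C > 0 \<and> (\<forall>z A. cmod z = 1 \<longrightarrow> A \<in> sets borel \<longrightarrow>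
    ennreal ((measure (nu z []) A)\<^sup>2) \<le> ennreal C * emeasure lborel A))"

lemma Cnu: "Cnu > 0"
  "cmod z = 1 \<Longrightarrow> A \<in> sets borel \<Longrightarrow> ennreal ((measure (nu z []) A)\<^sup>2) \<le> ennreal Cnu * emeasure lborel A"
proof -
  have *: "Cnu > 0 \<and> (\<forall>z A. cmod z = 1 \<longrightarrow> A \<in> sets borel \<longrightarrow>
      ennreal ((measure (nu z []) A)\<^sup>2) \<le> ennreal Cnu * emeasure lborel A)"
    unfolding Cnu_def by (rule someI_ex[OF nu_Nil_bound])
  show "Cnu > 0" using * by (rule conjunct1)
  show "cmod z = 1 \<Longrightarrow> A \<in> sets borel \<Longrightarrow> ennreal ((measure (nu z []) A)\<^sup>2) \<le> ennreal Cnu * emeasure lborel A"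
    by (rule conjunct2[OF *, rule_format])
qed

text \<open>A cylinder is a copy of the whole system contracted by \<open>rho ^ length u\<close> and
  rotated. Its projection is therefore a scaled projection in another direction, so uniformity in
  the direction is indispensable.\<close>

lemma nu_bound:
  assumes z: "cmod z = 1" and A: "A \<in> sets borel"
  shows "ennreal ((measure (nu z u) A)\<^sup>2) \<le> ennreal (Cnu / rho ^ length u) * emeasure lborel A"
proof -
  define r where "r = rho ^ length u"
  define z' where "z' = z * cnj (lam ^ length u) / of_real r"
  define T where "T x = proj z (pt lam a u) + r * x" for x
  have r: "r > 0" using rho by (simp add: r_def)
  have [measurable]: "T \<in> borel_measurable borel" unfolding T_def[abs_def] by measurable
  have z': "cmod z' = 1"
    using z lam by (simp add: z'_def norm_divide norm_mult norm_power r_def rho_def)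
  have "proj z (f u w) = T (proj z' w)" for w
  proof -
    have "proj z (f u w) = proj z (pt lam a u) + proj (z * cnj (lam ^ length u)) w"
      by (simp only: f_def proj_add proj_mult_left)
    also have "z * cnj (lam ^ length u) = of_real r * z'" using r by (simp add: z'_def)
    finally show ?thesis by (simp only: T_def proj_scale)
  qed
  then have "measure (nu z u) A = measure (nu z' []) (T -` A)"
    using A measurable_sets[of T borel borel A] by (simp add: measure_nu)
  also have "ennreal (\<dots>\<^sup>2) \<le> ennreal Cnu * emeasure lborel (T -` A)"
    using A measurable_sets[of T borel borel A] by (intro Cnu z') auto
  also have "\<dots> = ennreal (Cnu / r) * (ennreal r * emeasure lborel (T -` A))"
    using r Cnu(1) by (simp add: mult.assoc[symmetric] ennreal_mult[symmetric])
  also have "ennreal r * emeasure lborel (T -` A) = emeasure lborel A"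
  proof -
    have L: "lborel = density (distr lborel borel T) (\<lambda>_. ennreal \<bar>r\<bar>)"
      unfolding T_def[abs_def] using r by (intro lborel_real_affine) simp
    have "emeasure lborel A = emeasure (density (distr lborel borel T) (\<lambda>_. ennreal \<bar>r\<bar>)) A"
      by (rule arg_cong[OF L])
    also have "\<dots> = ennreal r * emeasure (distr lborel borel T) A"
      using A r by (simp add: emeasure_density nn_integral_cmult)
    also have "emeasure (distr lborel borel T) A = emeasure lborel (T -` A)"
      using A by (subst emeasure_distr) auto
    finally show ?thesis by simp
  qed
  finally show ?thesis by (simp add: r_def)
qed

end

section \<open>Mass distributions on slices\<close>

text \<open>A mass distribution on the tree of words is realised by Lebesgue measure: each word \<open>u\<close>
  gets an interval of length \<open>m u\<close>, and the intervals of its children partition it.\<close>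

definition left_end :: "(nat list \<Rightarrow> real) \<Rightarrow> nat list \<Rightarrow> real" where
  "left_end m u = (\<Sum>k<length u. \<Sum>j<u ! k. m (take k u @ [j]))"

definition word_ivl :: "(nat list \<Rightarrow> real) \<Rightarrow> nat list \<Rightarrow> real set" where
  "word_ivl m u = {left_end m u..<left_end m u + m u}"

text \<open>The address of \<open>t\<close>: at each level, the child whose interval contains
  \<open>t\<close>. A child of mass 0 has an empty interval and is never chosen for \<open>t\<close>
  in the root interval.\<close>

primrec word_at :: "(nat list \<Rightarrow> real) \<Rightarrow> real \<Rightarrow> nat \<Rightarrow> nat list" where
  "word_at m t 0 = []"
| "word_at m t (Suc k) = word_at m t k @
     [LEAST i. t < left_end m (word_at m t k) + (\<Sum>j<Suc i. m (word_at m t k @ [j]))]"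

lemma left_end_snoc: "left_end m (u @ [i]) = left_end m u + (\<Sum>j<i. m (u @ [j]))"
  by (simp add: left_end_def nth_append)

lemma word_ivl_sets [simp, measurable]: "word_ivl m u \<in> sets borel"
  by (simp add: word_ivl_def)

lemma emeasure_word_ivl: "0 \<le> m u \<Longrightarrow> emeasure lborel (word_ivl m u) = ennreal (m u)"
  by (simp add: word_ivl_def)

context separated_ifs
begin

lemma word_at:
  assumes madd: "\<And>u. m u = (\<Sum>i<n. m (u @ [i]))" and t: "t \<in> {0..<m []}"
  shows "word_at m t k \<in> W k \<and> t \<in> word_ivl m (word_at m t k)"
proof (induction k)
  case 0 then show ?case using t by (simp add: word_ivl_def left_end_def)
next
  case (Suc k)
  define u where "u = word_at m t k"
  define P where "P i \<longleftrightarrow> t < left_end m u + (\<Sum>j<Suc i. m (u @ [j]))" for i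
  have "Suc (n - 1) = n" using n_pos by simp
  then have ex: "P (n - 1)" using Suc madd[of u] by (simp add: P_def u_def[symmetric] word_ivl_def del: sum.lessThan_Suc)
  define i where "i = (LEAST i. P i)"
  have Pi: "P i" unfolding i_def by (rule LeastI[of P, OF ex])
  have "i \<le> n - 1" unfolding i_def by (rule Least_le[of P, OF ex])
  then have i: "i < n" using n_pos by linarith
  have low: "left_end m u + (\<Sum>j<i. m (u @ [j])) \<le> t"
  proof (cases i)
    case 0 then show ?thesis using Suc by (simp add: u_def word_ivl_def)
  next
    case (Suc i')
    then have "\<not> P i'" using not_less_Least[of i' P] by (simp add: i_def[symmetric])
    then show ?thesis by (simp add: P_def Suc not_less del: sum.lessThan_Suc)
  qed
  have w: "word_at m t (Suc k) = u @ [i]" by (simp add: u_def i_def P_def[abs_def])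
  have "t \<in> word_ivl m (u @ [i])"
    using low Pi by (simp add: word_ivl_def left_end_snoc P_def add.assoc)
  moreover have "u @ [i] \<in> W (Suc k)" using Suc i by (simp add: words_def u_def)
  ultimately show ?case by (simp only: w)
qed

text \<open>The interval of every address of \<open>t\<close> contains \<open>t\<close>, so all
  these words have positive mass and their cylinders meet \<open>Y\<close>; nested compact sets have
  a common point.\<close>

lemma word_point:
  assumes m0: "\<And>u. 0 \<le> m u" and madd: "\<And>u. m u = (\<Sum>i<n. m (u @ [i]))"
    and Y: "closed Y" and hit: "\<And>u. set u \<subseteq> {..<n} \<Longrightarrow> 0 < m u \<Longrightarrow> \<exists>w\<in>K. f u w \<in> Y"
    and t: "t \<in> {0..<m []}"
  shows "\<exists>p\<in>Y. \<forall>k. p \<in> f (word_at m t k) ` K"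
proof -
  define F where "F k = Y \<inter> f (word_at m t k) ` K" for k
  have "\<Inter> (range F) \<noteq> {}"
  proof (rule compact_nest)
    show "compact (F k)" for k
      unfolding F_def using compact_cyl Y by (simp add: closed_Int_compact)
    show "F k \<noteq> {}" for k
    proof -
      have "word_at m t k \<in> W k" "t \<in> word_ivl m (word_at m t k)" using word_at[where m = m, OF madd t] by auto
      then show ?thesis using hit[of "word_at m t k"] by (auto simp: F_def words_def word_ivl_def)
    qed
    have "f (word_at m t (Suc k)) ` K \<subseteq> f (word_at m t k) ` K" for k
    proof -
      have "set (word_at m t (Suc k)) \<subseteq> {..<n}" using word_at[where m = m, OF madd t, of "Suc k"] by (simp add: words_def)
      then show ?thesis using f_K[of "[_]"] by (auto simp: f_append)
    qed
    then have "F (Suc k) \<subseteq> F k" for k unfolding F_def by blast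
    then show "F l \<subseteq> F k" if "k \<le> l" for k l using that lift_Suc_antimono_le[of F] by blast
  qed
  then show ?thesis unfolding F_def by blast
qed

definition word_pt :: "(nat list \<Rightarrow> real) \<Rightarrow> complex set \<Rightarrow> real \<Rightarrow> complex" where
  "word_pt m Y t = (SOME p. p \<in> Y \<and> (\<forall>k. p \<in> f (word_at m t k) ` K))"

definition bad_mass :: "(nat list \<Rightarrow> real) \<Rightarrow> (nat \<Rightarrow> real) \<Rightarrow> nat \<Rightarrow> real" where
  "bad_mass m \<theta> k = (\<Sum>u\<in>W k. if m u > \<theta> k then m u else 0)"

end

text \<open>Applied to the fibre masses on a slice, and also with uniform mass and
  \<open>Y = K\<close> to find the dimension of \<open>K\<close>.\<close>

locale slice_mass = separated_ifs +
  fixes m :: "nat list \<Rightarrow> real" and Y :: "complex set"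
  assumes m_nonneg: "\<And>u. 0 \<le> m u" and m_add: "\<And>u. m u = (\<Sum>i<n. m (u @ [i]))"
    and closed_Y: "closed Y" and m_pos_hit: "\<And>u. set u \<subseteq> {..<n} \<Longrightarrow> 0 < m u \<Longrightarrow> \<exists>w\<in>K. f u w \<in> Y"
begin

abbreviation "wd \<equiv> word_at m"
abbreviation "J \<equiv> word_ivl m"
abbreviation "p \<equiv> word_pt m Y"

lemma wd: assumes "t \<in> {0..<m []}" shows "wd t k \<in> W k" "t \<in> J (wd t k)"
  using word_at[of m, OF m_add assms] by auto

lemma p: assumes "t \<in> {0..<m []}" shows "p t \<in> Y" "p t \<in> f (wd t k) ` K"
proof -
  have "\<exists>x. x \<in> Y \<and> (\<forall>k. x \<in> f (wd t k) ` K)"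
    using word_point[where m = m, OF m_nonneg m_add closed_Y m_pos_hit assms] by blast
  from someI_ex[OF this] show "p t \<in> Y" "p t \<in> f (wd t k) ` K" unfolding word_pt_def by auto
qed

lemma J_measure: "emeasure lborel (J u) = ennreal (m u)"
  by (rule emeasure_word_ivl[OF m_nonneg])

lemma p_separated:
  assumes "t \<in> {0..<m []}" "t' \<in> {0..<m []}" "wd t k \<noteq> wd t' k"
  shows "gap * rho ^ k \<le> dist (p t) (p t')"
proof -
  obtain x where x: "x \<in> K" "p t = f (wd t k) x" using p(2)[OF assms(1)] by blast
  obtain y where y: "y \<in> K" "p t' = f (wd t' k) y" using p(2)[OF assms(2)] by blast
  have "gap * rho ^ length (wd t k) \<le> cmod (f (wd t k) x - f (wd t' k) y)"
    using wd[OF assms(1), of k] wd[OF assms(2), of k] x y assms(3)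
    by (intro cyl_separated) (auto simp: words_def)
  then show ?thesis using wd[OF assms(1), of k] x y by (simp add: words_def dist_norm)
qed

definition bad_set :: "(nat \<Rightarrow> real) \<Rightarrow> nat \<Rightarrow> real set" where
  "bad_set \<theta> k = (\<Union>u\<in>{u\<in>W k. m u > \<theta> k}. J u)"

lemma bad_set_sets [measurable, simp]: "bad_set \<theta> k \<in> sets borel"
  unfolding bad_set_def by (intro sets.finite_UN) auto

lemma bad_set_measure: "emeasure lborel (bad_set \<theta> k) \<le> ennreal (bad_mass m \<theta> k)"
proof -
  have "emeasure lborel (bad_set \<theta> k) \<le> (\<Sum>u\<in>{u\<in>W k. m u > \<theta> k}. emeasure lborel (J u))"
    unfolding bad_set_def by (intro emeasure_subadditive_finite) auto
  also have "\<dots> = ennreal (\<Sum>u\<in>{u\<in>W k. m u > \<theta> k}. m u)"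
    by (simp add: J_measure m_nonneg)
  also have "(\<Sum>u\<in>{u\<in>W k. m u > \<theta> k}. m u) = bad_mass m \<theta> k"
    unfolding bad_mass_def by (subst sum.inter_filter) auto
  finally show ?thesis .
qed

lemma wd_good:
  assumes "t \<in> {0..<m []}" "t \<notin> bad_set \<theta> k"
  shows "m (wd t k) \<le> \<theta> k"
  using wd[OF assms(1), of k] assms(2) unfolding bad_set_def by force

text \<open>The deepest level \<open>l\<close> with \<open>diameter U < gap * rho ^ l\<close> is
  taken: at this level \<open>U\<close> meets only one cylinder, and \<open>rho ^ l\<close> is
  comparable to the diameter. A set of diameter 0 has gauge 0 and no deepest level, so a level is
  chosen whose weight is below \<epsilon>.\<close>

lemma small_set_level:
  assumes e: "e > 0" and U: "bounded U" "diameter U \<le> gap * rho ^ k0 / 2" "U \<noteq> {}" and \<epsilon>: "\<epsilon> > 0"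
  shows "\<exists>k\<ge>k0. (\<forall>x\<in>U. \<forall>y\<in>U. dist x y < gap * rho ^ k) \<and>
    ennreal ((rho powr e) ^ k) \<le> ennreal ((1 / (gap * rho)) powr e) * diam_gauge e U + ennreal \<epsilon>"
proof (cases "diameter U = 0")
  case True
  have "rho powr e < 1" using powr_less_mono2[of e rho 1] rho e by simp
  then obtain k1 where k1: "(rho powr e) ^ k1 < \<epsilon>" using real_arch_pow_inv \<epsilon> by blast
  have "(rho powr e) ^ max k0 k1 \<le> (rho powr e) ^ k1"
    using rho \<open>rho powr e < 1\<close> by (intro power_decreasing) auto
  then have "ennreal ((rho powr e) ^ max k0 k1) \<le> ennreal \<epsilon>" using k1 by (intro ennreal_leI) auto
  then have "ennreal ((rho powr e) ^ max k0 k1) \<le> ennreal ((1 / (gap * rho)) powr e) * diam_gauge e U + ennreal \<epsilon>"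
    by (rule add_increasing[OF zero_le])
  moreover have "dist x y < gap * rho ^ max k0 k1" if "x \<in> U" "y \<in> U" for x y
    using diameter_bounded_bound[OF U(1) that] True gap(1) rho mult_pos_pos[of gap "rho ^ max k0 k1"] by auto
  ultimately show ?thesis by (intro exI[of _ "max k0 k1"]) auto
next
  case False
  define d where "d = diameter U"
  have d: "d > 0" using False diameter_ge_0[OF U(1)] by (simp add: d_def)
  have g: "gap * rho ^ k > 0" for k using gap(1) rho by simp
  have d_lt: "d < gap * rho ^ k0" using U(2) g[of k0] by (simp add: d_def)
  define Q where "Q k \<longleftrightarrow> gap * rho ^ k \<le> d" for k
  obtain k1 where "rho ^ k1 < d / gap" using real_arch_pow_inv[of "d / gap" rho] d gap(1) rho by auto
  then have "Q k1" using gap(1) by (simp add: Q_def field_simps)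
  define k where "k = (LEAST k. Q k)"
  have Qk: "Q k" unfolding k_def by (rule LeastI[of Q, OF \<open>Q k1\<close>])
  have kk: "k0 < k"
  proof (rule ccontr)
    assume "\<not> k0 < k"
    then have "rho ^ k0 \<le> rho ^ k" using rho by (intro power_decreasing) auto
    then have "gap * rho ^ k0 \<le> gap * rho ^ k" using gap(1) by (intro mult_left_mono) auto
    then show False using Qk d_lt by (simp add: Q_def)
  qed
  then obtain l where l: "k = Suc l" by (cases k) auto
  then have "\<not> Q l" using not_less_Least[of l Q] by (simp add: k_def[symmetric])
  then have dl: "d < gap * rho ^ l" by (simp add: Q_def)
  have "rho ^ l \<le> d * (1 / (gap * rho))" using Qk l gap(1) rho by (simp add: Q_def field_simps)
  then have "(rho ^ l) powr e \<le> (d * (1 / (gap * rho))) powr e" using e rho by (intro powr_mono2) auto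
  also have "\<dots> = (1 / (gap * rho)) powr e * d powr e" using d gap(1) rho by (subst powr_mult) auto
  finally have "(rho powr e) ^ l \<le> (1 / (gap * rho)) powr e * d powr e"
    using rho by (simp add: powr_realpow[symmetric] powr_powr mult.commute)
  then have "ennreal ((rho powr e) ^ l) \<le> ennreal ((1 / (gap * rho)) powr e) * diam_gauge e U"
    using e U(3) by (simp add: diam_gauge_def d_def ennreal_mult[symmetric] ennreal_leI)
  then have "ennreal ((rho powr e) ^ l) \<le> ennreal ((1 / (gap * rho)) powr e) * diam_gauge e U + ennreal \<epsilon>"
    by (rule add_increasing2[OF zero_le])
  moreover have "dist x y < gap * rho ^ l" if "x \<in> U" "y \<in> U" for x y
    using diameter_bounded_bound[OF U(1) that] dl by (simp add: d_def)
  ultimately show ?thesis using kk l by (intro exI[of _ l]) auto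
qed

lemma suminf_half: "\<epsilon> \<ge> 0 \<Longrightarrow> (\<Sum>i. ennreal (\<epsilon> * (1 / 2) ^ Suc i)) = ennreal \<epsilon>"
  by (intro suminf_ennreal_eq) (auto intro: sums_mult[OF power_half_series, of \<epsilon>, simplified])

text \<open>A mass distribution principle with exceptions. A cover of \<open>Y\<close> by small sets
  yields a cover of \<open>{0..<m []}\<close>: each covering set accounts for one word interval,
  which is short if the word is good, and all other parameters lie in bad sets of level at least
  \<open>k0\<close>, whose total length is less than \<open>m []\<close>.\<close>

lemma hausdorff_measure_pos:
  assumes e: "e > 0" and bad: "(\<Sum>k. ennreal (bad_mass m (\<lambda>k. (rho powr e) ^ k) (k + k0))) < ennreal (m [])"
  shows "hausdorff_measure e Y > 0"
proof (rule ccontr)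
  assume "\<not> hausdorff_measure e Y > 0"
  then have H0: "hausdorff_measure e Y = 0" by simp
  define \<theta> where "\<theta> k = (rho powr e) ^ k" for k
  define C where "C = (1 / (gap * rho)) powr e"
  define \<beta> where "\<beta> = (\<Sum>k. ennreal (bad_mass m \<theta> (k + k0)))"
  have C: "C \<ge> 0" by (simp add: C_def)
  define \<delta> where "\<delta> = gap * rho ^ k0 / 2"
  have \<delta>: "\<delta> > 0" using gap(1) rho by (simp add: \<delta>_def)
  have pre0: "hausdorff_premeasure e \<delta> Y = 0"
  proof -
    have "hausdorff_premeasure e \<delta> Y \<le> hausdorff_measure e Y"
      unfolding hausdorff_measure_def using \<delta> by (intro SUP_upper) auto
    then show ?thesis using H0 by simp
  qed
  have le: "ennreal (m []) \<le> \<beta> + ennreal ((C + 1) * \<epsilon>)" if \<epsilon>: "\<epsilon> > 0" for \<epsilon>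
  proof -
    have "hausdorff_premeasure e \<delta> Y < ennreal \<epsilon>" using pre0 \<epsilon> by simp
    then obtain U where U: "Y \<subseteq> (\<Union>i::nat. U i)" "\<And>i. bounded (U i)" "\<And>i. diameter (U i) \<le> \<delta>"
        "(\<Sum>i. diam_gauge e (U i)) < ennreal \<epsilon>"
      unfolding hausdorff_premeasure_def INF_less_iff by auto
    define I where "I i = {t \<in> {0..<m []}. p t \<in> U i}" for i
    have "\<exists>k\<ge>k0. (\<forall>x\<in>U i. \<forall>y\<in>U i. dist x y < gap * rho ^ k) \<and>
      ennreal ((rho powr e) ^ k) \<le> ennreal C * diam_gauge e (U i) + ennreal (\<epsilon> * (1 / 2) ^ Suc i)"
      if "U i \<noteq> {}" for i
      unfolding C_def using small_set_level[OF e U(2) U(3)[unfolded \<delta>_def] that, of "\<epsilon> * (1 / 2) ^ Suc i"] \<epsilon> by auto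
    then obtain l where l: "\<And>i. U i \<noteq> {} \<Longrightarrow> l i \<ge> k0"
      "\<And>i x y. x \<in> U i \<Longrightarrow> y \<in> U i \<Longrightarrow> dist x y < gap * rho ^ l i"
      "\<And>i. U i \<noteq> {} \<Longrightarrow> ennreal (\<theta> (l i)) \<le> ennreal C * diam_gauge e (U i) + ennreal (\<epsilon> * (1 / 2) ^ Suc i)"
      unfolding \<theta>_def by (metis empty_iff)
    define G where "G i = {t \<in> I i. t \<notin> bad_set \<theta> (l i)}" for i
    \<comment> \<open>All good parameters whose points lie in \<open>U i\<close> share the same word
      of level \<open>l i\<close>, since different words would put their points too far apart; so
      one interval covers them.\<close>
    define V where "V i = (if G i = {} then {} else J (wd (SOME t. t \<in> G i) (l i)))" for i
    have V_sets: "V i \<in> sets lborel" for i by (simp add: V_def)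
    have V_meas: "emeasure lborel (V i) \<le> ennreal C * diam_gauge e (U i) + ennreal (\<epsilon> * (1 / 2) ^ Suc i)" for i
    proof (cases "G i = {}")
      case False
      define t where "t = (SOME t. t \<in> G i)"
      have "t \<in> G i" unfolding t_def using False some_in_eq by blast
      then have "m (wd t (l i)) \<le> \<theta> (l i)" "U i \<noteq> {}" using wd_good by (auto simp: G_def I_def)
      then have "emeasure lborel (V i) \<le> ennreal (\<theta> (l i))"
        using False by (simp add: V_def t_def[symmetric] J_measure ennreal_leI)
      then show ?thesis using l(3)[OF \<open>U i \<noteq> {}\<close>] by (rule order_trans)
    qed (simp add: V_def)
    have G_V: "G i \<subseteq> V i" for i
    proof
      fix t assume t: "t \<in> G i"
      define t' where "t' = (SOME t. t \<in> G i)"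
      have t': "t' \<in> G i" unfolding t'_def using t by (rule someI)
      have "wd t (l i) = wd t' (l i)"
      proof (rule ccontr)
        assume "wd t (l i) \<noteq> wd t' (l i)"
        then have "gap * rho ^ l i \<le> dist (p t) (p t')" using t t' by (intro p_separated) (auto simp: G_def I_def)
        then show False using l(2)[of "p t" i "p t'"] t t' by (auto simp: G_def I_def)
      qed
      moreover have "V i = J (wd t' (l i))" using t by (auto simp: V_def t'_def)
      moreover have "t \<in> J (wd t (l i))" using t wd(2)[of t "l i"] by (auto simp: G_def I_def)
      ultimately show "t \<in> V i" by simp
    qed
    have "{0..<m []} \<subseteq> (\<Union>i. V i) \<union> (\<Union>k. bad_set \<theta> (k + k0))"
    proof
      fix t assume t: "t \<in> {0..<m []}"
      obtain i where i: "p t \<in> U i" using p(1)[OF t] U(1) by blast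
      show "t \<in> (\<Union>i. V i) \<union> (\<Union>k. bad_set \<theta> (k + k0))"
      proof (cases "t \<in> bad_set \<theta> (l i)")
        case True
        moreover have "l i = (l i - k0) + k0" using l(1) i by force
        ultimately show ?thesis by (metis UNIV_I UN_I UnCI)
      next
        case False
        then have "t \<in> G i" using t i by (simp add: G_def I_def)
        then show ?thesis using G_V by blast
      qed
    qed
    then have "emeasure lborel {0..<m []} \<le> emeasure lborel ((\<Union>i. V i) \<union> (\<Union>k. bad_set \<theta> (k + k0)))"
      using V_sets by (intro emeasure_mono) auto
    also have "\<dots> \<le> emeasure lborel (\<Union>i. V i) + emeasure lborel (\<Union>k. bad_set \<theta> (k + k0))"
      using V_sets by (intro emeasure_subadditive) auto
    also have "\<dots> \<le> (\<Sum>i. emeasure lborel (V i)) + (\<Sum>k. emeasure lborel (bad_set \<theta> (k + k0)))"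
      using V_sets by (intro add_mono emeasure_subadditive_countably) auto
    also have "\<dots> \<le> (\<Sum>i. ennreal C * diam_gauge e (U i) + ennreal (\<epsilon> * (1 / 2) ^ Suc i)) + \<beta>"
      unfolding \<beta>_def by (intro add_mono suminf_le V_meas bad_set_measure) auto
    also have "(\<Sum>i. ennreal C * diam_gauge e (U i) + ennreal (\<epsilon> * (1 / 2) ^ Suc i))
        = ennreal C * (\<Sum>i. diam_gauge e (U i)) + ennreal \<epsilon>"
      unfolding suminf_half[OF less_imp_le[OF \<epsilon>], symmetric]
      by (subst suminf_add[symmetric]) (simp_all only: summableI ennreal_suminf_cmult)
    also have "\<dots> \<le> ennreal C * ennreal \<epsilon> + ennreal \<epsilon>"
      using U(4) by (intro add_mono mult_left_mono) auto
    also have "\<dots> = ennreal ((C + 1) * \<epsilon>)"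
      using C \<epsilon> by (simp add: ennreal_mult[symmetric] ennreal_plus[symmetric] distrib_right del: ennreal_plus)
    finally show ?thesis using m_nonneg by (simp add: add.commute)
  qed
  have "ennreal (m []) \<le> \<beta>"
  proof (rule ennreal_le_epsilon)
    fix \<epsilon> :: real assume "\<epsilon> > 0"
    then show "ennreal (m []) \<le> \<beta> + ennreal \<epsilon>" using le[of "\<epsilon> / (C + 1)"] C by auto
  qed
  then show False using bad by (simp add: \<beta>_def \<theta>_def[abs_def])
qed

text \<open>The balls of the packing come from the words that are minimal among the good ones along
  a branch; two different minimal words are separated at the level of the shorter one.\<close>

lemma packing_cover:
  assumes T: "T > 0" and e: "e > 0" and P: "packing_premeasure e B < ennreal h"
    and B: "\<And>t. t \<in> E \<Longrightarrow> p t \<in> B" and E: "E \<subseteq> {0..<m []}"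
    and good: "\<And>t k0. t \<in> E \<Longrightarrow> \<exists>k\<ge>k0. m (wd t k) \<le> T * (rho powr e) ^ k"
  shows "\<exists>V\<in>sets borel. E \<subseteq> V \<and> emeasure lborel V \<le> ennreal (T / (2 * gap / 3) powr e * h)"
proof -
  obtain \<delta> where \<delta>: "\<delta> > 0"
    "(SUP I \<in> packings \<delta> B. \<Sum>\<^sub>\<infinity>(x, r)\<in>I. ennreal ((2 * r) powr e)) < ennreal h"
    using P unfolding packing_premeasure_def INF_less_iff by auto
  \<comment> \<open>With radii \<open>g * rho ^ length u\<close> the sum of two radii is at most two
    thirds of \<open>gap * rho ^ min (length u) (length v)\<close>, which bounds the distance of the
    centres from below.\<close>
  define g where "g = gap / 3"
  have g: "g > 0" using gap(1) by (simp add: g_def)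
  obtain k0 where "rho ^ k0 < \<delta> / (2 * g)" using real_arch_pow_inv[of "\<delta> / (2 * g)" rho] \<delta>(1) g rho by auto
  then have k0: "2 * g * rho ^ k0 < \<delta>" using g by (simp add: pos_less_divide_eq mult_ac)
  define Q where "Q t k \<longleftrightarrow> k0 \<le> k \<and> m (wd t k) \<le> T * (rho powr e) ^ k" for t k
  define \<kappa> where "\<kappa> t = (LEAST k. Q t k)" for t
  have Q\<kappa>: "Q t (\<kappa> t)" if "t \<in> E" for t
  proof -
    have "\<exists>k. Q t k" using good[OF that, of k0] by (auto simp: Q_def)
    then show ?thesis unfolding \<kappa>_def by (rule LeastI_ex)
  qed
  have \<kappa>_le: "\<kappa> t \<le> k" if "Q t k" for t k unfolding \<kappa>_def using that by (rule Least_le)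
  define \<phi> where "\<phi> t = wd t (\<kappa> t)" for t
  have len: "length (\<phi> t) = \<kappa> t" if "t \<in> E" for t
    using wd(1)[of t "\<kappa> t"] that E by (auto simp: \<phi>_def words_def)
  define U where "U = \<phi> ` E"
  have rep: "\<exists>t. t \<in> E \<and> \<phi> t = u" if "u \<in> U" for u using that by (auto simp: U_def)
  define \<tau> where "\<tau> u = (SOME t. t \<in> E \<and> \<phi> t = u)" for u
  have \<tau>: "\<tau> u \<in> E" "\<phi> (\<tau> u) = u" if "u \<in> U" for u
    using someI_ex[OF rep[OF that]] by (auto simp: \<tau>_def)
  have sep_le: "gap * rho ^ length u \<le> dist (p (\<tau> u)) (p (\<tau> v))"
    if le: "length u \<le> length v" "u \<in> U" "v \<in> U" "u \<noteq> v" for u v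
  proof -
    define k where "k = length u"
    have ku: "k = \<kappa> (\<tau> u)" using len[OF \<tau>(1)] \<tau>(2) le by (simp add: k_def)
    have kv: "k \<le> \<kappa> (\<tau> v)" using len[OF \<tau>(1), of v] \<tau>(2)[of v] le by (simp add: k_def)
    have "wd (\<tau> u) k \<noteq> wd (\<tau> v) k"
    proof
      assume eq: "wd (\<tau> u) k = wd (\<tau> v) k"
      have "Q (\<tau> v) k" using Q\<kappa>[OF \<tau>(1)[OF le(2)]] unfolding Q_def ku[symmetric] eq by simp
      then have "\<kappa> (\<tau> v) = k" using \<kappa>_le kv by (intro antisym) auto
      then have "\<phi> (\<tau> u) = \<phi> (\<tau> v)" using eq ku by (simp add: \<phi>_def)
      then show False using \<tau>(2) le by auto
    qed
    then show ?thesis unfolding k_def[symmetric]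
      using subsetD[OF E \<tau>(1)[OF le(2)]] subsetD[OF E \<tau>(1)[OF le(3)]] by (intro p_separated)
  qed
  have sep: "gap * rho ^ min (length u) (length v) \<le> dist (p (\<tau> u)) (p (\<tau> v))"
    if "u \<in> U" "v \<in> U" "u \<noteq> v" for u v
  proof (cases "length u \<le> length v")
    case True then show ?thesis using sep_le[OF True that] by (simp add: min_def)
  next
    case False then show ?thesis using sep_le[of v u] that by (simp add: min_def dist_commute)
  qed
  define V where "V = (\<Union>u\<in>U. J u)"
  have J_sum: "emeasure lborel (\<Union>u\<in>F. J u) \<le> ennreal (T / (2 * g) powr e * h)" if F: "finite F" "F \<subseteq> U" for F
  proof -
    define b where "b u = (p (\<tau> u), g * rho ^ length u)" for u
    have inj: "inj_on b F"
    proof (rule inj_onI, rule ccontr)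
      fix u v assume uv: "u \<in> F" "v \<in> F" "b u = b v" "u \<noteq> v"
      then have "gap * rho ^ min (length u) (length v) \<le> 0" using sep[of u v] F by (auto simp: b_def)
      then show False using mult_pos_pos[OF gap(1), of "rho ^ min (length u) (length v)"] rho by auto
    qed
    have rad: "g * rho ^ length u > 0" for u using g rho by simp
    have "b ` F \<in> packings \<delta> B"
      unfolding packings_def mem_Collect_eq
    proof (intro conjI ballI)
      fix x assume "x \<in> b ` F"
      then obtain u where u: "u \<in> F" "x = b u" by blast
      then have uU: "u \<in> U" using F by blast
      have "length u \<ge> k0" using Q\<kappa>[OF \<tau>(1)[OF uU]] len[OF \<tau>(1)[OF uU]] \<tau>(2)[OF uU] by (simp add: Q_def)
      then have "rho ^ length u \<le> rho ^ k0" using rho by (intro power_decreasing) auto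
      then have "2 * g * rho ^ length u \<le> 2 * g * rho ^ k0" using g by (intro mult_left_mono) auto
      then show "case x of (x, r) \<Rightarrow> x \<in> B \<and> 0 < r \<and> 2 * r \<le> \<delta>"
        using k0 rad B[OF \<tau>(1)[OF uU]] u by (simp add: b_def)
    next
      show "disjoint_family_on (\<lambda>(x, r). cball x r) (b ` F)"
        unfolding disjoint_family_on_def
      proof (intro ballI impI)
        fix x y assume "x \<in> b ` F" "y \<in> b ` F" "x \<noteq> y"
        then obtain u v where uv: "u \<in> F" "v \<in> F" "x = b u" "y = b v" "u \<noteq> v" by blast
        have "rho ^ length u \<le> rho ^ min (length u) (length v)" "rho ^ length v \<le> rho ^ min (length u) (length v)"
          using rho by (auto intro!: power_decreasing)
        then have "g * rho ^ length u + g * rho ^ length v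
            \<le> g * rho ^ min (length u) (length v) + g * rho ^ min (length u) (length v)"
          using g by (intro add_mono mult_left_mono) auto
        also have "\<dots> < gap * rho ^ min (length u) (length v)"
          using gap(1) rho by (simp add: g_def)
        also have "\<dots> \<le> dist (p (\<tau> u)) (p (\<tau> v))" using uv F by (intro sep) auto
        finally have d: "g * rho ^ length u + g * rho ^ length v < dist (p (\<tau> u)) (p (\<tau> v))" .
        have False if "w \<in> cball (p (\<tau> u)) (g * rho ^ length u)" "w \<in> cball (p (\<tau> v)) (g * rho ^ length v)" for w
          using that d dist_triangle2[of "p (\<tau> u)" "p (\<tau> v)" w] by (simp add: dist_commute)
        then show "(case x of (x, r) \<Rightarrow> cball x r) \<inter> (case y of (x, r) \<Rightarrow> cball x r) = {}"
          unfolding uv b_def by auto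
      qed
    qed
    then have "(\<Sum>\<^sub>\<infinity>(x, r)\<in>b ` F. ennreal ((2 * r) powr e)) \<le>
        (SUP I \<in> packings \<delta> B. \<Sum>\<^sub>\<infinity>(x, r)\<in>I. ennreal ((2 * r) powr e))"
      by (rule SUP_upper)
    then have le: "(\<Sum>\<^sub>\<infinity>(x, r)\<in>b ` F. ennreal ((2 * r) powr e)) \<le> ennreal h" using \<delta>(2) by simp
    have pw: "(2 * (g * rho ^ length u)) powr e = (2 * g) powr e * (rho powr e) ^ length u" for u
      using g rho by (simp add: powr_mult powr_realpow[symmetric] powr_powr mult.commute)
    have "(\<Sum>\<^sub>\<infinity>(x, r)\<in>b ` F. ennreal ((2 * r) powr e)) = (\<Sum>(x, r)\<in>b ` F. ennreal ((2 * r) powr e))"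
      using F by (intro infsum_finite) simp
    also have "\<dots> = (\<Sum>u\<in>F. ennreal ((2 * g) powr e * (rho powr e) ^ length u))"
      by (simp only: sum.reindex[OF inj] comp_def b_def prod.case pw)
    also have "\<dots> = ennreal (\<Sum>u\<in>F. (2 * g) powr e * (rho powr e) ^ length u)" by (intro sum_ennreal) simp
    finally have le': "ennreal (\<Sum>u\<in>F. (2 * g) powr e * (rho powr e) ^ length u) \<le> ennreal h" using le by simp
    have "emeasure lborel (\<Union>u\<in>F. J u) \<le> (\<Sum>u\<in>F. emeasure lborel (J u))"
      using F by (intro emeasure_subadditive_finite) auto
    also have "\<dots> = ennreal (\<Sum>u\<in>F. m u)" by (simp add: J_measure m_nonneg)
    also have "\<dots> \<le> ennreal (\<Sum>u\<in>F. T / (2 * g) powr e * ((2 * g) powr e * (rho powr e) ^ length u))"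
    proof (intro ennreal_leI sum_mono)
      fix u assume "u \<in> F"
      then have uU: "u \<in> U" using F by blast
      have "m u \<le> T * (rho powr e) ^ length u"
        using Q\<kappa>[OF \<tau>(1)[OF uU]] len[OF \<tau>(1)[OF uU]] \<tau>(2)[OF uU] by (simp add: Q_def \<phi>_def)
      then show "m u \<le> T / (2 * g) powr e * ((2 * g) powr e * (rho powr e) ^ length u)" using g by simp
    qed
    also have "\<dots> = ennreal (T / (2 * g) powr e) * ennreal (\<Sum>u\<in>F. (2 * g) powr e * (rho powr e) ^ length u)"
      unfolding sum_distrib_left[symmetric, of "T / (2 * g) powr e"] using T by (intro ennreal_mult sum_nonneg) auto
    also have "\<dots> \<le> ennreal (T / (2 * g) powr e) * ennreal h" by (intro mult_left_mono le') auto
    also have "\<dots> = ennreal (T / (2 * g) powr e * h)" using T by (intro ennreal_mult'[symmetric]) simp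
    finally show ?thesis .
  qed
  have "emeasure lborel V \<le> ennreal (T / (2 * g) powr e * h)"
  proof -
    \<comment> \<open>\<open>J_sum\<close> concerns finite families; the words of length at most
      \<open>k\<close> exhaust \<open>U\<close> by such families.\<close>
    define VV where "VV k = (\<Union>u\<in>U \<inter> (\<Union>j\<le>k. W j). J u)" for k
    have fin: "finite (U \<inter> (\<Union>j\<le>k. W j))" for k by auto
    have "u \<in> (\<Union>k. \<Union>j\<le>k. W j)" if "u \<in> U" for u
    proof -
      have "u \<in> W (\<kappa> (\<tau> u))" using wd(1)[OF subsetD[OF E \<tau>(1)[OF that]], of "\<kappa> (\<tau> u)"] \<tau>(2)[OF that] by (simp add: \<phi>_def)
      then show ?thesis by blast
    qed
    then have V: "V = (\<Union>k. VV k)" unfolding V_def VV_def by blast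
    have inc: "incseq VV" unfolding VV_def by (intro incseq_SucI) (force simp: atMost_Suc)
    have "range VV \<subseteq> sets lborel" unfolding VV_def using fin by (auto intro!: sets.finite_UN)
    then have "emeasure lborel V = (SUP k. emeasure lborel (VV k))"
      unfolding V using inc by (rule SUP_emeasure_incseq[symmetric])
    also have "\<dots> \<le> ennreal (T / (2 * g) powr e * h)"
      unfolding VV_def by (intro SUP_least J_sum fin Int_lower1)
    finally show ?thesis .
  qed
  moreover have "V \<in> sets borel"
  proof -
    have "countable U" by simp
    then show ?thesis unfolding V_def by (intro sets.countable_UN') auto
  qed
  moreover have "E \<subseteq> V"
  proof
    fix t assume t: "t \<in> E"
    then have "t \<in> J (\<phi> t)" using wd(2)[of t "\<kappa> t"] E by (auto simp: \<phi>_def)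
    then show "t \<in> V" using t by (auto simp: V_def U_def)
  qed
  ultimately show ?thesis by (auto simp: g_def)
qed

text \<open>The parameters that are good at infinitely many levels form a limsup set
  \<open>E\<close> of length at least \<beta>. Each piece of a countable cover of \<open>Y\<close>
  covers its share of \<open>E\<close> by a length proportional to its packing premeasure, so these
  premeasures cannot have an arbitrarily small sum.\<close>

lemma packing_measure_pos:
  assumes e: "e > 0" and T: "T > 0" and \<beta>: "\<beta> > 0"
    and inf: "\<exists>\<^sub>\<infinity>k. bad_mass m (\<lambda>k. T * (rho powr e) ^ k) k \<le> m [] - \<beta>"
  shows "packing_measure e Y > 0"
proof (rule ccontr)
  assume "\<not> packing_measure e Y > 0"
  then have P0: "packing_measure e Y = 0" by simp
  define \<theta> where "\<theta> k = T * (rho powr e) ^ k" for k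
  define G where "G j = (\<Union>k\<in>{j..}. {0..<m []} - bad_set \<theta> k)" for j
  define E where "E = (\<Inter>j. G j)"
  have G_sets: "G j \<in> sets lborel" for j unfolding G_def by auto
  have G_big: "ennreal \<beta> \<le> emeasure lborel (G j)" for j
  proof -
    obtain k where k: "k \<ge> j" "bad_mass m \<theta> k \<le> m [] - \<beta>"
      using inf unfolding INFM_nat_le \<theta>_def[abs_def] by blast
    have "ennreal (m []) = emeasure lborel {0..<m []}" using m_nonneg by simp
    also have "\<dots> \<le> emeasure lborel (({0..<m []} - bad_set \<theta> k) \<union> bad_set \<theta> k)"
      by (intro emeasure_mono) auto
    also have "\<dots> \<le> emeasure lborel ({0..<m []} - bad_set \<theta> k) + emeasure lborel (bad_set \<theta> k)"
      by (intro emeasure_subadditive) auto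
    also have "\<dots> \<le> emeasure lborel (G j) + ennreal (m [] - \<beta>)"
    proof (intro add_mono emeasure_mono G_sets)
      show "{0..<m []} - bad_set \<theta> k \<subseteq> G j" unfolding G_def using k by auto
      show "emeasure lborel (bad_set \<theta> k) \<le> ennreal (m [] - \<beta>)"
        using bad_set_measure[of \<theta> k] k(2) by (meson ennreal_leI order_trans)
    qed
    finally have 1: "ennreal (m []) \<le> emeasure lborel (G j) + ennreal (m [] - \<beta>)" .
    have "0 \<le> bad_mass m \<theta> k" unfolding bad_mass_def using m_nonneg by (intro sum_nonneg) auto
    then have 2: "0 \<le> m [] - \<beta>" using k(2) by linarith
    have "ennreal (m [] - \<beta>) + ennreal \<beta> = ennreal (m [])" using 2 \<beta> by (simp add: ennreal_plus[symmetric] del: ennreal_plus)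
    then have "ennreal (m [] - \<beta>) + ennreal \<beta> \<le> ennreal (m [] - \<beta>) + emeasure lborel (G j)"
      using 1 by (simp add: add.commute)
    then show ?thesis by (subst (asm) ennreal_add_left_cancel_le) auto
  qed
  have E_big: "ennreal \<beta> \<le> emeasure lborel E"
  proof -
    have "decseq G" unfolding G_def by (intro decseq_SucI) auto
    moreover have "emeasure lborel (G j) \<noteq> \<infinity>" for j
    proof -
      have "emeasure lborel (G j) \<le> emeasure lborel {0..<m []}" unfolding G_def by (intro emeasure_mono) auto
      also have "\<dots> < \<infinity>" using m_nonneg by simp
      finally show ?thesis by simp
    qed
    moreover have "range G \<subseteq> sets lborel" using G_sets by blast
    ultimately have "emeasure lborel E = (INF j. emeasure lborel (G j))"
      unfolding E_def by (intro INF_emeasure_decseq[symmetric]) auto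
    then show ?thesis using G_big by (simp add: INF_greatest)
  qed
  have E_sub: "E \<subseteq> {0..<m []}" by (auto simp: E_def G_def)
  have E_good: "\<exists>k\<ge>k0. m (wd t k) \<le> T * (rho powr e) ^ k" if "t \<in> E" for t k0
  proof -
    obtain k where "k \<ge> k0" "t \<in> {0..<m []}" "t \<notin> bad_set \<theta> k" using \<open>t \<in> E\<close> by (auto simp: E_def G_def)
    then show ?thesis using wd_good[of t \<theta> k] by (auto simp: \<theta>_def)
  qed
  define C where "C = T / (2 * gap / 3) powr e"
  have C: "C > 0" using T gap(1) by (simp add: C_def)
  \<comment> \<open>The premeasures and the slack added below each sum to at most \<epsilon>, which
    gives the total length \<open>2 * C * \<epsilon> = \<beta> / 2\<close>.\<close>
  define \<epsilon> where "\<epsilon> = \<beta> / (4 * C)"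
  have \<epsilon>: "\<epsilon> > 0" using \<beta> C by (simp add: \<epsilon>_def)
  have "packing_measure e Y < ennreal \<epsilon>" using P0 \<epsilon> by simp
  then obtain B where B: "Y \<subseteq> (\<Union>i::nat. B i)" "(\<Sum>i. packing_premeasure e (B i)) < ennreal \<epsilon>"
    unfolding packing_measure_def INF_less_iff by auto
  define q where "q i = packing_premeasure e (B i)" for i
  have q_fin: "q i < \<top>" for i
  proof -
    have "q i \<le> (\<Sum>i. q i)" using sum_le_suminf[of q "{i}"] by simp
    also have "\<dots> < ennreal \<epsilon>" using B(2) by (simp add: q_def)
    finally show ?thesis by (rule less_trans) simp
  qed
  \<comment> \<open>\<open>packing_cover\<close> needs a strict upper bound, so a summable positive
    slack is added; it also covers pieces of premeasure 0.\<close>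
  define h where "h i = enn2real (q i) + \<epsilon> * (1 / 2) ^ Suc i" for i
  have h: "q i < ennreal (h i)" "ennreal (h i) = q i + ennreal (\<epsilon> * (1 / 2) ^ Suc i)" for i
  proof -
    show eq: "ennreal (h i) = q i + ennreal (\<epsilon> * (1 / 2) ^ Suc i)"
      unfolding h_def using \<epsilon> q_fin[of i] by (subst ennreal_plus) auto
    show "q i < ennreal (h i)" unfolding eq using q_fin[of i] \<epsilon> ennreal_add_left_cancel_less[of "q i" 0] by simp
  qed
  \<comment> \<open>The pieces \<open>B i\<close> are arbitrary, so the parameters landing in
    \<open>B i\<close> need not form a measurable set; Borel supersets are used instead.\<close>
  have "\<exists>V\<in>sets borel. {t\<in>E. p t \<in> B i} \<subseteq> V \<and> emeasure lborel V \<le> ennreal (C * h i)" for i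
    unfolding C_def using h(1)[of i] E_sub E_good
    by (intro packing_cover[OF T e, where B = "B i"]) (auto simp: q_def)
  then obtain V where V: "\<And>i. V i \<in> sets borel" "\<And>i. {t\<in>E. p t \<in> B i} \<subseteq> V i"
      "\<And>i. emeasure lborel (V i) \<le> ennreal (C * h i)" by metis
  have "E \<subseteq> (\<Union>i. V i)"
  proof
    fix t assume t: "t \<in> E"
    then obtain i where "p t \<in> B i" using p(1)[of t] E_sub B(1) by blast
    then show "t \<in> (\<Union>i. V i)" using V(2) t by blast
  qed
  then have "ennreal \<beta> \<le> emeasure lborel (\<Union>i. V i)"
    using V(1) by (intro order_trans[OF E_big emeasure_mono]) auto
  also have "\<dots> \<le> (\<Sum>i. emeasure lborel (V i))" using V(1) by (intro emeasure_subadditive_countably) auto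
  also have "\<dots> \<le> (\<Sum>i. ennreal C * (q i + ennreal (\<epsilon> * (1 / 2) ^ Suc i)))"
    using V(3) C unfolding h(2)[symmetric] by (intro suminf_le) (auto simp: ennreal_mult')
  also have "\<dots> = ennreal C * ((\<Sum>i. q i) + (\<Sum>i. ennreal (\<epsilon> * (1 / 2) ^ Suc i)))"
    unfolding ennreal_suminf_cmult
    by (rule arg_cong[where f = "\<lambda>x. ennreal C * x"], rule suminf_add[symmetric]) (rule summableI)+
  also have "\<dots> \<le> ennreal C * (ennreal \<epsilon> + ennreal \<epsilon>)"
  proof (intro mult_left_mono add_mono)
    show "(\<Sum>i. q i) \<le> ennreal \<epsilon>" using less_imp_le[OF B(2)] unfolding q_def .
    show "(\<Sum>i. ennreal (\<epsilon> * (1 / 2) ^ Suc i)) \<le> ennreal \<epsilon>" unfolding suminf_half[OF less_imp_le[OF \<epsilon>]] ..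
  qed simp
  also have "\<dots> = ennreal (\<beta> / 2)"
    using C \<epsilon> \<beta> by (simp add: ennreal_plus[symmetric] ennreal_mult[symmetric] \<epsilon>_def del: ennreal_plus)
  finally show False using \<beta> by simp
qed

end

section \<open>Hausdorff measure and dimension\<close>

lemma hausdorff_premeasure_antimono:
  assumes "\<delta> \<le> \<delta>'"
  shows "hausdorff_premeasure t \<delta>' A \<le> hausdorff_premeasure t \<delta> A"
  unfolding hausdorff_premeasure_def using assms by (intro INF_superset_mono) (auto intro: order_trans)

lemma diam_gauge_mono:
  assumes "0 \<le> t" "t \<le> e" "bounded U" "diameter U \<le> 1"
  shows "diam_gauge e U \<le> diam_gauge t U"
proof (cases "e = t")
  case False
  have "diameter U powr e \<le> diameter U powr t"
  proof (cases "diameter U = 0")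
    case False
    then have "0 < diameter U" using diameter_ge_0[OF assms(3)] by linarith
    then show ?thesis using assms by (intro powr_mono') auto
  qed simp
  \<comment> \<open>For \<open>t = 0\<close> the gauge is 1 rather than
    \<open>diameter U powr 0\<close>, and this bound handles that case.\<close>
  moreover have "diameter U powr e \<le> 1"
    using powr_le_one_le[of "diameter U" 1] diameter_ge_0[OF assms(3)] assms False
    by (intro powr_le1) auto
  ultimately show ?thesis using assms False by (auto simp: diam_gauge_def ennreal_leI ennreal_le_1)
qed simp

lemma hausdorff_measure_antimono:
  assumes "0 \<le> t" "t \<le> e"
  shows "hausdorff_measure e A \<le> hausdorff_measure t A"
  unfolding hausdorff_measure_def[of e]
proof (rule SUP_least)
  fix \<delta> :: real assume "\<delta> \<in> {0<..}"
  then have d: "0 < min \<delta> 1" by simp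
  have "hausdorff_premeasure e \<delta> A \<le> hausdorff_premeasure e (min \<delta> 1) A"
    by (rule hausdorff_premeasure_antimono) simp
  also have "\<dots> \<le> hausdorff_premeasure t (min \<delta> 1) A"
    unfolding hausdorff_premeasure_def
    by (intro INF_mono bexI suminf_le summableI) (auto intro!: diam_gauge_mono[OF assms])
  also have "\<dots> \<le> hausdorff_measure t A"
    unfolding hausdorff_measure_def using d by (intro SUP_upper) auto
  finally show "hausdorff_premeasure e \<delta> A \<le> hausdorff_measure t A" .
qed

text \<open>Countably many exponents decide the dimension, so the conditions can be checked outside
  one null set. The factor \<open>1 - 1 / (j + 2)\<close> keeps the lower exponents
  positive.\<close>

lemma hausdorff_dim_eqI:
  fixes A :: "'a::euclidean_space set"
  assumes \<tau>: "\<tau> > 0" and zero: "\<And>j::nat. hausdorff_measure (\<tau> + 1 / real (Suc j)) A = 0"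
    and pos: "\<And>j::nat. hausdorff_measure (\<tau> * (1 - 1 / real (Suc (Suc j)))) A > 0"
  shows "hausdorff_dim A = \<tau>"
proof -
  define S where "S = {t. 0 \<le> t \<and> hausdorff_measure t A = 0}"
  have in_S: "\<tau> + 1 / real (Suc j) \<in> S" for j using zero \<tau> by (auto simp: S_def)
  have low: "\<tau> \<le> x" if "x \<in> S" for x
  proof (rule ccontr)
    assume "\<not> \<tau> \<le> x"
    then have "0 < (\<tau> - x) / \<tau>" using \<tau> by simp
    then obtain j where "inverse (real (Suc j)) < (\<tau> - x) / \<tau>" using reals_Archimedean by blast
    moreover have "1 / real (Suc (Suc j)) \<le> inverse (real (Suc j))" by (simp add: field_simps)
    ultimately have "1 / real (Suc (Suc j)) < (\<tau> - x) / \<tau>" by linarith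
    then have "\<tau> * (1 / real (Suc (Suc j))) < \<tau> * ((\<tau> - x) / \<tau>)" using \<tau> by (intro mult_strict_left_mono)
    also have "\<dots> = \<tau> - x" using \<tau> by simp
    finally have "x \<le> \<tau> * (1 - 1 / real (Suc (Suc j)))" using \<tau> by (simp add: right_diff_distrib)
    then have "hausdorff_measure (\<tau> * (1 - 1 / real (Suc (Suc j)))) A \<le> hausdorff_measure x A"
      using that by (intro hausdorff_measure_antimono) (auto simp: S_def)
    then show False using that pos[of j] by (simp add: S_def)
  qed
  have "Inf S \<le> \<tau> + e" if e: "e > 0" for e
  proof -
    obtain j where j: "inverse (real (Suc j)) < e" using reals_Archimedean[OF e] by blast
    have "Inf S \<le> \<tau> + 1 / real (Suc j)" by (intro cInf_lower in_S bdd_belowI[of S \<tau>] low)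
    then show ?thesis using j by (simp add: inverse_eq_divide)
  qed
  then have "Inf S \<le> \<tau>" by (rule field_le_epsilon)
  moreover have "\<tau> \<le> Inf S" using in_S[of 0] low by (intro cInf_greatest) blast+
  ultimately show ?thesis by (simp add: hausdorff_dim_def S_def)
qed

lemma hausdorff_measure_zeroI:
  fixes A :: "'a::metric_space set"
  assumes t: "t > 0" and cov: "\<And>\<epsilon>. \<epsilon> > 0 \<Longrightarrow> \<exists>F d. finite F \<and> A \<subseteq> \<Union>F \<and> 0 \<le> d \<and> d \<le> \<epsilon> \<and>
     (\<forall>U\<in>F. bounded U \<and> diameter U \<le> d) \<and> real (card F) * d powr t \<le> \<epsilon>"
  shows "hausdorff_measure t A = 0"
proof -
  have le: "hausdorff_premeasure t \<delta> A \<le> ennreal \<epsilon>" if "\<delta> > 0" "\<epsilon> > 0" for \<delta> \<epsilon>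
  proof -
    have "min \<delta> \<epsilon> > 0" using that by simp
    from cov[OF this] obtain F d where F: "finite F" "A \<subseteq> \<Union>F" "0 \<le> d" "d \<le> \<delta>"
      "\<And>U. U \<in> F \<Longrightarrow> bounded U \<and> diameter U \<le> d" "real (card F) * d powr t \<le> \<epsilon>" by auto
    obtain h where h: "bij_betw h {0..<card F} F" using ex_bij_betw_nat_finite[OF F(1)] by blast
    define U where "U i = (if i < card F then h i else {})" for i
    have hF: "h i \<in> F" if "i < card F" for i using bij_betw_apply[OF h, of i] that by simp
    have "U \<in> {U. A \<subseteq> (\<Union>i. U i) \<and> (\<forall>i. bounded (U i) \<and> diameter (U i) \<le> \<delta>)}"
    proof (intro CollectI conjI allI)
      show "A \<subseteq> (\<Union>i. U i)"
      proof
        fix x assume "x \<in> A"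
        then obtain V where V: "V \<in> F" "x \<in> V" using F(2) by blast
        then have "V \<in> h ` {0..<card F}" using bij_betw_imp_surj_on[OF h] by simp
        then obtain i where "i < card F" "h i = V" by auto
        then show "x \<in> (\<Union>i. U i)" using V by (auto simp: U_def)
      qed
      show "bounded (U i)" "diameter (U i) \<le> \<delta>" for i
        using F(4) F(5)[OF hF] that by (auto simp: U_def intro: order_trans)
    qed
    then have "hausdorff_premeasure t \<delta> A \<le> (\<Sum>i. diam_gauge t (U i))"
      unfolding hausdorff_premeasure_def by (rule INF_lower)
    also have "\<dots> = (\<Sum>i<card F. diam_gauge t (U i))"
      by (rule suminf_finite) (auto simp: U_def diam_gauge_def)
    also have "\<dots> \<le> (\<Sum>i<card F. ennreal (d powr t))"
    proof (intro sum_mono)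
      fix i assume "i \<in> {..<card F}"
      then have "U i \<in> F" using hF by (simp add: U_def)
      then have "diameter (U i) powr t \<le> d powr t" using F(5)[of "U i"] t by (intro powr_mono2) (auto simp: diameter_ge_0)
      then show "diam_gauge t (U i) \<le> ennreal (d powr t)" using t by (simp add: diam_gauge_def ennreal_leI)
    qed
    also have "\<dots> = ennreal (real (card F) * d powr t)" by (simp add: ennreal_mult ennreal_of_nat_eq_real_of_nat)
    also have "\<dots> \<le> ennreal \<epsilon>" using F(6) by (rule ennreal_leI)
    finally show ?thesis .
  qed
  have "hausdorff_premeasure t \<delta> A \<le> 0" if "\<delta> \<in> {0<..}" for \<delta>
  proof (rule ennreal_le_epsilon)
    fix \<epsilon> :: real assume "0 < \<epsilon>"
    then show "hausdorff_premeasure t \<delta> A \<le> 0 + ennreal \<epsilon>" using le[of \<delta> \<epsilon>] that by simp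
  qed
  then have "hausdorff_measure t A \<le> 0" unfolding hausdorff_measure_def by (rule SUP_least)
  then show ?thesis by simp
qed

lemma covers_hausdorff_zero:
  fixes A :: "'a::metric_space set"
  assumes t: "t > 0" and r: "0 < r" "r < 1" and D: "D \<ge> 0"
    and cov: "\<And>k. \<exists>F. finite F \<and> A \<subseteq> \<Union>F \<and> (\<forall>U\<in>F. bounded U \<and> diameter U \<le> D * r ^ k) \<and> card F \<le> N k"
    and lim: "(\<lambda>k. real (N k) * (r powr t) ^ k) \<longlonglongrightarrow> 0"
  shows "hausdorff_measure t A = 0"
proof (rule hausdorff_measure_zeroI[OF t])
  fix \<epsilon> :: real assume \<epsilon>: "\<epsilon> > 0"
  have "(\<lambda>k. D powr t * (real (N k) * (r powr t) ^ k)) \<longlonglongrightarrow> D powr t * 0"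
    by (intro tendsto_mult_left lim)
  then have "eventually (\<lambda>k. D powr t * (real (N k) * (r powr t) ^ k) < \<epsilon>) sequentially"
    using \<epsilon> by (intro order_tendstoD) auto
  moreover have "(\<lambda>k. D * r ^ k) \<longlonglongrightarrow> D * 0"
    using r by (intro tendsto_mult_left LIMSEQ_realpow_zero) auto
  then have "eventually (\<lambda>k. D * r ^ k < \<epsilon>) sequentially" using \<epsilon> by (intro order_tendstoD) auto
  ultimately have "eventually (\<lambda>k. D powr t * (real (N k) * (r powr t) ^ k) < \<epsilon> \<and> D * r ^ k < \<epsilon>) sequentially"
    by (rule eventually_conj)
  then obtain k where k: "D powr t * (real (N k) * (r powr t) ^ k) < \<epsilon>" "D * r ^ k < \<epsilon>"
    by (auto simp: eventually_sequentially)
  obtain F where F: "finite F" "A \<subseteq> \<Union>F" "\<forall>U\<in>F. bounded U \<and> diameter U \<le> D * r ^ k" "card F \<le> N k"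
    using cov by blast
  have "(D * r ^ k) powr t = D powr t * (r powr t) ^ k"
    using D r by (simp add: powr_mult powr_realpow[symmetric] powr_powr mult.commute)
  then have le: "real (card F) * (D * r ^ k) powr t \<le> D powr t * (real (N k) * (r powr t) ^ k)"
    using F(4) mult_right_mono[of "real (card F)" "real (N k)" "D powr t * (r powr t) ^ k"] by (simp add: mult_ac)
  have "0 \<le> D * r ^ k" using D r by simp
  moreover have "real (card F) * (D * r ^ k) powr t \<le> \<epsilon>" using le k(1) by linarith
  ultimately show "\<exists>F d. finite F \<and> A \<subseteq> \<Union>F \<and> 0 \<le> d \<and> d \<le> \<epsilon> \<and>
     (\<forall>U\<in>F. bounded U \<and> diameter U \<le> d) \<and> real (card F) * d powr t \<le> \<epsilon>"
    using F(1,2,3) less_imp_le[OF k(2)] by blast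
qed

lemma affine_image_diameter:
  fixes U :: "complex set"
  assumes "bounded U" "diameter U \<le> d" "U \<noteq> {}"
  shows "bounded ((\<lambda>w. b + c * w) ` U)" "diameter ((\<lambda>w. b + c * w) ` U) \<le> d * cmod c"
proof -
  obtain B where B: "\<And>w. w \<in> U \<Longrightarrow> cmod w \<le> B" using assms(1) by (auto simp: bounded_iff)
  show "bounded ((\<lambda>w. b + c * w) ` U)"
  proof (rule boundedI[of _ "cmod b + cmod c * B"])
    fix y assume "y \<in> (\<lambda>w. b + c * w) ` U"
    then obtain w where w: "w \<in> U" "y = b + c * w" by blast
    have "cmod y \<le> cmod b + cmod c * cmod w" unfolding w by (metis norm_mult norm_triangle_ineq)
    also have "\<dots> \<le> cmod b + cmod c * B" using B[OF w(1)] by (intro add_left_mono mult_left_mono) auto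
    finally show "cmod y \<le> cmod b + cmod c * B" .
  qed
  show "diameter ((\<lambda>w. b + c * w) ` U) \<le> d * cmod c"
  proof (rule diameter_le)
    show "(\<lambda>w. b + c * w) ` U \<noteq> {} \<or> 0 \<le> d * cmod c" using assms(3) by simp
    fix x y assume "x \<in> (\<lambda>w. b + c * w) ` U" "y \<in> (\<lambda>w. b + c * w) ` U"
    then obtain v w where vw: "v \<in> U" "w \<in> U" "x = b + c * v" "y = b + c * w" by blast
    have "norm (x - y) = cmod c * dist v w"
      by (simp add: vw dist_norm right_diff_distrib[symmetric] norm_mult)
    also have "\<dots> \<le> cmod c * d" using diameter_bounded_bound[OF assms(1) vw(1,2)] assms(2)
      by (intro mult_left_mono) auto
    finally show "norm (x - y) \<le> d * cmod c" by (simp add: mult.commute)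
  qed
qed

text \<open>The natural covers by images of \<open>K\<close> under words of length \<open>k\<close>.
  Separation is not assumed, so this also serves to deduce \<open>n * |lam| > 1\<close> from
  \<open>s > 1\<close>.\<close>

lemma attractor_hausdorff_zero:
  assumes L: "finite L" and lam: "lam \<noteq> 0" "cmod lam < 1" and K: "is_attractor L lam a K"
    and t: "t > 0" and lt: "real (card L) * cmod lam powr t < 1"
  shows "hausdorff_measure t K = 0"
proof (rule covers_hausdorff_zero[OF t])
  have cK: "compact K" and eq: "K = (\<Union>i\<in>L. ifs_map lam a i ` K)"
    using K by (auto simp: is_attractor_def)
  have bK: "bounded K" using cK by (rule compact_imp_bounded)
  show "0 \<le> diameter K" by (rule diameter_ge_0[OF bK])
  show "0 < cmod lam" "cmod lam < 1" using lam by auto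
  show "(\<lambda>k. real (card L ^ k) * (cmod lam powr t) ^ k) \<longlonglongrightarrow> 0"
    using LIMSEQ_realpow_zero[of "real (card L) * cmod lam powr t"] lt by (simp add: power_mult_distrib)
  have "\<exists>F. finite F \<and> K \<subseteq> \<Union>F \<and> (\<forall>U\<in>F. U \<noteq> {} \<and> bounded U \<and> diameter U \<le> diameter K * cmod lam ^ k) \<and> card F \<le> card L ^ k" for k
  proof (induction k)
    case 0
    show ?case using bK K by (intro exI[of _ "{K}"]) (auto simp: is_attractor_def)
  next
    case (Suc k)
    then obtain F where F: "finite F" "K \<subseteq> \<Union>F" "card F \<le> card L ^ k"
      "\<And>U. U \<in> F \<Longrightarrow> U \<noteq> {} \<and> bounded U \<and> diameter U \<le> diameter K * cmod lam ^ k" by blast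
    define F' where "F' = (\<lambda>q. ifs_map lam a (fst q) ` snd q) ` (L \<times> F)"
    have im: "ifs_map lam a i ` U = (\<lambda>w. a i + lam * w) ` U" for i U by (simp add: ifs_map_def add.commute)
    have "finite F'" using L F by (simp add: F'_def)
    moreover have "K \<subseteq> \<Union>F'"
    proof
      fix x assume "x \<in> K"
      then obtain i y where iy: "i \<in> L" "y \<in> K" "x = ifs_map lam a i y" using eq by blast
      then obtain U where U: "U \<in> F" "y \<in> U" using F(2) by blast
      have "(\<lambda>q. ifs_map lam a (fst q) ` snd q) (i, U) \<in> F'" unfolding F'_def using iy(1) U(1) by (intro imageI) simp
      then have "ifs_map lam a i ` U \<in> F'" by simp
      then show "x \<in> \<Union>F'" using iy(3) U(2) by blast
    qed
    moreover have "U \<noteq> {} \<and> bounded U \<and> diameter U \<le> diameter K * cmod lam ^ Suc k" if "U \<in> F'" for U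
    proof -
      have "\<exists>q\<in>L \<times> F. U = ifs_map lam a (fst q) ` snd q"
        using that unfolding F'_def image_iff .
      then obtain q where q: "q \<in> L \<times> F" "U = ifs_map lam a (fst q) ` snd q" by (rule bexE)
      define i V where "i = fst q" and "V = snd q"
      have V: "V \<in> F" "U = (\<lambda>w. a i + lam * w) ` V" using q unfolding i_def V_def im by (simp_all add: mem_Times_iff)
      have eq: "diameter K * cmod lam ^ k * cmod lam = diameter K * cmod lam ^ Suc k" by simp
      have V': "V \<noteq> {}" "bounded V" "diameter V \<le> diameter K * cmod lam ^ k" using F(4)[OF V(1)] by blast+
      show ?thesis unfolding V(2)
        using affine_image_diameter[OF V'(2,3,1), of "a i" lam, unfolded eq] V'(1) by blast
    qed
    moreover have "card F' \<le> card L ^ Suc k"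
    proof -
      have "card F' \<le> card (L \<times> F)" unfolding F'_def using L F by (intro card_image_le) auto
      also have "\<dots> \<le> card L * card L ^ k" using F(3) by (simp add: card_cartesian_product)
      finally show ?thesis by simp
    qed
    ultimately show ?case by blast
  qed
  then show "\<exists>F. finite F \<and> K \<subseteq> \<Union>F \<and> (\<forall>U\<in>F. bounded U \<and> diameter U \<le> diameter K * cmod lam ^ k) \<and> card F \<le> card L ^ k" for k
    by meson
qed

context separated_ifs
begin

definition "s0 = ln (real n) / ln (1 / rho)"

lemma rho_powr_s0: "rho powr s0 = 1 / real n"
proof -
  have "ln (1 / rho) > 0" using rho by (intro ln_gt_zero) auto
  then have "s0 * ln rho = - ln (real n)" using rho by (simp add: s0_def ln_div)
  then have "rho powr s0 = exp (- ln (real n))" using rho by (simp add: powr_def)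
  then show ?thesis using n_pos by (simp add: exp_minus inverse_eq_divide)
qed

lemma s0_gt_1: "s0 > 1"
proof -
  have "ln (1 / rho) > 0" using rho by (intro ln_gt_zero) auto
  moreover have "1 / rho < real n" using n_lam rho by (simp add: rho_def field_simps)
  then have "ln (1 / rho) < ln (real n)" using rho n_pos by (subst ln_less_cancel_iff) auto
  ultimately show ?thesis by (simp add: s0_def)
qed

lemma rho_powr_s0_minus_1: "rho powr (s0 - 1) = 1 / (real n * rho)"
  using rho by (simp add: powr_diff rho_powr_s0)

text \<open>The upper bound is the natural cover. For the lower bound every word of length
  \<open>k\<close> gets mass \<open>(1 / n) ^ k = (rho powr s0) ^ k\<close>, so for exponents up to
  \<open>s0\<close> no word is bad.\<close>

lemma hausdorff_dim_K: "hausdorff_dim K = s0"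
proof (rule hausdorff_dim_eqI)
  show "s0 > 0" using s0_gt_1 by simp
  fix j :: nat
  show "hausdorff_measure (s0 + 1 / real (Suc j)) K = 0"
  proof (rule attractor_hausdorff_zero[of "{..<n}"])
    show "is_attractor {..<n} lam a K"
      using compact_K K_nonempty K_eq by (simp add: is_attractor_def ifs_map_def)
    show "0 < s0 + 1 / real (Suc j)" using s0_gt_1 by (simp add: add_pos_nonneg)
    have "cmod lam powr (s0 + 1 / real (Suc j)) < cmod lam powr s0"
      using rho unfolding rho_def[symmetric] by (intro powr_less_mono') auto
    then show "real (card {..<n}) * cmod lam powr (s0 + 1 / real (Suc j)) < 1"
      using rho_powr_s0 n_pos by (simp add: rho_def[symmetric] field_simps)
  qed (use lam in auto)
  define e where "e = s0 * (1 - 1 / real (Suc (Suc j)))"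
  have e: "0 < e" "e \<le> s0"
    using s0_gt_1 unfolding e_def by (auto intro!: mult_pos_pos mult_left_le simp del: of_nat_Suc)
  interpret S: slice_mass n a lam K "\<lambda>u. (1 / real n) ^ length u" K
  proof unfold_locales
    show "(1 / real n) ^ length u = (\<Sum>i<n. (1 / real n) ^ length (u @ [i]))" for u using n_pos by simp
    show "closed K" by (rule compact_imp_closed[OF compact_K])
    show "\<exists>w\<in>K. f u w \<in> K" if "set u \<subseteq> {..<n}" for u using f_K[OF that] K_nonempty by blast
  qed auto
  have "rho powr s0 \<le> rho powr e" using e rho by (intro powr_mono') auto
  then have le: "(1 / real n) ^ k \<le> (rho powr e) ^ k" for k unfolding rho_powr_s0 by (intro power_mono) auto
  have "bad_mass (\<lambda>u. (1 / real n) ^ length u) (\<lambda>k. (rho powr e) ^ k) k = 0" for k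
    unfolding bad_mass_def
  proof (intro sum.neutral ballI)
    fix u assume "u \<in> W k"
    then have "length u = k" by (simp add: words_def)
    then show "(if (rho powr e) ^ k < (1 / real n) ^ length u then (1 / real n) ^ length u else 0) = 0"
      using le[of k] by simp
  qed
  then have "hausdorff_measure e K > 0"
    by (intro S.hausdorff_measure_pos[OF e(1), of 0]) simp
  then show "hausdorff_measure (s0 * (1 - 1 / real (Suc (Suc j)))) K > 0" by (simp add: e_def)
qed

end

section \<open>Decomposition and support of the projected measures\<close>

context irrational_ifs
begin

lemma emeasure_nu_nn_integral:
  assumes [measurable]: "A \<in> sets borel"
  shows "emeasure (nu z u) A = (\<integral>\<^sup>+\<omega>. indicator A (proj z (f u (X \<omega>))) \<partial>\<Omega>)"
proof -
  have "emeasure (nu z u) A = (\<integral>\<^sup>+x. indicator A x \<partial>nu z u)" using assms by simp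
  also have "\<dots> = (\<integral>\<^sup>+\<omega>. indicator A (proj z (f u (X \<omega>))) \<partial>\<Omega>)"
    unfolding nu_def by (intro nn_integral_distr) measurable
  finally show ?thesis .
qed

lemma f_X_Stream: "f u (X (i ## \<omega>)) = f (u @ [i]) (X \<omega>)"
  unfolding f_append by (rule arg_cong[of _ _ "f u"]) (simp add: X_Stream f_Cons)

lemma nu_children:
  assumes [measurable]: "A \<in> sets borel"
  shows "emeasure (nu z u) A = (\<Sum>i<n. ennreal (1 / real n) * emeasure (nu z (u @ [i])) A)"
proof -
  have "emeasure (nu z u) A = (\<Sum>i<n. ennreal (1 / real n) * (\<integral>\<^sup>+\<omega>. indicator A (proj z (f u (X (i ## \<omega>)))) \<partial>\<Omega>))"
    unfolding emeasure_nu_nn_integral[OF assms] by (rule nn_integral_Stream) measurable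
  then show ?thesis unfolding emeasure_nu_nn_integral[OF assms] f_X_Stream .
qed

lemma nu_words:
  assumes A: "A \<in> sets borel"
  shows "emeasure (nu z []) A = (\<Sum>u\<in>W k. ennreal ((1 / real n) ^ k) * emeasure (nu z u) A)"
proof -
  have "emeasure (nu z v) A = (\<Sum>u\<in>W k. ennreal ((1 / real n) ^ k) * emeasure (nu z (v @ u)) A)" for v
  proof (induction k arbitrary: v)
    case (Suc k)
    have "emeasure (nu z v) A = (\<Sum>i<n. ennreal (1 / real n) * emeasure (nu z (v @ [i])) A)"
      by (rule nu_children[OF A])
    also have "\<dots> = (\<Sum>i<n. \<Sum>u\<in>W k. ennreal ((1 / real n) ^ Suc k) * emeasure (nu z (v @ i # u)) A)"
    proof (intro sum.cong refl)
      fix i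
      have "ennreal (1 / real n) * emeasure (nu z (v @ [i])) A
          = ennreal (1 / real n) * (\<Sum>u\<in>W k. ennreal ((1 / real n) ^ k) * emeasure (nu z ((v @ [i]) @ u)) A)"
        by (rule arg_cong[OF Suc])
      then show "ennreal (1 / real n) * emeasure (nu z (v @ [i])) A
          = (\<Sum>u\<in>W k. ennreal ((1 / real n) ^ Suc k) * emeasure (nu z (v @ i # u)) A)"
        by (simp add: sum_distrib_left mult.assoc[symmetric] ennreal_mult[symmetric])
    qed
    finally show ?case by (simp only: sum_words_Suc[OF finite_lessThan])
  qed simp
  from this[of "[]"] show ?thesis by simp
qed

text \<open>Truncations followed by a point of \<open>K\<close> lie in the closed set
  \<open>K\<close> and converge to \<open>X \<omega>\<close>. The statement is an almost sure one
  because streams may contain letters outside the alphabet.\<close>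

lemma X_in_K: "AE \<omega> in \<Omega>. X \<omega> \<in> K"
proof -
  have "AE \<omega> in \<Omega>. stake m \<omega> \<in> W m" for m
  proof -
    have "measure \<Omega> {\<omega> \<in> space \<Omega>. stake m \<omega> \<in> W m} = 1"
      unfolding measure_stake using n_pos by (simp add: card_words)
    from \<Omega>.AE_prob_1[OF this] show ?thesis by eventually_elim simp
  qed
  then have "AE \<omega> in \<Omega>. \<forall>m. stake m \<omega> \<in> W m" by (simp add: AE_all_countable)
  then show ?thesis
  proof (rule AE_mp, intro AE_I2 impI)
    fix \<omega> assume w: "\<forall>m. stake m \<omega> \<in> W m"
    obtain x where x: "x \<in> K" using K_nonempty by blast
    show "X \<omega> \<in> K"
    proof (rule closed_sequentially[OF compact_imp_closed[OF compact_K]])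
      show "f (stake m \<omega>) x \<in> K" for m using w x by (intro f_K) (auto simp: words_def)
      have "(\<lambda>m. pt lam a (stake m \<omega>) - X \<omega>) \<longlonglongrightarrow> 0"
      proof (rule Lim_null_comparison)
        show "\<forall>\<^sub>F m in sequentially. norm (pt lam a (stake m \<omega>) - X \<omega>) \<le> rho ^ m * B0"
          using cmod_X_stake_le[of \<omega>] by (simp add: rho_def norm_minus_commute)
        show "(\<lambda>m. rho ^ m * B0) \<longlonglongrightarrow> 0"
          using rho by (intro tendsto_mult_left_zero LIMSEQ_realpow_zero) auto
      qed
      moreover have "(\<lambda>m. lam ^ m * x) \<longlonglongrightarrow> 0" using lam by (intro tendsto_mult_left_zero LIMSEQ_power_zero) auto
      ultimately have "(\<lambda>m. X \<omega> + (pt lam a (stake m \<omega>) - X \<omega>) + lam ^ m * x) \<longlonglongrightarrow> X \<omega> + 0 + 0"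
        by (intro tendsto_add tendsto_const)
      then show "(\<lambda>m. f (stake m \<omega>) x) \<longlonglongrightarrow> X \<omega>" by (simp add: f_def)
    qed
  qed
qed

end

section \<open>Densities of the projected cylinder measures\<close>

locale projected_ifs = irrational_ifs +
  fixes z :: complex
  assumes z: "cmod z = 1"
begin

lemma nu_ac: "absolutely_continuous lborel (nu z u)"
  unfolding absolutely_continuous_def
proof
  fix A :: "real set" assume "A \<in> null_sets lborel"
  then have A: "A \<in> sets borel" "emeasure lborel A = 0" by auto
  interpret P: prob_space "nu z u" by (rule prob_nu)
  have "ennreal ((measure (nu z u) A)\<^sup>2) \<le> 0" using nu_bound[OF z A(1), of u] A(2) by simp
  then have "measure (nu z u) A = 0" by simp
  then have "emeasure (nu z u) A = 0" by (simp add: P.emeasure_eq_measure)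
  then show "A \<in> null_sets (nu z u)" using A by auto
qed

definition g :: "nat list \<Rightarrow> real \<Rightarrow> real" where
  "g u x = enn2real (RN_deriv lborel (nu z u) x)"

lemma g_measurable [measurable]: "g u \<in> borel_measurable borel"
proof -
  have "RN_deriv lborel (nu z u) \<in> borel_measurable lborel" by (rule borel_measurable_RN_deriv)
  then show ?thesis unfolding g_def[abs_def] by measurable
qed

lemma g_nonneg: "0 \<le> g u x" by (simp add: g_def)

lemma g_RN: "AE x in lborel. ennreal (g u x) = RN_deriv lborel (nu z u) x"
proof -
  interpret P: prob_space "nu z u" by (rule prob_nu)
  have "AE x in lborel. RN_deriv lborel (nu z u) x \<noteq> \<infinity>"
    by (rule sigma_finite_measure.RN_deriv_finite[OF lborel.sigma_finite_measure_axioms]) (auto intro: nu_ac P.sigma_finite_measure_axioms)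
  then show ?thesis by eventually_elim (simp add: g_def less_top)
qed

lemma emeasure_nu:
  assumes A: "A \<in> sets borel"
  shows "emeasure (nu z u) A = (\<integral>\<^sup>+x. ennreal (g u x) * indicator A x \<partial>lborel)"
proof -
  have "density lborel (RN_deriv lborel (nu z u)) = nu z u"
    by (rule sigma_finite_measure.density_RN_deriv[OF lborel.sigma_finite_measure_axioms]) (auto intro: nu_ac)
  then have "emeasure (nu z u) A = emeasure (density lborel (RN_deriv lborel (nu z u))) A" by simp
  also have "\<dots> = (\<integral>\<^sup>+x. RN_deriv lborel (nu z u) x * indicator A x \<partial>lborel)"
    using A by (intro emeasure_density) auto
  also have "\<dots> = (\<integral>\<^sup>+x. ennreal (g u x) * indicator A x \<partial>lborel)"
    using g_RN[of u] by (intro nn_integral_cong_AE) (auto elim: eventually_mono)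
  finally show ?thesis .
qed

text \<open>Densities are unique up to null sets, so \<open>nu_children\<close> passes to
  them.\<close>

lemma g_children: "AE x in lborel. g u x = (\<Sum>i<n. g (u @ [i]) x / real n)"
proof -
  define h where "h x = ennreal (\<Sum>i<n. g (u @ [i]) x / real n)" for x
  have h_eq: "h x = (\<Sum>i<n. ennreal (1 / real n) * ennreal (g (u @ [i]) x))" for x
    unfolding h_def by (subst sum_ennreal[symmetric]) (auto simp: g_nonneg ennreal_mult[symmetric])
  have [measurable]: "h \<in> borel_measurable borel" unfolding h_def[abs_def] by measurable
  have "density lborel h = nu z u"
  proof (rule measure_eqI)
    fix A assume "A \<in> sets (density lborel h)"
    then have A[measurable]: "A \<in> sets borel" by simp
    have "emeasure (density lborel h) A = (\<integral>\<^sup>+x. h x * indicator A x \<partial>lborel)" by (intro emeasure_density) auto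
    also have "\<dots> = (\<integral>\<^sup>+x. (\<Sum>i<n. ennreal (1 / real n) * (ennreal (g (u @ [i]) x) * indicator A x)) \<partial>lborel)"
      unfolding h_eq by (simp add: sum_distrib_right mult.assoc)
    also have "\<dots> = (\<Sum>i<n. \<integral>\<^sup>+x. ennreal (1 / real n) * (ennreal (g (u @ [i]) x) * indicator A x) \<partial>lborel)"
      by (intro nn_integral_sum) measurable
    also have "\<dots> = (\<Sum>i<n. ennreal (1 / real n) * emeasure (nu z (u @ [i])) A)"
      unfolding emeasure_nu[OF A] by (intro sum.cong refl nn_integral_cmult) measurable
    also have "\<dots> = emeasure (nu z u) A" by (rule nu_children[OF A, symmetric])
    finally show "emeasure (density lborel h) A = emeasure (nu z u) A" .
  qed simp
  then have "AE x in lborel. h x = RN_deriv lborel (nu z u) x"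
    by (intro sigma_finite_measure.RN_deriv_unique[OF lborel.sigma_finite_measure_axioms]) auto
  then show ?thesis
  proof eventually_elim
    case (elim x)
    have "g u x = enn2real (h x)" by (simp add: g_def elim)
    then show ?case by (simp add: h_def sum_nonneg g_nonneg)
  qed
qed

text \<open>The mass of the cylinder of \<open>u\<close> in the unnormalised disintegration of
  \<eta> along \<open>proj z\<close>; the fibre over \<open>x\<close> has total mass
  \<open>g [] x\<close>.\<close>

definition M :: "real \<Rightarrow> nat list \<Rightarrow> real" where
  "M x u = (1 / real n) ^ length u * g u x"

lemma M_nonneg: "0 \<le> M x u" by (simp add: M_def g_nonneg)

lemma M_add: "AE x in lborel. \<forall>u. M x u = (\<Sum>i<n. M x (u @ [i]))"
  unfolding AE_all_countable
proof
  fix u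
  from g_children[of u] show "AE x in lborel. M x u = (\<Sum>i<n. M x (u @ [i]))"
  proof eventually_elim
    case (elim x)
    show ?case unfolding M_def elim by (simp add: sum_distrib_left mult_ac)
  qed
qed

lemma g_support: "AE x in lborel. 0 < g u x \<longrightarrow> x \<in> proj z ` f u ` K"
proof -
  have "compact (proj z ` f u ` K)"
    unfolding proj_def by (intro compact_continuous_image compact_cyl continuous_intros)
  then have A[measurable]: "- (proj z ` f u ` K) \<in> sets borel" by (intro borel_open) (simp add: compact_imp_closed open_Compl)
  have "emeasure (nu z u) (- (proj z ` f u ` K)) = (\<integral>\<^sup>+\<omega>. indicator (- (proj z ` f u ` K)) (proj z (f u (X \<omega>))) \<partial>\<Omega>)"
    by (rule emeasure_nu_nn_integral[OF A])
  also have "\<dots> = (\<integral>\<^sup>+\<omega>. 0 \<partial>\<Omega>)"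
    using X_in_K by (intro nn_integral_cong_AE) (auto elim!: eventually_mono simp: indicator_def)
  finally have "(\<integral>\<^sup>+x. ennreal (g u x) * indicator (- (proj z ` f u ` K)) x \<partial>lborel) = 0"
    unfolding emeasure_nu[OF A] by simp
  then have "AE x in lborel. ennreal (g u x) * indicator (- (proj z ` f u ` K)) x = 0"
    by (subst (asm) nn_integral_0_iff_AE) auto
  then show ?thesis by eventually_elim (auto simp: indicator_def split: if_splits)
qed

text \<open>There are countably many words, so additivity and support hold for all of them outside
  one null set. A word of positive mass has \<open>x\<close> in the projection of its cylinder,
  which is to say that the cylinder meets the slice.\<close>

lemma AE_slice_mass: "AE x in lborel. slice_mass n a lam K (M x) (slice K z x)"
proof -
  have "AE x in lborel. \<forall>u. 0 < g u x \<longrightarrow> x \<in> proj z ` f u ` K"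
    unfolding AE_all_countable using g_support by blast
  with M_add show ?thesis
  proof eventually_elim
    case (elim x)
    show ?case
    proof (intro slice_mass.intro separated_ifs_axioms slice_mass_axioms.intro)
      show "0 \<le> M x u" for u by (rule M_nonneg)
      show "M x u = (\<Sum>i<n. M x (u @ [i]))" for u using elim(1) by blast
      have "closed (proj z -` {x})"
        unfolding proj_def by (intro closed_vimage continuous_intros closed_singleton)
      then show "closed (slice K z x)" unfolding slice_def by (intro closed_Int compact_imp_closed[OF compact_K])
      fix u assume u: "set u \<subseteq> {..<n}" "0 < M x u"
      then have "0 < g u x" using g_nonneg[of u x] by (auto simp: M_def zero_less_mult_iff)
      then have "x \<in> proj z ` f u ` K" using elim(2) by blast
      then obtain w where w: "w \<in> K" "x = proj z (f u w)" by blast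
      then have "f u w \<in> slice K z x" using f_K[OF u(1) w(1)] by (simp add: slice_def)
      then show "\<exists>w\<in>K. f u w \<in> slice K z x" using w(1) by blast
    qed
  qed
qed

text \<open>For \<open>A = {x. g u x > t}\<close> with mass v and length l one has
  \<open>t * l \<le> v\<close> from the density and
  \<open>v^2 \<le> Cnu / rho ^ length u * l\<close> from \<open>nu_bound\<close>; eliminating l
  gives the claim.\<close>

lemma nu_tail:
  assumes t: "t > 0"
  shows "emeasure (nu z u) {x. g u x > t} \<le> ennreal (Cnu / (rho ^ length u * t))"
proof -
  interpret P: prob_space "nu z u" by (rule prob_nu)
  define A where "A = {x. g u x > t}"
  have A[measurable]: "A \<in> sets borel" unfolding A_def by measurable
  define v where "v = measure (nu z u) A"
  have v: "v \<ge> 0" by (simp add: v_def)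
  have "ennreal t * emeasure lborel A = (\<integral>\<^sup>+x. ennreal t * indicator A x \<partial>lborel)"
    by (simp add: nn_integral_cmult_indicator)
  also have "\<dots> \<le> (\<integral>\<^sup>+x. ennreal (g u x) * indicator A x \<partial>lborel)"
    by (intro nn_integral_mono) (auto simp: A_def indicator_def ennreal_leI)
  also have "\<dots> = emeasure (nu z u) A" by (rule emeasure_nu[OF A, symmetric])
  also have "\<dots> = ennreal v" by (simp add: v_def P.emeasure_eq_measure)
  finally have 1: "ennreal t * emeasure lborel A \<le> ennreal v" .
  have "emeasure lborel A \<noteq> \<top>" using 1 t by (auto simp: ennreal_mult_top top_unique)
  then obtain l where l: "l \<ge> 0" "emeasure lborel A = ennreal l" by (cases "emeasure lborel A") auto
  have tl: "t * l \<le> v" using 1 t l v by (simp add: ennreal_mult[symmetric])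
  define R where "R = rho ^ length u"
  have R: "R > 0" using rho by (simp add: R_def)
  have "ennreal (v\<^sup>2) \<le> ennreal (Cnu / R) * ennreal l"
    using nu_bound[OF z A, of u] by (simp add: v_def l(2) R_def)
  also have "\<dots> = ennreal (Cnu / R * l)" using Cnu(1) R l(1) by (simp add: ennreal_mult[symmetric])
  finally have v2: "v\<^sup>2 \<le> Cnu / R * l" using Cnu(1) R l(1) by (subst (asm) ennreal_le_iff) auto
  have "v \<le> Cnu / (R * t)"
  proof (cases "v = 0")
    case True then show ?thesis using Cnu(1) R t by simp
  next
    case False
    then have vp: "v > 0" using v by linarith
    have "l \<le> v / t" using tl t by (simp add: pos_le_divide_eq mult.commute)
    then have "Cnu / R * l \<le> Cnu / R * (v / t)" using Cnu(1) R by (intro mult_left_mono) auto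
    then have "v * v \<le> Cnu / (R * t) * v" using v2 by (simp add: power2_eq_square)
    then show ?thesis using vp by (rule mult_right_le_imp_le)
  qed
  then show ?thesis unfolding A_def[symmetric] P.emeasure_eq_measure v_def[symmetric] R_def by (rule ennreal_leI)
qed

lemma bad_mass_measurable [measurable]: "(\<lambda>x. bad_mass (M x) \<theta> k) \<in> borel_measurable borel"
  unfolding bad_mass_def M_def by measurable

lemma bad_mass_nonneg: "0 \<le> bad_mass (M x) \<theta> k"
  unfolding bad_mass_def by (intro sum_nonneg) (auto simp: M_nonneg)

text \<open>A word of length \<open>k\<close> is bad over \<open>x\<close> exactly if
  \<open>g u x > \<theta> k * n ^ k\<close>; the tail bound is averaged over the
  \<open>n ^ k\<close> words. The critical thresholds are of order
  \<open>(1 / (n * rho)) ^ k\<close>, which is \<open>rho\<close> to the power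
  \<open>(s0 - 1) * k\<close>.\<close>

lemma bad_integral:
  assumes \<theta>: "\<theta> k > 0"
  shows "(\<integral>\<^sup>+x. ennreal (bad_mass (M x) \<theta> k) \<partial>lborel) \<le> ennreal (Cnu * (1 / (real n * rho)) ^ k / \<theta> k)"
proof -
  define N where "N = real n ^ k"
  have N: "N > 0" using n_pos by (simp add: N_def)
  define A where "A u = {x. g u x > \<theta> k * N}" for u
  have A[measurable]: "A u \<in> sets borel" for u unfolding A_def by measurable
  have eq: "ennreal (bad_mass (M x) \<theta> k) = (\<Sum>u\<in>W k. ennreal (1 / N) * (ennreal (g u x) * indicator (A u) x))" for x
  proof -
    have "bad_mass (M x) \<theta> k = (\<Sum>u\<in>W k. 1 / N * (g u x * indicator (A u) x))"
      unfolding bad_mass_def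
    proof (intro sum.cong refl)
      fix u assume "u \<in> W k"
      then have "M x u = g u x / N" by (simp add: M_def words_def N_def power_one_over)
      moreover have "\<theta> k < g u x / N \<longleftrightarrow> x \<in> A u" using N by (simp add: A_def pos_less_divide_eq)
      ultimately show "(if \<theta> k < M x u then M x u else 0) = 1 / N * (g u x * indicator (A u) x)" by simp
    qed
    also have "ennreal \<dots> = (\<Sum>u\<in>W k. ennreal (1 / N * (g u x * indicator (A u) x)))"
      using N by (intro sum_ennreal[symmetric]) (simp add: g_nonneg)
    also have "\<dots> = (\<Sum>u\<in>W k. ennreal (1 / N) * (ennreal (g u x) * indicator (A u) x))"
    proof (intro sum.cong refl)
      fix u
      show "ennreal (1 / N * (g u x * indicator (A u) x)) = ennreal (1 / N) * (ennreal (g u x) * indicator (A u) x)"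
        using N by (cases "x \<in> A u") (simp_all add: ennreal_mult'[symmetric])
    qed
    finally show ?thesis .
  qed
  have "(\<integral>\<^sup>+x. ennreal (bad_mass (M x) \<theta> k) \<partial>lborel)
      = (\<Sum>u\<in>W k. \<integral>\<^sup>+x. ennreal (1 / N) * (ennreal (g u x) * indicator (A u) x) \<partial>lborel)"
    unfolding eq by (intro nn_integral_sum) measurable
  also have "\<dots> = (\<Sum>u\<in>W k. ennreal (1 / N) * emeasure (nu z u) (A u))"
    unfolding emeasure_nu[OF A] by (intro sum.cong refl nn_integral_cmult) measurable
  also have "\<dots> \<le> (\<Sum>u\<in>W k. ennreal (1 / N) * ennreal (Cnu / (rho ^ k * (\<theta> k * N))))"
  proof (intro sum_mono mult_left_mono)
    fix u assume "u \<in> W k"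
    then have "length u = k" by (simp add: words_def)
    then show "emeasure (nu z u) (A u) \<le> ennreal (Cnu / (rho ^ k * (\<theta> k * N)))"
      unfolding A_def using nu_tail[of "\<theta> k * N" u] \<theta> N by simp
  qed simp
  also have "\<dots> = (\<Sum>u\<in>W k. ennreal (1 / N * (Cnu / (rho ^ k * (\<theta> k * N)))))"
    using N by (intro sum.cong refl ennreal_mult'[symmetric]) simp
  also have "\<dots> = ennreal (\<Sum>u\<in>W k. 1 / N * (Cnu / (rho ^ k * (\<theta> k * N))))"
    using N \<theta> rho Cnu(1) by (intro sum_ennreal) auto
  also have "(\<Sum>u\<in>W k. 1 / N * (Cnu / (rho ^ k * (\<theta> k * N)))) = N * (1 / N * (Cnu / (rho ^ k * (\<theta> k * N))))"
    by (simp add: card_words N_def)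
  also have "\<dots> = Cnu * (1 / (real n * rho)) ^ k / \<theta> k"
    using N by (simp add: N_def power_divide power_mult_distrib)
  finally show ?thesis .
qed

section \<open>Dimension and packing measure of almost every slice\<close>

lemma M_Nil: "M x [] = g [] x" by (simp add: M_def)

text \<open>A Borel-Cantelli argument: below the critical exponent the mean bad masses decay
  geometrically, so for almost every \<open>x\<close> they are summable, and the tail from some
  \<open>k0\<close> on is smaller than the total mass \<open>g [] x\<close>.\<close>

lemma AE_hausdorff_pos:
  assumes e: "0 < e" "e < s0 - 1"
  shows "AE x in lborel. 0 < g [] x \<longrightarrow> hausdorff_measure e (slice K z x) > 0"
proof -
  define \<theta> where "\<theta> k = (rho powr e) ^ k" for k :: nat
  define b where "b x k = bad_mass (M x) \<theta> k" for x k
  define q where "q = 1 / (real n * rho) / rho powr e"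
  have q: "0 < q" "q < 1"
  proof -
    show "0 < q" using rho n_pos by (simp add: q_def)
    have "rho powr (s0 - 1) < rho powr e" using e rho by (intro powr_less_mono') auto
    moreover have "rho powr e > 0" using rho by simp
    ultimately show "q < 1" unfolding rho_powr_s0_minus_1 q_def by (subst divide_less_eq_1_pos)
  qed
  have "(\<integral>\<^sup>+x. (\<Sum>k. ennreal (b x k)) \<partial>lborel) = (\<Sum>k. \<integral>\<^sup>+x. ennreal (b x k) \<partial>lborel)"
    unfolding b_def by (intro nn_integral_suminf) measurable
  also have "\<dots> \<le> (\<Sum>k. ennreal (Cnu * q ^ k))"
  proof (intro suminf_le summableI)
    fix k
    have "\<theta> k > 0" using rho by (simp add: \<theta>_def)
    from bad_integral[of \<theta>, OF this]
    show "(\<integral>\<^sup>+x. ennreal (b x k) \<partial>lborel) \<le> ennreal (Cnu * q ^ k)"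
      by (simp add: b_def q_def \<theta>_def power_divide power_mult_distrib)
  qed
  also have "\<dots> = ennreal (\<Sum>k. Cnu * q ^ k)"
    using q Cnu(1) by (intro suminf_ennreal2 summable_mult summable_geometric) auto
  finally have "(\<integral>\<^sup>+x. (\<Sum>k. ennreal (b x k)) \<partial>lborel) \<noteq> \<infinity>" by (auto simp: top_unique)
  then have "AE x in lborel. (\<Sum>k. ennreal (b x k)) \<noteq> \<infinity>"
    unfolding b_def by (intro nn_integral_noteq_infinite) measurable
  with AE_slice_mass show ?thesis
  proof eventually_elim
    case (elim x)
    show ?case
    proof
    assume gx: "0 < g [] x"
    interpret S: slice_mass n a lam K "M x" "slice K z x" by (rule elim(1))
    have b0: "0 \<le> b x k" for k unfolding b_def by (rule bad_mass_nonneg)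
    have "summable (b x)" using elim(2) b0 by (intro summable_suminf_not_top) auto
    then obtain k0 where k0: "norm (\<Sum>i. b x (i + k0)) < g [] x"
      using suminf_exist_split[OF gx, of "b x"] by blast
    have "(\<Sum>k. ennreal (b x (k + k0))) = ennreal (\<Sum>k. b x (k + k0))"
      using b0 \<open>summable (b x)\<close> by (intro suminf_ennreal2) (auto simp: summable_iff_shift)
    also have "\<dots> < ennreal (g [] x)" using k0 gx by (intro ennreal_lessI) auto
    finally show "hausdorff_measure e (slice K z x) > 0"
      unfolding b_def \<theta>_def M_Nil[symmetric] by (intro S.hausdorff_measure_pos[OF e(1)])
    qed
  qed
qed

text \<open>At the critical exponent the mean bad masses are bounded by \<open>Cnu / (T + 1)\<close>
  but need not be summable. Fatou's lemma for each \<open>T\<close>, then the infimum over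
  \<open>T\<close>, show that the function \<open>h\<close> vanishes almost everywhere.\<close>

lemma AE_packing_pos: "AE x in lborel. 0 < g [] x \<longrightarrow> packing_measure (s0 - 1) (slice K z x) > 0"
proof -
  define \<theta> where "\<theta> T k = real (Suc T) * (rho powr (s0 - 1)) ^ k" for T k :: nat
  define b where "b T k x = ennreal (bad_mass (M x) (\<theta> T) k)" for T k x
  have [measurable]: "b T k \<in> borel_measurable borel" for T k unfolding b_def by measurable
  define h where "h x = (INF T. liminf (\<lambda>k. b T k x))" for x
  have [measurable]: "h \<in> borel_measurable borel" unfolding h_def by measurable
  have "(\<integral>\<^sup>+x. h x \<partial>lborel) \<le> ennreal (Cnu / real (Suc T))" for T
  proof -
    have "(\<integral>\<^sup>+x. h x \<partial>lborel) \<le> (\<integral>\<^sup>+x. liminf (\<lambda>k. b T k x) \<partial>lborel)"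
      unfolding h_def by (intro nn_integral_mono INF_lower) simp
    also have "\<dots> \<le> liminf (\<lambda>k. \<integral>\<^sup>+x. b T k x \<partial>lborel)" by (intro nn_integral_liminf) measurable
    also have "\<dots> \<le> liminf (\<lambda>k. ennreal (Cnu / real (Suc T)))"
    proof (intro Liminf_mono always_eventually allI)
      fix k
      have "\<theta> T k > 0" using rho by (simp add: \<theta>_def)
      from bad_integral[of "\<theta> T", OF this]
      show "(\<integral>\<^sup>+x. b T k x \<partial>lborel) \<le> ennreal (Cnu / real (Suc T))"
        using rho n_pos by (simp add: b_def \<theta>_def rho_powr_s0_minus_1 power_divide)
    qed
    also have "\<dots> = ennreal (Cnu / real (Suc T))" by (simp add: Liminf_const)
    finally show ?thesis .
  qed
  then have le: "(\<integral>\<^sup>+x. h x \<partial>lborel) \<le> ennreal (Cnu / real (Suc T))" for T .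
  have "(\<lambda>T. ennreal (Cnu / real (Suc T))) \<longlonglongrightarrow> ennreal 0"
    by (intro tendsto_ennrealI LIMSEQ_Suc[OF lim_const_over_n])
  then have "(\<integral>\<^sup>+x. h x \<partial>lborel) \<le> ennreal 0" using le by (intro LIMSEQ_le_const) auto
  then have "(\<integral>\<^sup>+x. h x \<partial>lborel) = 0" by simp
  then have "AE x in lborel. h x = 0" by (subst (asm) nn_integral_0_iff_AE) auto
  with AE_slice_mass show ?thesis
  proof eventually_elim
    case (elim x)
    show ?case
    proof
    assume gx: "0 < g [] x"
    interpret S: slice_mass n a lam K "M x" "slice K z x" by (rule elim(1))
    define \<beta> where "\<beta> = g [] x / 2"
    have \<beta>: "\<beta> > 0" using gx by (simp add: \<beta>_def)
    have "h x < ennreal \<beta>" using elim(2) \<beta> by simp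
    \<comment> \<open>The threshold factor may depend on \<open>x\<close>: for this \<open>T\<close>
      the bad mass is below half of the total mass at infinitely many levels.\<close>
    then obtain T where T: "liminf (\<lambda>k. b T k x) < ennreal \<beta>" unfolding h_def INF_less_iff by blast
    have "\<exists>\<^sub>\<infinity>k. b T k x < ennreal \<beta>"
    proof (rule ccontr)
      assume "\<not> (\<exists>\<^sub>\<infinity>k. b T k x < ennreal \<beta>)"
      then have "\<forall>\<^sub>F k in sequentially. ennreal \<beta> \<le> b T k x"
        by (simp add: not_frequently cofinite_eq_sequentially not_less)
      then have "ennreal \<beta> \<le> liminf (\<lambda>k. b T k x)" by (rule Liminf_bounded)
      then show False using T by simp
    qed
    then have "\<exists>\<^sub>\<infinity>k. bad_mass (M x) (\<theta> T) k \<le> M x [] - \<beta>"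
    proof (rule INFM_mono)
      fix k assume "b T k x < ennreal \<beta>"
      then have "bad_mass (M x) (\<theta> T) k < \<beta>" using bad_mass_nonneg by (simp add: b_def ennreal_less_iff)
      then show "bad_mass (M x) (\<theta> T) k \<le> M x [] - \<beta>" by (simp add: M_Nil \<beta>_def)
    qed
    then show "packing_measure (s0 - 1) (slice K z x) > 0"
      unfolding \<theta>_def using s0_gt_1 by (intro S.packing_measure_pos[OF _ _ \<beta>]) auto
    qed
  qed
qed

lemma emeasure_proj_cyl:
  assumes "\<And>w. w \<in> K \<Longrightarrow> cmod w \<le> D"
  shows "emeasure lborel (proj z ` f u ` K) \<le> ennreal (2 * D * rho ^ length u)"
proof -
  define c where "c = proj z (pt lam a u)"
  define r where "r = D * rho ^ length u"
  have "0 \<le> D" using K_nonempty assms norm_ge_zero order_trans by blast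
  then have r: "0 \<le> r" using rho by (simp add: r_def)
  have "proj z ` f u ` K \<subseteq> {c - r..c + r}"
  proof
    fix x assume "x \<in> proj z ` f u ` K"
    then obtain w where w: "w \<in> K" "x = proj z (f u w)" by blast
    have "\<bar>x - c\<bar> = \<bar>proj z (f u w - pt lam a u)\<bar>" by (simp add: w c_def proj_diff)
    also have "\<dots> \<le> cmod z * cmod (f u w - pt lam a u)" by (rule abs_proj_le)
    also have "\<dots> = rho ^ length u * cmod w" using z by (simp add: f_def norm_mult norm_power rho_def)
    also have "\<dots> \<le> r" unfolding r_def using assms[OF w(1)] rho by (subst mult.commute) (intro mult_right_mono, auto)
    finally show "x \<in> {c - r..c + r}" by (auto simp: abs_le_iff)
  qed
  then have "emeasure lborel (proj z ` f u ` K) \<le> emeasure lborel {c - r..c + r}" by (intro emeasure_mono) auto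
  also have "\<dots> = ennreal (2 * r)" using r by (simp add: algebra_simps)
  finally show ?thesis by (simp add: r_def mult.assoc)
qed

lemma proj_cyl_sets [measurable]: "proj z ` f u ` K \<in> sets borel"
proof -
  have "compact (proj z ` f u ` K)"
    unfolding proj_def by (intro compact_continuous_image compact_cyl continuous_intros)
  then show ?thesis by (intro borel_closed compact_imp_closed)
qed

text \<open>A cylinder of level \<open>k\<close> projects to length at most
  \<open>2 * D * rho ^ k\<close>, so the integral of the number of cylinders meeting the slice is
  \<open>O((n * rho) ^ k)\<close>. For \<open>t > s0 - 1\<close> the sum of these numbers times
  \<open>rho powr t\<close> to the power \<open>k\<close> is finite for almost every
  \<open>x\<close>, hence its terms tend to 0.\<close>

lemma AE_hausdorff_zero:
  assumes t: "t > s0 - 1"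
  shows "AE x in lborel. hausdorff_measure t (slice K z x) = 0"
proof -
  obtain D where D: "\<And>w. w \<in> K \<Longrightarrow> cmod w \<le> D"
    using compact_imp_bounded[OF compact_K] by (auto simp: bounded_iff)
  have D0: "0 \<le> D" using K_nonempty D norm_ge_zero order_trans by blast
  have t0: "t > 0" using t s0_gt_1 by simp
  define q where "q = real n * rho * rho powr t"
  have q: "0 < q" "q < 1"
  proof -
    show "0 < q" using rho n_pos by (simp add: q_def)
    have "rho powr t < rho powr (s0 - 1)" using t rho by (intro powr_less_mono') auto
    then show "q < 1" using rho n_pos unfolding rho_powr_s0_minus_1 by (simp add: q_def field_simps)
  qed
  define N where "N x k = card {u \<in> W k. x \<in> proj z ` f u ` K}" for x k
  have N_eq: "ennreal (real (N x k)) = (\<Sum>u\<in>W k. indicator (proj z ` f u ` K) x)" for x k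
  proof -
    have "(\<Sum>u\<in>W k. indicator (proj z ` f u ` K) x) = (\<Sum>u\<in>W k. if x \<in> proj z ` f u ` K then 1 else 0 :: ennreal)"
      by (simp add: indicator_def of_bool_def)
    also have "\<dots> = of_nat (N x k)" by (simp add: sum.If_cases N_def Int_def)
    finally show ?thesis by (simp add: ennreal_of_nat_eq_real_of_nat)
  qed
  have [measurable]: "(\<lambda>x. ennreal (real (N x k))) \<in> borel_measurable borel" for k unfolding N_eq by measurable
  have "(\<integral>\<^sup>+x. (\<Sum>k. ennreal ((rho powr t) ^ k) * ennreal (real (N x k))) \<partial>lborel)
      = (\<Sum>k. \<integral>\<^sup>+x. ennreal ((rho powr t) ^ k) * ennreal (real (N x k)) \<partial>lborel)"
    by (intro nn_integral_suminf) measurable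
  also have "\<dots> \<le> (\<Sum>k. ennreal (2 * D * q ^ k))"
  proof (intro suminf_le summableI)
    fix k
    have "(\<integral>\<^sup>+x. ennreal (real (N x k)) \<partial>lborel) = (\<Sum>u\<in>W k. \<integral>\<^sup>+x. indicator (proj z ` f u ` K) x \<partial>lborel)"
      unfolding N_eq by (intro nn_integral_sum) measurable
    also have "\<dots> \<le> (\<Sum>u\<in>W k. ennreal (2 * D * rho ^ k))"
    proof (intro sum_mono)
      fix u assume "u \<in> W k"
      then have "length u = k" by (simp add: words_def)
      then show "(\<integral>\<^sup>+x. indicator (proj z ` f u ` K) x \<partial>lborel) \<le> ennreal (2 * D * rho ^ k)"
        using emeasure_proj_cyl[OF D, of u] by (simp add: nn_integral_indicator)
    qed
    also have "\<dots> = ennreal (\<Sum>u\<in>W k. 2 * D * rho ^ k)" using D0 rho by (intro sum_ennreal) auto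
    also have "(\<Sum>u\<in>W k. 2 * D * rho ^ k) = real n ^ k * (2 * D * rho ^ k)" by (simp add: card_words)
    finally have le: "(\<integral>\<^sup>+x. ennreal (real (N x k)) \<partial>lborel) \<le> ennreal (real n ^ k * (2 * D * rho ^ k))" .
    have "(\<integral>\<^sup>+x. ennreal ((rho powr t) ^ k) * ennreal (real (N x k)) \<partial>lborel)
        = ennreal ((rho powr t) ^ k) * (\<integral>\<^sup>+x. ennreal (real (N x k)) \<partial>lborel)"
      by (intro nn_integral_cmult) measurable
    also have "\<dots> \<le> ennreal ((rho powr t) ^ k) * ennreal (real n ^ k * (2 * D * rho ^ k))"
      by (intro mult_left_mono le) simp
    also have "\<dots> = ennreal ((rho powr t) ^ k * (real n ^ k * (2 * D * rho ^ k)))"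
      by (intro ennreal_mult'[symmetric]) simp
    also have "(rho powr t) ^ k * (real n ^ k * (2 * D * rho ^ k)) = 2 * D * q ^ k"
      by (simp add: q_def power_mult_distrib)
    finally show "(\<integral>\<^sup>+x. ennreal ((rho powr t) ^ k) * ennreal (real (N x k)) \<partial>lborel) \<le> ennreal (2 * D * q ^ k)" .
  qed
  also have "\<dots> = ennreal (\<Sum>k. 2 * D * q ^ k)"
    using q D0 by (intro suminf_ennreal2 summable_mult summable_geometric) auto
  finally have "(\<integral>\<^sup>+x. (\<Sum>k. ennreal ((rho powr t) ^ k) * ennreal (real (N x k))) \<partial>lborel) \<noteq> \<infinity>"
    by (auto simp: top_unique)
  then have "AE x in lborel. (\<Sum>k. ennreal ((rho powr t) ^ k) * ennreal (real (N x k))) \<noteq> \<infinity>"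
    by (intro nn_integral_noteq_infinite) measurable
  then show ?thesis
  proof eventually_elim
    case (elim x)
    have "(\<Sum>k. ennreal (real (N x k) * (rho powr t) ^ k)) \<noteq> \<top>"
      using elim by (simp add: ennreal_mult' mult.commute)
    then have "summable (\<lambda>k. real (N x k) * (rho powr t) ^ k)" by (intro summable_suminf_not_top) auto
    then have lim: "(\<lambda>k. real (N x k) * (rho powr t) ^ k) \<longlonglongrightarrow> 0" by (rule summable_LIMSEQ_zero)
    have bK: "bounded K" by (rule compact_imp_bounded[OF compact_K])
    show ?case
    proof (rule covers_hausdorff_zero[OF t0 rho diameter_ge_0[OF bK] _ lim])
      fix k
      define F where "F = (\<lambda>u. f u ` K) ` {u \<in> W k. x \<in> proj z ` f u ` K}"
      have "finite {u \<in> W k. x \<in> proj z ` f u ` K}" by simp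
      then have 1: "finite F" "card F \<le> N x k" unfolding F_def N_def by (auto intro: card_image_le)
      have 2: "slice K z x \<subseteq> \<Union>F"
      proof
        fix y assume y: "y \<in> slice K z x"
        then obtain u w where uw: "u \<in> W k" "w \<in> K" "y = f u w" using K_words[of y k] by (auto simp: slice_def)
        then have "x \<in> proj z ` f u ` K" using y by (auto simp: slice_def)
        then show "y \<in> \<Union>F" using uw by (auto simp: F_def)
      qed
      have 3: "bounded U \<and> diameter U \<le> diameter K * rho ^ k" if U: "U \<in> F" for U
      proof -
        obtain u where u: "u \<in> W k" "U = f u ` K" using U by (auto simp: F_def)
        have "f u ` K = (\<lambda>w. pt lam a u + lam ^ k * w) ` K" using u(1) by (simp add: f_def words_def)
        then show ?thesis using affine_image_diameter[OF bK order_refl K_nonempty, of "pt lam a u" "lam ^ k"]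
          by (simp add: u(2) norm_power rho_def)
      qed
      show "\<exists>F. finite F \<and> slice K z x \<subseteq> \<Union>F \<and> (\<forall>U\<in>F. bounded U \<and> diameter U \<le> diameter K * rho ^ k) \<and> card F \<le> N x k"
        using 1 2 3 by blast
    qed
  qed
qed

definition "good = {x. hausdorff_dim (slice K z x) = s0 - 1 \<and> packing_measure (s0 - 1) (slice K z x) > 0}"

lemma AE_good: "AE x in lborel. 0 < g [] x \<longrightarrow> x \<in> good"
proof -
  define \<tau> where "\<tau> = s0 - 1"
  have \<tau>: "\<tau> > 0" using s0_gt_1 by (simp add: \<tau>_def)
  have 1: "AE x in lborel. \<forall>j::nat. hausdorff_measure (\<tau> + 1 / real (Suc j)) (slice K z x) = 0"
    unfolding AE_all_countable by (intro allI AE_hausdorff_zero) (simp add: \<tau>_def)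
  have 2: "AE x in lborel. \<forall>j::nat. 0 < g [] x \<longrightarrow> hausdorff_measure (\<tau> * (1 - 1 / real (Suc (Suc j)))) (slice K z x) > 0"
    unfolding AE_all_countable
  proof (intro allI AE_hausdorff_pos)
    fix j :: nat
    have 0: "0 < 1 - 1 / real (Suc (Suc j))" "1 - 1 / real (Suc (Suc j)) < 1" by (auto simp: field_simps)
    show "0 < \<tau> * (1 - 1 / real (Suc (Suc j)))" using \<tau> 0 by (intro mult_pos_pos)
    show "\<tau> * (1 - 1 / real (Suc (Suc j))) < s0 - 1"
      using mult_strict_left_mono[OF 0(2) \<tau>] by (simp add: \<tau>_def)
  qed
  from 1 2 AE_packing_pos show ?thesis
  proof eventually_elim
    case (elim x)
    show ?case
    proof
      assume g: "0 < g [] x"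
      have "hausdorff_dim (slice K z x) = \<tau>"
        using elim(1,2) g by (intro hausdorff_dim_eqI \<tau>) blast+
      then show "x \<in> good" using elim(3) g by (simp add: good_def \<tau>_def)
    qed
  qed
qed

end

section \<open>Null sets\<close>

text \<open>Vitali's covering lemma replaces the Lebesgue density theorem.\<close>

lemma emeasure_zero_if_no_density_points:
  fixes A :: "real set"
  assumes A: "A \<in> sets borel" and \<kappa>: "\<kappa> > 0"
    and por: "\<And>x e. x \<in> A \<Longrightarrow> e > 0 \<Longrightarrow> \<exists>r>0. r < e \<and> ennreal (\<kappa> * r) \<le> emeasure lborel (ball x r - A)"
  shows "emeasure lborel A = 0"
proof -
  have ball: "emeasure lborel (ball x r) = ennreal (2 * r)" if "r \<ge> 0" for x r :: real
    using that by (simp add: ball_eq_greaterThanLessThan)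
  have le: "emeasure lborel A \<le> ennreal (10 / \<kappa> * \<epsilon>)" if \<epsilon>: "\<epsilon> > 0" for \<epsilon>
  proof -
    obtain U where U: "open U" "A \<subseteq> U" "emeasure lborel (U - A) < ennreal \<epsilon>"
      using outer_regular_lborel[OF A \<epsilon>] by blast
    have "\<exists>r. 0 < r \<and> r \<le> 1 \<and> ball x r \<subseteq> U \<and> ennreal (\<kappa> * r) \<le> emeasure lborel (ball x r - A)" if x: "x \<in> A" for x
    proof -
      obtain e where e: "e > 0" "ball x e \<subseteq> U" using U x open_contains_ball by blast
      then obtain r where "r > 0" "r < min e 1" "ennreal (\<kappa> * r) \<le> emeasure lborel (ball x r - A)"
        using por[OF x, of "min e 1"] by auto
      moreover from this have "ball x r \<subseteq> ball x e" by (intro subset_ball) simp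
      ultimately show ?thesis using e by (intro exI[of _ r]) auto
    qed
    then obtain r where r: "\<And>x. x \<in> A \<Longrightarrow> 0 < r x \<and> r x \<le> 1" "\<And>x. x \<in> A \<Longrightarrow> ball x (r x) \<subseteq> U"
        "\<And>x. x \<in> A \<Longrightarrow> ennreal (\<kappa> * r x) \<le> emeasure lborel (ball x (r x) - A)" by metis
    have "A \<subseteq> (\<Union>x\<in>A. ball x (r x))" using r(1) by force
    then obtain C where C: "countable C" "C \<subseteq> A"
        "pairwise (\<lambda>x y. disjnt (ball x (r x)) (ball y (r y))) C"
        "A \<subseteq> (\<Union>x\<in>C. ball x (5 * r x))"
      using Vitali_covering_lemma_balls[where S = A and K = A and a = "\<lambda>x. x" and r = r and B = 1] r(1) by auto
    have fin: "emeasure lborel (\<Union>x\<in>F. ball x (5 * r x)) \<le> ennreal (10 / \<kappa> * \<epsilon>)" if F: "finite F" "F \<subseteq> C" for F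
    proof -
      have "emeasure lborel (\<Union>x\<in>F. ball x (5 * r x)) \<le> (\<Sum>x\<in>F. emeasure lborel (ball x (5 * r x)))"
        using F by (intro emeasure_subadditive_finite) auto
      also have "\<dots> \<le> (\<Sum>x\<in>F. ennreal (10 / \<kappa>) * emeasure lborel (ball x (r x) - A))"
      proof (intro sum_mono)
        fix x assume "x \<in> F"
        then have x: "x \<in> A" using F C by blast
        \<comment> \<open>The enlarged ball has length \<open>10 * r x\<close>, which is
          \<open>10 / \<kappa>\<close> times the guaranteed length outside \<open>A\<close>.\<close>
        have "emeasure lborel (ball x (5 * r x)) = ennreal (10 / \<kappa>) * ennreal (\<kappa> * r x)"
          using r(1)[OF x] \<kappa> by (simp add: ball ennreal_mult[symmetric])
        also have "\<dots> \<le> ennreal (10 / \<kappa>) * emeasure lborel (ball x (r x) - A)" by (intro mult_left_mono r(3) x) simp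
        finally show "emeasure lborel (ball x (5 * r x)) \<le> ennreal (10 / \<kappa>) * emeasure lborel (ball x (r x) - A)" .
      qed
      also have "\<dots> = ennreal (10 / \<kappa>) * (\<Sum>x\<in>F. emeasure lborel (ball x (r x) - A))" by (rule sum_distrib_left[symmetric])
      also have "(\<Sum>x\<in>F. emeasure lborel (ball x (r x) - A)) = emeasure lborel (\<Union>x\<in>F. ball x (r x) - A)"
      proof (rule sum_emeasure)
        show "disjoint_family_on (\<lambda>x. ball x (r x) - A) F"
          unfolding disjoint_family_on_def
        proof (intro ballI impI)
          fix x y assume "x \<in> F" "y \<in> F" "x \<noteq> y"
          then have "disjnt (ball x (r x)) (ball y (r y))" using C(3) F(2) by (auto simp: pairwise_def)
          then show "(ball x (r x) - A) \<inter> (ball y (r y) - A) = {}" unfolding disjnt_def by blast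
        qed
        show "(\<lambda>x. ball x (r x) - A) ` F \<subseteq> sets lborel" using A by (simp add: image_subset_iff)
      qed (rule F)
      also have "\<dots> \<le> emeasure lborel (U - A)"
      proof (rule emeasure_mono)
        show "(\<Union>x\<in>F. ball x (r x) - A) \<subseteq> U - A" using r(2) F(2) C(2) by blast
        show "U - A \<in> sets lborel" using U(1) A by simp
      qed
      also have "ennreal (10 / \<kappa>) * emeasure lborel (U - A) \<le> ennreal (10 / \<kappa>) * ennreal \<epsilon>"
        using less_imp_le[OF U(3)] by (rule mult_left_mono) simp
      also have "\<dots> = ennreal (10 / \<kappa> * \<epsilon>)" using \<kappa> by (intro ennreal_mult'[symmetric]) simp
      finally show ?thesis by (simp add: mult_left_mono)
    qed
    show ?thesis
    proof (cases "C = {}")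
      case True
      then have "A = {}" using C(4) by simp
      then show ?thesis by simp
    next
      case False
      define c where "c = from_nat_into C"
      have rc: "range c = C" unfolding c_def by (rule range_from_nat_into[OF False C(1)])
      define V where "V k = (\<Union>x\<in>c ` {..<k}. ball x (5 * r x))" for k
      have "emeasure lborel A \<le> emeasure lborel (\<Union>k. V k)"
      proof (rule emeasure_mono)
        show "A \<subseteq> (\<Union>k. V k)"
        proof
          fix y assume "y \<in> A"
          then obtain x where x: "x \<in> C" "y \<in> ball x (5 * r x)" using C(4) by blast
          then obtain i where "x = c i" using rc by blast
          then have "y \<in> V (Suc i)" using x by (auto simp: V_def)
          then show "y \<in> (\<Union>k. V k)" by blast
        qed
      qed (auto simp: V_def)
      also have "\<dots> = (SUP k. emeasure lborel (V k))"
      proof (rule SUP_emeasure_incseq[symmetric])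
        show "range V \<subseteq> sets lborel" unfolding V_def by (simp add: image_subset_iff)
        show "incseq V" unfolding V_def by (intro incseq_SucI) (auto simp: lessThan_Suc)
      qed
      also have "\<dots> \<le> ennreal (10 / \<kappa> * \<epsilon>)"
        unfolding V_def
      proof (intro SUP_least fin)
        fix k show "c ` {..<k} \<subseteq> C" unfolding rc[symmetric] by blast
      qed simp
      finally show ?thesis .
    qed
  qed
  have "emeasure lborel A \<le> 0"
  proof (rule ennreal_le_epsilon)
    fix \<epsilon> :: real assume "0 < \<epsilon>"
    then show "emeasure lborel A \<le> 0 + ennreal \<epsilon>" using le[of "\<epsilon> * \<kappa> / 10"] \<kappa> by simp
  qed
  then show ?thesis by simp
qed

text \<open>Since \<open>s0 - 1 > 0\<close>, empty slices are not good, which confines the good set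
  to the projection of \<open>K\<close>.\<close>

lemma hausdorff_dim_empty: "hausdorff_dim ({} :: 'a::euclidean_space set) = 0"
proof -
  have "hausdorff_measure t ({} :: 'a set) = 0" for t
  proof -
    have "hausdorff_premeasure t \<delta> ({} :: 'a set) \<le> 0" if "\<delta> \<in> {0<..}" for \<delta>
    proof -
      have "hausdorff_premeasure t \<delta> ({} :: 'a set) \<le> (\<Sum>i::nat. diam_gauge t ({} :: 'a set))"
        unfolding hausdorff_premeasure_def using that by (intro INF_lower) auto
      then show ?thesis by (simp add: diam_gauge_def)
    qed
    then have "hausdorff_measure t ({} :: 'a set) \<le> 0" unfolding hausdorff_measure_def by (rule SUP_least)
    then show ?thesis by simp
  qed
  then have "hausdorff_dim ({} :: 'a set) = Inf {0::real..}" by (simp add: hausdorff_dim_def atLeast_def)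
  then show ?thesis by simp
qed

lemma (in irrational_ifs) nu_cyl:
  assumes A: "A \<in> sets borel" and sub: "proj z ` f u ` K \<subseteq> A"
  shows "emeasure (nu z u) A = 1"
proof -
  have "emeasure (nu z u) A = (\<integral>\<^sup>+\<omega>. indicator A (proj z (f u (X \<omega>))) \<partial>\<Omega>)" by (rule emeasure_nu_nn_integral[OF A])
  also have "\<dots> = (\<integral>\<^sup>+\<omega>. 1 \<partial>\<Omega>)"
  proof (rule nn_integral_cong_AE)
    from X_in_K show "AE \<omega> in \<Omega>. indicator A (proj z (f u (X \<omega>))) = (1::ennreal)"
    proof eventually_elim
      case (elim \<omega>)
      then have "proj z (f u (X \<omega>)) \<in> A" using sub by blast
      then show ?case by simp
    qed
  qed
  finally show ?thesis by (simp add: \<Omega>.emeasure_space_1)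
qed

section \<open>Positivity of the density and comparison with Hausdorff measure\<close>

context projected_ifs
begin

lemma f_Nil_image: "f [] ` K = K"
  by (auto simp: image_iff)

lemma proj_K_sets [measurable]: "proj z ` K \<in> sets borel"
  using proj_cyl_sets[of "[]"] unfolding f_Nil_image .

text \<open>Around a point of \<open>proj z ` K\<close>, at every scale \<open>r\<close>, some projected cylinder measure is carried
  by an interval of length \<open>O(r)\<close> outside the set below, so the complement has length at least
  a constant times \<open>r\<close> there.\<close>

lemma g_zero_null: "emeasure lborel {x \<in> proj z ` K. g [] x = 0} = 0"
proof -
  define A where "A = {x \<in> proj z ` K. g [] x = 0}"
  have A: "A \<in> sets borel" unfolding A_def by measurable
  have "emeasure (nu z []) A = (\<integral>\<^sup>+x. ennreal (g [] x) * indicator A x \<partial>lborel)" by (rule emeasure_nu[OF A])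
  also have "\<dots> = (\<integral>\<^sup>+x. 0 \<partial>(lborel :: real measure))"
    by (rule nn_integral_cong) (auto simp: A_def indicator_def)
  finally have nuA: "emeasure (nu z []) A = 0" by simp
  \<comment> \<open>\<open>nu z []\<close> is an average of the cylinder measures with positive
    weights, so a null set of the average is null for each of them.\<close>
  have nuA': "A \<in> null_sets (nu z u)" if u: "u \<in> W k" for u k
  proof -
    have "(\<Sum>u\<in>W k. ennreal ((1 / real n) ^ k) * emeasure (nu z u) A) = 0"
      using nuA unfolding nu_words[OF A, of _ k] .
    then have "ennreal ((1 / real n) ^ k) * emeasure (nu z u) A = 0"
      using u by (subst (asm) sum_nonneg_eq_0_iff) auto
    then show ?thesis using n_pos A by (auto simp: null_sets_def)
  qed
  obtain D where D: "\<And>w. w \<in> K \<Longrightarrow> cmod w \<le> D"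
    using compact_imp_bounded[OF compact_K] by (auto simp: bounded_iff)
  have D0: "0 \<le> D" using K_nonempty D norm_ge_zero order_trans by blast
  \<comment> \<open>A cylinder of level \<open>k\<close> has mass 1 outside \<open>A\<close>, hence
    leaves length at least \<open>rho ^ k / Cnu\<close> there; \<kappa> expresses this in terms of
    the radius \<open>r = 4 * (D + 1) * rho ^ k\<close>.\<close>
  define \<kappa> where "\<kappa> = 1 / (4 * (D + 1) * Cnu)"
  have "emeasure lborel A = 0"
  proof (rule emeasure_zero_if_no_density_points[OF A])
    show "\<kappa> > 0" using D0 Cnu(1) by (simp add: \<kappa>_def)
    fix x e :: real assume x: "x \<in> A" and e: "e > 0"
    obtain k where "rho ^ k < e / (4 * (D + 1))" using real_arch_pow_inv[of "e / (4 * (D + 1))" rho] e D0 rho by auto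
    then have re: "4 * (D + 1) * rho ^ k < e" using D0 by (simp add: pos_less_divide_eq mult_ac)
    define r where "r = 4 * (D + 1) * rho ^ k"
    have r: "r > 0" using D0 rho by (simp add: r_def)
    obtain y where y: "y \<in> K" "x = proj z y" using x by (auto simp: A_def)
    obtain u w where uw: "u \<in> W k" "w \<in> K" "y = f u w" using K_words[OF y(1)] by blast
    interpret P: prob_space "nu z u" by (rule prob_nu)
    have "proj z ` f u ` K \<subseteq> ball x r"
    proof
      fix x' assume "x' \<in> proj z ` f u ` K"
      then obtain w' where w': "w' \<in> K" "x' = proj z (f u w')" by blast
      have "\<bar>x - x'\<bar> = \<bar>proj z (f u w - f u w')\<bar>" by (simp add: y uw w' proj_diff)
      also have "\<dots> \<le> cmod z * cmod (f u w - f u w')" by (rule abs_proj_le)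
      also have "\<dots> = rho ^ k * cmod (w - w')" using z uw(1) by (simp add: f_diff norm_mult norm_power rho_def words_def)
      also have "\<dots> \<le> rho ^ k * (D + D)"
        using norm_triangle_ineq4[of w w'] D[OF uw(2)] D[OF w'(1)] rho by (intro mult_left_mono) auto
      also have "\<dots> < rho ^ k * (4 * (D + 1))" using rho D0 by (intro mult_strict_left_mono) auto
      finally show "x' \<in> ball x r" by (simp add: r_def dist_real_def mult.commute)
    qed
    then have "emeasure (nu z u) (ball x r) = 1" by (intro nu_cyl) auto
    then have "emeasure (nu z u) (ball x r - A) = 1"
      by (subst emeasure_Diff_null_set[OF nuA'[OF uw(1)]]) auto
    then have "measure (nu z u) (ball x r - A) = 1" by (simp add: P.emeasure_eq_measure)
    then have 1: "1 \<le> ennreal (Cnu / rho ^ k) * emeasure lborel (ball x r - A)"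
      using nu_bound[OF z, of "ball x r - A" u] A uw(1) by (simp add: words_def)
    have "ennreal (\<kappa> * r) = ennreal (rho ^ k / Cnu) * 1" using D0 Cnu(1) by (simp add: \<kappa>_def r_def)
    also have "\<dots> \<le> ennreal (rho ^ k / Cnu) * (ennreal (Cnu / rho ^ k) * emeasure lborel (ball x r - A))"
      using 1 by (rule mult_left_mono) simp
    also have "\<dots> = emeasure lborel (ball x r - A)"
      using rho Cnu(1) by (simp add: mult.assoc[symmetric] ennreal_mult[symmetric])
    finally show "\<exists>r>0. r < e \<and> ennreal (\<kappa> * r) \<le> emeasure lborel (ball x r - A)"
      using r re unfolding r_def by blast
  qed
  then show ?thesis by (simp add: A_def)
qed

lemma good_sub: "good \<subseteq> proj z ` K"
proof
  fix x assume x: "x \<in> good"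
  have "slice K z x \<noteq> {}"
  proof
    assume "slice K z x = {}"
    then have "s0 - 1 = 0" using x by (simp add: good_def hausdorff_dim_empty)
    then show False using s0_gt_1 by simp
  qed
  then show "x \<in> proj z ` K" by (auto simp: slice_def)
qed

text \<open>The implication from right to left serves measurability: it makes \<open>good\<close>
  differ by a null set from a Borel set. It holds because \<open>good\<close> lies in the projection
  of \<open>K\<close>, where the density is almost everywhere positive.\<close>

lemma AE_good_iff: "AE x in lborel. 0 < g [] x \<longleftrightarrow> x \<in> good"
proof -
  have "{x \<in> proj z ` K. g [] x = 0} \<in> null_sets lborel"
    using g_zero_null by (intro null_setsI) measurable
  from AE_not_in[OF this] AE_good show ?thesis
  proof eventually_elim
    case (elim x)
    then show ?case using good_sub g_nonneg[of "[]" x] by (auto simp: less_le)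
  qed
qed

lemma nu_g_pos: "measure (nu z []) {x. 0 < g [] x} = 1"
proof -
  interpret P: prob_space "nu z []" by (rule prob_nu)
  have "emeasure (nu z []) {x. \<not> 0 < g [] x} = (\<integral>\<^sup>+x. ennreal (g [] x) * indicator {x. \<not> 0 < g [] x} x \<partial>lborel)"
    by (rule emeasure_nu) measurable
  also have "\<dots> = (\<integral>\<^sup>+x. 0 \<partial>(lborel :: real measure))"
    by (rule nn_integral_cong) (auto simp: indicator_def ennreal_eq_0_iff)
  finally have "measure (nu z []) {x. \<not> 0 < g [] x} = 0" by (simp add: measure_def)
  moreover have "{x. \<not> 0 < g [] x} = space (nu z []) - {x. 0 < g [] x}" by auto
  moreover have "{x. 0 < g [] x} \<in> sets (nu z [])" by simp
  ultimately show ?thesis using P.prob_compl[of "{x. 0 < g [] x}"] by simp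
qed

text \<open>The set where the density is positive has full mass, so its length is at least
  \<open>1 / Cnu\<close>; halving makes the inequality strict. The bound inherits the uniformity of
  \<open>Cnu\<close> in the direction.\<close>

lemma emeasure_good: "emeasure lebesgue good > ennreal (1 / (2 * Cnu))"
proof -
  define G where "G = {x. 0 < g [] x}"
  have G: "G \<in> sets borel" unfolding G_def by measurable
  have GL: "G \<in> sets lebesgue" using G by simp
  have ae: "AE x in lebesgue. x \<in> G \<longleftrightarrow> x \<in> good"
    using AE_completion[OF AE_good_iff] by (simp add: G_def)
  have good_sets: "good \<in> sets lebesgue"
    by (rule completion.in_sets_AE[OF ae GL]) simp
  have "emeasure lebesgue good = emeasure lebesgue G"
    using ae good_sets GL by (intro emeasure_eq_AE) auto
  also have "\<dots> = emeasure lborel G" using G by simp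
  finally have eq: "emeasure lebesgue good = emeasure lborel G" .
  have "1 \<le> ennreal Cnu * emeasure lborel G"
    using Cnu(2)[OF z G] nu_g_pos by (simp add: G_def)
  then have "ennreal (1 / Cnu) * 1 \<le> ennreal (1 / Cnu) * (ennreal Cnu * emeasure lborel G)"
    by (rule mult_left_mono) simp
  also have "\<dots> = emeasure lborel G"
    using Cnu(1) by (simp add: mult.assoc[symmetric] ennreal_mult[symmetric])
  finally have "ennreal (1 / Cnu) \<le> emeasure lborel G" by simp
  moreover have "ennreal (1 / (2 * Cnu)) < ennreal (1 / Cnu)" using Cnu(1) by (intro ennreal_lessI) (auto simp: field_simps)
  ultimately show ?thesis unfolding eq by simp
qed

text \<open>The cover consists of the minimal words (of length at least \<open>k0\<close>) whose cylinders project
  into an open set of small measure; passing from level \<open>l\<close> to level \<open>l + 1\<close> counts the new ones.\<close>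

lemma hausdorff_premeasure_le_nu:
  assumes U: "open U" and S: "S \<subseteq> K" "\<And>w. w \<in> S \<Longrightarrow> proj z w \<in> U"
    and D: "\<And>x y. x \<in> K \<Longrightarrow> y \<in> K \<Longrightarrow> dist x y \<le> D" "D > 0" and k0: "D * rho ^ k0 \<le> \<delta>"
  shows "hausdorff_premeasure s0 \<delta> S \<le> ennreal (D powr s0) * emeasure (nu z []) U"
proof -
  define Q where "Q u \<longleftrightarrow> k0 \<le> length u \<and> proj z ` f u ` K \<subseteq> U" for u
  define G where "G k = {u \<in> W k. Q u \<and> (k = 0 \<or> \<not> Q (butlast u))}" for k
  define N where "N k = (\<Sum>u\<in>W k. of_bool (Q u) :: real)" for k
  have finG: "finite (G k)" for k by (simp add: G_def)
  have child: "Q (v @ [i])" if "Q v" "i < n" for v i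
  proof -
    have "f (v @ [i]) ` K \<subseteq> f v ` K" using f_K[of "[i]"] that(2) by (auto simp: f_append)
    then show ?thesis using that(1) by (auto simp: Q_def)
  qed
  have cardG: "real (card (G k)) = (\<Sum>u\<in>W k. of_bool (Q u \<and> (k = 0 \<or> \<not> Q (butlast u))))" for k
    by (simp add: of_bool_def sum.If_cases G_def Int_def)
  have step: "N (Suc k) = real n * N k + real (card (G (Suc k)))" for k
  proof -
    have W1: "W 1 = (\<lambda>i. [i]) ` {..<n}" by (auto simp: words_def length_Suc_conv image_iff)
    have S1: "(\<Sum>u\<in>W (Suc k). h u) = (\<Sum>v\<in>W k. \<Sum>i<n. h (v @ [i]))" for h :: "nat list \<Rightarrow> real"
    proof -
      have "(\<Sum>u\<in>W (Suc k). h u) = (\<Sum>v\<in>W k. \<Sum>w\<in>W 1. h (v @ w))"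
        using sum_words_add[OF finite_lessThan, where m = k and l = 1 and f = h] by simp
      also have "\<dots> = (\<Sum>v\<in>W k. \<Sum>i<n. h (v @ [i]))"
        unfolding W1 by (intro sum.cong refl) (simp add: sum.reindex inj_on_def)
      finally show ?thesis .
    qed
    have "N (Suc k) = (\<Sum>v\<in>W k. \<Sum>i<n. of_bool (Q (v @ [i])))" unfolding N_def by (rule S1)
    also have "\<dots> = (\<Sum>v\<in>W k. real n * of_bool (Q v) + (\<Sum>i<n. of_bool (Q (v @ [i]) \<and> \<not> Q v)))"
    proof (intro sum.cong refl)
      fix v
      show "(\<Sum>i<n. of_bool (Q (v @ [i])) :: real) = real n * of_bool (Q v) + (\<Sum>i<n. of_bool (Q (v @ [i]) \<and> \<not> Q v))"
        using child by (cases "Q v") auto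
    qed
    also have "\<dots> = real n * N k + (\<Sum>v\<in>W k. \<Sum>i<n. of_bool (Q (v @ [i]) \<and> \<not> Q v))"
      by (simp add: sum.distrib N_def sum_distrib_left)
    also have "(\<Sum>v\<in>W k. \<Sum>i<n. of_bool (Q (v @ [i]) \<and> \<not> Q v)) = real (card (G (Suc k)))"
      unfolding cardG S1 by simp
    finally show ?thesis .
  qed
  \<comment> \<open>\<open>step\<close> telescopes: the cylinders of the minimal words up to level
    \<open>l\<close> carry the same total weight as all words of level \<open>l\<close> with
    property \<open>Q\<close>.\<close>
  have sumG: "(\<Sum>k\<le>l. real (card (G k)) * (1 / real n) ^ k) = N l * (1 / real n) ^ l" for l
  proof (induction l)
    case 0 then show ?case by (simp add: cardG N_def)
  next
    case (Suc l) then show ?case using n_pos by (simp add: step field_simps)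
  qed
  \<comment> \<open>A cylinder that projects into \<open>U\<close> has \<open>nu z u U = 1\<close>,
    and \<open>nu z [] U\<close> is the average of these values over the words of level
    \<open>l\<close>.\<close>
  have N_le: "ennreal (N l * (1 / real n) ^ l) \<le> emeasure (nu z []) U" for l
  proof -
    have "ennreal (N l * (1 / real n) ^ l) = ennreal (\<Sum>u\<in>W l. (1 / real n) ^ l * of_bool (Q u))"
      by (simp add: N_def sum_distrib_left mult.commute)
    also have "\<dots> = (\<Sum>u\<in>W l. ennreal ((1 / real n) ^ l * of_bool (Q u)))"
      by (rule sum_ennreal[symmetric]) simp
    also have "\<dots> \<le> (\<Sum>u\<in>W l. ennreal ((1 / real n) ^ l) * emeasure (nu z u) U)"
    proof (intro sum_mono)
      fix u
      show "ennreal ((1 / real n) ^ l * of_bool (Q u)) \<le> ennreal ((1 / real n) ^ l) * emeasure (nu z u) U"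
      proof (cases "Q u")
        case True
        then have "emeasure (nu z u) U = 1" using U by (intro nu_cyl) (auto simp: Q_def)
        then show ?thesis using True by simp
      qed simp
    qed
    also have "\<dots> = emeasure (nu z []) U" using U by (intro nu_words[symmetric]) simp
    finally show ?thesis .
  qed
  \<comment> \<open>The premeasure asks for covers indexed by natural numbers; words are coded by
    \<open>to_nat\<close>, so every \<open>V i\<close> is one cylinder or empty.\<close>
  define V where "V i = (\<Union>u\<in>{u. to_nat u = i \<and> u \<in> G (length u)}. f u ` K)" for i :: nat
  have V_eq: "V i = {} \<or> (\<exists>u. to_nat u = i \<and> u \<in> G (length u) \<and> V i = f u ` K)" for i
  proof (cases "\<exists>u. to_nat u = i \<and> u \<in> G (length u)")
    case True
    then obtain u where u: "to_nat u = i" "u \<in> G (length u)" by blast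
    then have "{u. to_nat u = i \<and> u \<in> G (length u)} = {u}" by (auto dest: injD[OF inj_to_nat])
    then have "V i = f u ` K" by (simp add: V_def)
    then show ?thesis using u by blast
  next
    case False
    then have "V i = {}" by (auto simp: V_def)
    then show ?thesis by blast
  qed
  have bK: "bounded K" by (rule compact_imp_bounded[OF compact_K])
  have dK: "diameter K \<le> D" using D by (intro diameter_le) (auto simp: dist_norm)
  have cyl: "bounded (f u ` K) \<and> diameter (f u ` K) \<le> D * rho ^ length u" for u
    using affine_image_diameter[OF bK dK K_nonempty, of "pt lam a u" "lam ^ length u"]
    by (simp add: f_def[abs_def] norm_power rho_def)
  have cover: "S \<subseteq> (\<Union>i. V i)"
  proof
    fix w assume w: "w \<in> S"
    obtain e where e: "e > 0" "ball (proj z w) e \<subseteq> U" using U S(2)[OF w] open_contains_ball by blast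
    obtain k1 where "rho ^ k1 < e / D" using real_arch_pow_inv[of "e / D" rho] e(1) D(2) rho by auto
    then have k1: "D * rho ^ k1 < e" using D(2) by (simp add: pos_less_divide_eq mult_ac)
    define k where "k = max k0 k1"
    obtain u y where u: "u \<in> W k" "y \<in> K" "w = f u y" using K_words[of w k] S(1) w by blast
    have lu: "length u = k" using u(1) by (simp add: words_def)
    have "proj z ` f u ` K \<subseteq> U"
    proof
      fix x assume "x \<in> proj z ` f u ` K"
      then obtain y' where y': "y' \<in> K" "x = proj z (f u y')" by blast
      have "\<bar>proj z w - x\<bar> = \<bar>proj z (f u y - f u y')\<bar>" by (simp add: u(3) y'(2) proj_diff)
      also have "\<dots> \<le> cmod z * cmod (f u y - f u y')" by (rule abs_proj_le)
      also have "\<dots> = rho ^ k * dist y y'" using z lu by (simp add: f_diff norm_mult norm_power rho_def dist_norm)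
      also have "\<dots> \<le> rho ^ k1 * D"
        using D(1)[OF u(2) y'(1)] D(2) rho by (intro mult_mono power_decreasing) (auto simp: k_def)
      also have "\<dots> < e" using k1 by (simp add: mult.commute)
      finally have "x \<in> ball (proj z w) e" by (simp add: dist_real_def)
      then show "x \<in> U" using e(2) by blast
    qed
    then have "Q (take k u)" by (simp add: Q_def lu k_def)
    \<comment> \<open>The shortest prefix with property \<open>Q\<close> is a minimal word, and its
      cylinder still contains \<open>w\<close>.\<close>
    define j where "j = (LEAST j. Q (take j u))"
    have Qj: "Q (take j u)" unfolding j_def by (rule LeastI[of "\<lambda>j. Q (take j u)", OF \<open>Q (take k u)\<close>])
    have jk: "j \<le> k" unfolding j_def by (rule Least_le[of "\<lambda>j. Q (take j u)", OF \<open>Q (take k u)\<close>])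
    have lj: "length (take j u) = j" using jk lu by simp
    have "take j u \<in> W j" using u(1) jk lu by (auto simp: words_def dest: in_set_takeD)
    moreover have "j = 0 \<or> \<not> Q (butlast (take j u))"
    proof (cases j)
      case (Suc i)
      then have "\<not> Q (take i u)" using not_less_Least[of i "\<lambda>j. Q (take j u)"] by (simp add: j_def[symmetric])
      moreover have "butlast (take j u) = take i u" using Suc jk lu by (simp add: butlast_take)
      ultimately show ?thesis by simp
    qed simp
    ultimately have "take j u \<in> G (length (take j u))" using Qj lj by (simp add: G_def)
    moreover have "w \<in> f (take j u) ` K"
    proof -
      have "w = f (take j u) (f (drop j u) y)" by (simp add: u(3) f_append[symmetric])
      moreover have "f (drop j u) y \<in> K" using u(1,2) by (intro f_K) (auto simp: words_def dest: in_set_dropD)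
      ultimately show ?thesis by blast
    qed
    ultimately have "w \<in> V (to_nat (take j u))" by (auto simp: V_def)
    then show "w \<in> (\<Union>i. V i)" by blast
  qed
  have small: "bounded (V i) \<and> diameter (V i) \<le> \<delta>" for i
    using V_eq[of i]
  proof
    assume "V i = {}"
    moreover have "0 \<le> \<delta>" using k0 D(2) rho by (auto intro: order_trans[rotated])
    ultimately show ?thesis by simp
  next
    assume "\<exists>u. to_nat u = i \<and> u \<in> G (length u) \<and> V i = f u ` K"
    then obtain u where u: "u \<in> G (length u)" "V i = f u ` K" by blast
    have "rho ^ length u \<le> rho ^ k0" using u(1) rho by (intro power_decreasing) (auto simp: G_def Q_def)
    then have "D * rho ^ length u \<le> \<delta>" using k0 D(2) mult_left_mono[of "rho ^ length u" "rho ^ k0" D] by linarith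
    then show ?thesis using cyl[of u] u(2) by auto
  qed
  have gauge: "diam_gauge s0 (f u ` K) \<le> ennreal (D powr s0 * (1 / real n) ^ length u)" for u
  proof -
    have "diameter (f u ` K) powr s0 \<le> (D * rho ^ length u) powr s0"
      using cyl[of u] s0_gt_1 by (intro powr_mono2) (auto simp: diameter_ge_0)
    also have "\<dots> = D powr s0 * (rho powr s0) ^ length u"
      using D(2) rho by (simp add: powr_mult powr_realpow[symmetric] powr_powr mult.commute)
    finally show ?thesis using s0_gt_1 by (simp add: rho_powr_s0 diam_gauge_def ennreal_leI)
  qed
  have "hausdorff_premeasure s0 \<delta> S \<le> (\<Sum>i. diam_gauge s0 (V i))"
    unfolding hausdorff_premeasure_def using cover small by (intro INF_lower) simp
  also have "\<dots> = (SUP k. \<Sum>i<k. diam_gauge s0 (V i))" by (rule suminf_eq_SUP)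
  also have "\<dots> \<le> ennreal (D powr s0) * emeasure (nu z []) U"
  proof (rule SUP_least)
    fix k
    define F where "F = {u :: nat list. to_nat u < k \<and> u \<in> G (length u)}"
    have "F \<subseteq> from_nat ` {..<k}"
    proof
      fix u assume "u \<in> F"
      then show "u \<in> from_nat ` {..<k}" by (intro image_eqI[of _ _ "to_nat u"]) (auto simp: F_def)
    qed
    then have finF: "finite F" by (rule finite_subset) simp
    have injF: "inj_on to_nat F" by (rule inj_on_subset[OF inj_to_nat]) simp
    \<comment> \<open>A partial sum involves finitely many words; they all belong to levels up to
      \<open>l\<close>, where \<open>sumG\<close> applies.\<close>
    define l where "l = Max (insert 0 (length ` F))"
    have l: "length u \<le> l" if "u \<in> F" for u unfolding l_def using finF that by (intro Max_ge) auto
    have "(\<Sum>i<k. diam_gauge s0 (V i)) = (\<Sum>i\<in>to_nat ` F. diam_gauge s0 (V i))"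
    proof (rule sum.mono_neutral_right)
      show "to_nat ` F \<subseteq> {..<k}" by (auto simp: F_def)
      show "\<forall>i\<in>{..<k} - to_nat ` F. diam_gauge s0 (V i) = 0"
      proof
        fix i assume i: "i \<in> {..<k} - to_nat ` F"
        have "V i = {}" using V_eq[of i] i by (auto simp: F_def)
        then show "diam_gauge s0 (V i) = 0" by (simp add: diam_gauge_def)
      qed
    qed simp
    also have "\<dots> = (\<Sum>u\<in>F. diam_gauge s0 (V (to_nat u)))" by (simp add: sum.reindex[OF injF])
    also have "\<dots> \<le> (\<Sum>u\<in>F. ennreal (D powr s0 * (1 / real n) ^ length u))"
    proof (intro sum_mono)
      fix u assume "u \<in> F"
      have "V (to_nat u) = {} \<or> V (to_nat u) = f u ` K" using V_eq[of "to_nat u"] by (auto dest: injD[OF inj_to_nat])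
      then show "diam_gauge s0 (V (to_nat u)) \<le> ennreal (D powr s0 * (1 / real n) ^ length u)"
      proof
        assume "V (to_nat u) = {}"
        then show ?thesis by (simp add: diam_gauge_def)
      next
        assume "V (to_nat u) = f u ` K"
        then show ?thesis using gauge[of u] by simp
      qed
    qed
    also have "\<dots> = ennreal (\<Sum>u\<in>F. D powr s0 * (1 / real n) ^ length u)" by (intro sum_ennreal) simp
    also have "\<dots> \<le> ennreal (\<Sum>u\<in>(\<Union>j\<le>l. G j). D powr s0 * (1 / real n) ^ length u)"
    proof (intro ennreal_leI sum_mono2)
      show "F \<subseteq> (\<Union>j\<le>l. G j)" using l by (auto simp: F_def)
    qed (auto simp: finG)
    also have "(\<Sum>u\<in>(\<Union>j\<le>l. G j). D powr s0 * (1 / real n) ^ length u)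
        = (\<Sum>j\<le>l. \<Sum>u\<in>G j. D powr s0 * (1 / real n) ^ length u)"
      by (rule sum.UNION_disjoint) (auto simp: finG, auto simp: G_def words_def)
    also have "\<dots> = (\<Sum>j\<le>l. D powr s0 * (real (card (G j)) * (1 / real n) ^ j))"
    proof (intro sum.cong refl)
      fix j
      have "(\<Sum>u\<in>G j. D powr s0 * (1 / real n) ^ length u) = (\<Sum>u\<in>G j. D powr s0 * (1 / real n) ^ j)"
        by (intro sum.cong refl) (auto simp: G_def words_def)
      then show "(\<Sum>u\<in>G j. D powr s0 * (1 / real n) ^ length u) = D powr s0 * (real (card (G j)) * (1 / real n) ^ j)"
        by (simp add: mult_ac)
    qed
    also have "\<dots> = D powr s0 * (N l * (1 / real n) ^ l)" unfolding sum_distrib_left[symmetric] sumG ..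
    also have "ennreal \<dots> = ennreal (D powr s0) * ennreal (N l * (1 / real n) ^ l)"
      by (intro ennreal_mult') simp
    also have "\<dots> \<le> ennreal (D powr s0) * emeasure (nu z []) U" by (intro mult_left_mono N_le) simp
    finally show "(\<Sum>i<k. diam_gauge s0 (V i)) \<le> ennreal (D powr s0) * emeasure (nu z []) U" .
  qed
  finally show ?thesis .
qed

text \<open>Outer regularity of the finite measure \<open>nu z []\<close> gives open sets containing
  \<open>B\<close> of arbitrarily small mass, and the premeasure bound for open sets has the same
  constant at every scale \<delta>.\<close>

lemma hausdorff_measure_zero_of_nu:
  assumes B: "B \<in> sets borel" "emeasure (nu z []) B = 0" and S: "S \<subseteq> K" "\<And>w. w \<in> S \<Longrightarrow> proj z w \<in> B"
  shows "hausdorff_measure s0 S = 0"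
proof -
  interpret P: prob_space "nu z []" by (rule prob_nu)
  have bK: "bounded K" by (rule compact_imp_bounded[OF compact_K])
  define D where "D = diameter K + 1"
  have D: "\<And>x y. x \<in> K \<Longrightarrow> y \<in> K \<Longrightarrow> dist x y \<le> D" "D > 0"
    using diameter_bounded_bound[OF bK] diameter_ge_0[OF bK] by (force simp: D_def)+
  have "hausdorff_premeasure s0 \<delta> S \<le> 0" if \<delta>: "\<delta> \<in> {0<..}" for \<delta>
  proof (rule ennreal_le_epsilon)
    fix \<epsilon> :: real assume \<epsilon>: "\<epsilon> > 0"
    have Dp: "D powr s0 > 0" using D(2) by simp
    have "(INF U \<in> {U. B \<subseteq> U \<and> open U}. emeasure (nu z []) U) = 0"
      using outer_regular[of "nu z []" B] B P.emeasure_finite by simp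
    also have "\<dots> < ennreal (\<epsilon> / D powr s0)" using \<epsilon> Dp by simp
    finally obtain U where U: "B \<subseteq> U" "open U" "emeasure (nu z []) U < ennreal (\<epsilon> / D powr s0)"
      unfolding INF_less_iff by blast
    obtain k0 where "rho ^ k0 < \<delta> / D" using real_arch_pow_inv[of "\<delta> / D" rho] \<delta> D(2) rho by auto
    then have k0: "D * rho ^ k0 \<le> \<delta>" using D(2) by (simp add: pos_less_divide_eq mult_ac)
    have "hausdorff_premeasure s0 \<delta> S \<le> ennreal (D powr s0) * emeasure (nu z []) U"
      using S U(1) by (intro hausdorff_premeasure_le_nu[OF U(2) _ _ D k0]) auto
    also have "\<dots> \<le> ennreal (D powr s0) * ennreal (\<epsilon> / D powr s0)"
      using less_imp_le[OF U(3)] by (rule mult_left_mono) simp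
    also have "\<dots> = ennreal (D powr s0 * (\<epsilon> / D powr s0))" by (intro ennreal_mult'[symmetric]) simp
    also have "D powr s0 * (\<epsilon> / D powr s0) = \<epsilon>" using Dp by simp
    finally show "hausdorff_premeasure s0 \<delta> S \<le> 0 + ennreal \<epsilon>" by simp
  qed
  then have "hausdorff_measure s0 S \<le> 0" unfolding hausdorff_measure_def by (rule SUP_least)
  then show ?thesis by simp
qed

text \<open>Points that are not good project into a Lebesgue null set or into the zero set of the
  density; both have mass 0, the first by absolute continuity.\<close>

lemma hausdorff_measure_not_good: "hausdorff_measure s0 {w \<in> K. proj z w \<notin> good} = 0"
proof -
  obtain N where N: "N \<in> null_sets lborel" "{x. \<not> (0 < g [] x \<longrightarrow> x \<in> good)} \<subseteq> N"
    using AE_good by (auto simp: eventually_ae_filter)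
  define B where "B = N \<union> {x. \<not> 0 < g [] x}"
  have G0: "{x. \<not> 0 < g [] x} \<in> null_sets (nu z [])"
  proof -
    interpret P: prob_space "nu z []" by (rule prob_nu)
    have m: "{x. 0 < g [] x} \<in> sets (nu z [])" by simp
    have "{x. \<not> 0 < g [] x} = space (nu z []) - {x. 0 < g [] x}" by auto
    then have "measure (nu z []) {x. \<not> 0 < g [] x} = 0" using P.prob_compl[OF m] nu_g_pos by simp
    then show ?thesis using m by (auto simp: P.emeasure_eq_measure intro!: null_setsI)
  qed
  have "N \<in> null_sets (nu z [])" using nu_ac N(1) by (auto simp: absolutely_continuous_def)
  then have "B \<in> null_sets (nu z [])" unfolding B_def using G0 by (rule null_sets.Un)
  then have "B \<in> sets borel" "emeasure (nu z []) B = 0" by auto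
  then show ?thesis
  proof (rule hausdorff_measure_zero_of_nu)
    show "proj z w \<in> B" if "w \<in> {w \<in> K. proj z w \<notin> good}" for w
      using that N(2) by (auto simp: B_def)
  qed auto
qed

end

text \<open>\<open>lam / cnj lam = cis (2 * Arg lam)\<close>; if a power of it were 1, the argument
  would be a rational multiple of pi.\<close>

lemma lam_rotation_not_root:
  fixes lam :: complex
  assumes "lam \<noteq> 0" and irr: "Arg lam \<notin> {pi * q | q. q \<in> \<rat>}" and k: "k > 0"
  shows "(lam / cnj lam) ^ k \<noteq> 1"
proof
  assume eq: "(lam / cnj lam) ^ k = 1"
  define \<theta> where "\<theta> = Arg lam"
  have "lam = of_real (cmod lam) * cis \<theta>" using rcis_cmod_Arg[of lam] by (simp add: rcis_def \<theta>_def)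
  then have "lam / cnj lam = (of_real (cmod lam) * cis \<theta>) / cnj (of_real (cmod lam) * cis \<theta>)" by simp
  also have "\<dots> = cis \<theta> / cis (- \<theta>)" using assms(1) by (simp add: cis_cnj)
  also have "\<dots> = cis (2 * \<theta>)" by (simp add: cis_divide)
  finally have "lam / cnj lam = cis (2 * \<theta>)" .
  from eq[unfolded this Complex.DeMoivre] have "cis (real k * (2 * \<theta>)) = 1" .
  then have "exp (\<i> * of_real (real k * (2 * \<theta>))) = 1" by (simp only: cis_conv_exp)
  then obtain j :: int where "real k * (2 * \<theta>) = of_int (2 * j) * pi" unfolding exp_eq_1 by auto
  then have "\<theta> = pi * (of_int j / of_nat k)" using k by (simp add: field_simps)
  moreover have "of_int j / of_nat k \<in> (\<rat> :: real set)" by simp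
  ultimately show False using irr unfolding \<theta>_def by blast
qed

theorem corollary3p4:
  fixes E' :: "complex set" and lam :: complex
    and L :: "'i set" and a :: "'i \<Rightarrow> complex"
    and K :: "complex set" and s :: real
  assumes "E' \<subseteq> ball 0 1" and "hausdorff_dim E' = 0" and "fourier_decay_outside E'"
    and "lam \<in> ball 0 1 - exceptional_set E'"
    and "lam \<noteq> 0" and "Arg lam \<notin> {pi * q | q. q \<in> \<rat>}"
    and "finite L" and "L \<noteq> {}"
    and "is_attractor L lam a K"
    and "strong_separation L lam a K"
    and "s = hausdorff_dim K" and "s > 1"
  shows "(\<forall>z \<in> sphere 0 1.
            hausdorff_measure s
              {w \<in> K. \<not> (hausdorff_dim (slice K z (proj z w)) = s - 1 \<and>
                         packing_measure (s - 1) (slice K z (proj z w)) > 0)} = 0) \<and>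
         (\<exists>c::real. c > 0 \<and>
           (\<forall>z \<in> sphere 0 1.
              emeasure lebesgue
                {x::real. hausdorff_dim (slice K z x) = s - 1 \<and>
                          packing_measure (s - 1) (slice K z x) > 0} > ennreal c))"
proof -
  define n where "n = card L"
  have lam: "lam \<noteq> 0" "cmod lam < 1" using assms(4,5) by auto
  have n_lam: "1 < real n * cmod lam"
  proof (rule ccontr)
    assume "\<not> 1 < real n * cmod lam"
    then have le: "real n * cmod lam \<le> 1" by simp
    \<comment> \<open>An exponent strictly between 1 and \<open>s\<close>: if
      \<open>n * |lam| \<le> 1\<close>, then \<open>n * |lam| powr t < 1\<close> and the natural
      covers force the dimension down to \<open>t\<close>.\<close>
    define t where "t = (1 + s) / 2"
    have t: "1 < t" "t < s" using assms(12) by (auto simp: t_def)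
    have "cmod lam powr t < cmod lam powr 1" using lam t by (intro powr_less_mono') auto
    then have "cmod lam powr t < cmod lam" using lam by simp
    moreover have "0 < n" unfolding n_def using assms(7,8) by (simp add: card_gt_0_iff)
    ultimately have "real n * cmod lam powr t < real n * cmod lam" by simp
    then have "real n * cmod lam powr t < 1" using le by linarith
    then have "hausdorff_measure t K = 0"
      using t by (intro attractor_hausdorff_zero[OF assms(7) lam assms(9)]) (auto simp: n_def)
    then have "hausdorff_dim K \<le> t"
      unfolding hausdorff_dim_def using t by (intro cInf_lower bdd_belowI[of _ 0]) auto
    then show False using t assms(11) by simp
  qed
  obtain h where h: "bij_betw h {0..<n} L" using ex_bij_betw_nat_finite[OF assms(7)] unfolding n_def by blast
  \<comment> \<open>The letters are relabelled by an initial segment of the natural numbers, the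
    index type of the decay hypothesis; the value 0 beyond \<open>n\<close> is the convention of
    \<open>digit_series\<close>.\<close>
  define a' where "a' i = (if i < n then a (h i) else 0)" for i
  have h_im: "h ` {..<n} = L" using bij_betw_imp_surj_on[OF h] by (simp add: atLeast0LessThan)
  have h_inj: "inj_on h {..<n}" using bij_betw_imp_inj_on[OF h] by (simp add: atLeast0LessThan)
  have img: "(\<lambda>w. lam * w + a' i) ` K = ifs_map lam a (h i) ` K" if "i < n" for i
    using that by (simp add: ifs_map_def a'_def)
  have K: "compact K" "K \<noteq> {}" "K = (\<Union>i\<in>L. ifs_map lam a i ` K)"
    using assms(9) by (auto simp only: is_attractor_def)
  interpret I: irrational_ifs n a' lam K E'
  proof unfold_locales
    show "a' i = 0" if "n \<le> i" for i using that by (simp add: a'_def)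
    show "K = (\<Union>i<n. (\<lambda>w. lam * w + a' i) ` K)"
    proof -
      have "(\<Union>i<n. (\<lambda>w. lam * w + a' i) ` K) = (\<Union>i\<in>{..<n}. ifs_map lam a (h i) ` K)"
        by (intro SUP_cong refl img) simp
      also have "\<dots> = (\<Union>i\<in>h ` {..<n}. ifs_map lam a i ` K)" by (simp only: image_image)
      also have "\<dots> = K" unfolding h_im using K(3) by (rule sym)
      finally show ?thesis by (rule sym)
    qed
    show "disjoint_family_on (\<lambda>i. (\<lambda>w. lam * w + a' i) ` K) {..<n}"
      unfolding disjoint_family_on_def
    proof (intro ballI impI)
      fix i j assume ij: "i \<in> {..<n}" "j \<in> {..<n}" "i \<noteq> j"
      then have "h i \<in> L" "h j \<in> L" "h i \<noteq> h j" using h_im inj_onD[OF h_inj] by blast+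
      then have "ifs_map lam a (h i) ` K \<inter> ifs_map lam a (h j) ` K = {}"
        using assms(10) unfolding strong_separation_def disjoint_family_on_def by blast
      then show "(\<lambda>w. lam * w + a' i) ` K \<inter> (\<lambda>w. lam * w + a' j) ` K = {}"
        using ij by (simp add: img)
    qed
    show "(lam / cnj lam) ^ k \<noteq> 1" if "k > 0" for k
      by (rule lam_rotation_not_root[OF assms(5,6) that])
    show "lam ^ k \<notin> E'" if "k > 0" for k
      using assms(4) that by (auto simp: exceptional_set_def)
  qed (use lam n_lam K assms(3) in auto)
  have s: "s = I.s0" using I.hausdorff_dim_K assms(11) by simp
  have P: "projected_ifs n a' lam K E' z" if "z \<in> sphere 0 1" for z
    using that by unfold_locales simp
  show ?thesis
  proof (intro conjI ballI)
    fix z :: complex assume z: "z \<in> sphere 0 1"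
    interpret projected_ifs n a' lam K E' z by (rule P[OF z])
    show "hausdorff_measure s
              {w \<in> K. \<not> (hausdorff_dim (slice K z (proj z w)) = s - 1 \<and>
                         packing_measure (s - 1) (slice K z (proj z w)) > 0)} = 0"
      using hausdorff_measure_not_good unfolding good_def s mem_Collect_eq .
  next
    show "\<exists>c::real. c > 0 \<and>
           (\<forall>z \<in> sphere 0 1.
              emeasure lebesgue
                {x::real. hausdorff_dim (slice K z x) = s - 1 \<and>
                          packing_measure (s - 1) (slice K z x) > 0} > ennreal c)"
    proof (intro exI[of _ "1 / (2 * I.Cnu)"] conjI ballI)
      show "1 / (2 * I.Cnu) > 0" using I.Cnu(1) by simp
      fix z :: complex assume z: "z \<in> sphere 0 1"
      interpret projected_ifs n a' lam K E' z by (rule P[OF z])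
      show "emeasure lebesgue
                {x::real. hausdorff_dim (slice K z x) = s - 1 \<and>
                          packing_measure (s - 1) (slice K z x) > 0} > ennreal (1 / (2 * I.Cnu))"
        using emeasure_good unfolding good_def s .
    qed
  qed
qed

end
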